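(* Let $m$ be a non-negative integer, let $w_1,\ldots,w_m\in l^2$ be orthonormal, let $p_1,\ldots,p_m\in\mathbb{R}$, and let $L=\{v\in l^2:\langle v,w_1\rangle=p_1,\ldots,\langle v,w_m\rangle=p_m\}$, an affine subspace of $l^2$ of finite codimension. Let $k$ be a positive integer and suppose that the image of $L$ under the coordinate projection $l^2\to\mathbb{R}^k$, $z\mapsto z_{(k)}=(z_1,\ldots,z_k)$, is all of $\mathbb{R}^k$. Let $\phi$ be a bounded Borel function on $\mathbb{R}^k$. Then $$\lim_{N\to\infty}\int_{S_{L_N}}\phi(x_1,\ldots,x_k)\,d\overline{\sigma}(x_1,\ldots,x_N)=\int_{\mathbb{R}^\infty}\phi(z_{(k)})\,d\mu(z),$$ where $S_{L_N}=L_N\cap S^{N-1}(\sqrt N)$, $\overline{\sigma}$ is the surface area measure on the sphere $S_{L_N}$ normalized to have unit total mass, and $\mu$ is the probability measure on $\mathbb{R}^\infty$ specified by the characteristic function $$\int_{\mathbb{R}^\infty}\exp\left(i\langle t,x\rangle\right)\,d\mu(x)=\exp\left(i\langle t,z^0\rangle-\tfrac12\|P_0t\|^2\right)\qquad\text{for all }t\in\mathbb{R}^\infty_0,$$ where $z^0$ is the point on $L$ closest to the origin and $P_0$ is the orthogonal projection in $l^2$ onto the subspace $L-z^0$.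
   Context: $l^2$ is the real Hilbert space of square-summable real sequences; $\mathbb{R}^\infty$ is the space of all real sequences $(x_n)_{n\ge1}$ with the product $\sigma$-algebra; $\mathbb{R}^\infty_0$ is the set of sequences with only finitely many nonzero entries (so $\mathbb{R}^\infty_0\subset l^2$), and $\langle t,x\rangle=\sum_j t_jx_j$ for $t\in\mathbb{R}^\infty_0$, $x\in\mathbb{R}^\infty$. $\mathbb{R}^N$ is identified with the subspace $\mathbb{R}^N\oplus\{0\}$ of $l^2$ via $z\mapsto(z,0,0,\ldots)$, and $L_N=L\cap\mathbb{R}^N$. $S^{N-1}(\sqrt N)$ is the sphere of radius $\sqrt N$ centered at $0$ in $\mathbb{R}^N$. For all large enough $N$, $L_N$ is nonempty, of codimension $m$ in $\mathbb{R}^N$, and its distance from $0$ is less than $\sqrt N$, so that $S_{L_N}$ is a sphere of positive radius in the affine space $L_N$; the limit is over such $N$. *)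

theory Defs
  imports "HOL-Probability.Probability"
begin

section \<open>The real Hilbert space of square-summable sequences\<close>

text \<open>Sequences are indexed from 0: the coordinate written $x_n$ ($n \ge 1$) in the usual notation
  is \<open>coord x (n - 1)\<close>.\<close>

typedef ell2 = "{x :: nat \<Rightarrow> real. summable (\<lambda>n. (x n)\<^sup>2)}"
  morphisms coord Abs_ell2
  by (intro exI[of _ "\<lambda>_. 0"]) simp

lemma summable_coord_power2: "summable (\<lambda>n. (coord x n)\<^sup>2)"
  using coord[of x] by simp

lemma ell2_eqI: "(\<And>n. coord x n = coord y n) \<Longrightarrow> x = y"
  using coord_inject[of x y] by blast

lemma summable_mult_square_summable:
  fixes x y :: "nat \<Rightarrow> real"
  assumes "summable (\<lambda>n. (x n)\<^sup>2)" "summable (\<lambda>n. (y n)\<^sup>2)"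
  shows "summable (\<lambda>n. x n * y n)"
proof (rule summable_comparison_test')
  show "summable (\<lambda>n. (x n)\<^sup>2 + (y n)\<^sup>2)"
    using assms by (rule summable_add)
  fix n
  have "0 \<le> (\<bar>x n\<bar> - \<bar>y n\<bar>)\<^sup>2" by simp
  hence "2 * (\<bar>x n\<bar> * \<bar>y n\<bar>) \<le> (x n)\<^sup>2 + (y n)\<^sup>2"
    by (simp add: power2_diff)
  moreover have "0 \<le> \<bar>x n\<bar> * \<bar>y n\<bar>" by simp
  ultimately have "\<bar>x n\<bar> * \<bar>y n\<bar> \<le> (x n)\<^sup>2 + (y n)\<^sup>2" by linarith
  thus "norm (x n * y n) \<le> (x n)\<^sup>2 + (y n)\<^sup>2" by (simp add: abs_mult)
qed

lemma summable_coord_mult: "summable (\<lambda>n. coord x n * coord y n)"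
  by (intro summable_mult_square_summable summable_coord_power2)

lemma square_summable_add:
  fixes x y :: "nat \<Rightarrow> real"
  assumes "summable (\<lambda>n. (x n)\<^sup>2)" "summable (\<lambda>n. (y n)\<^sup>2)"
  shows "summable (\<lambda>n. (x n + y n)\<^sup>2)"
proof -
  have "summable (\<lambda>n. (x n)\<^sup>2 + (y n)\<^sup>2 + 2 * (x n * y n))"
    by (intro summable_add assms summable_mult summable_mult_square_summable)
  thus ?thesis by (simp add: power2_sum mult.assoc)
qed

instantiation ell2 :: real_vector
begin

definition "0 = Abs_ell2 (\<lambda>_. 0)"
definition "x + y = Abs_ell2 (\<lambda>n. coord x n + coord y n)"
definition "- x = Abs_ell2 (\<lambda>n. - coord x n)"
definition "x - y = Abs_ell2 (\<lambda>n. coord x n - coord y n)"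
definition "c *\<^sub>R x = Abs_ell2 (\<lambda>n. c * coord x n)"

lemma coord_zero: "coord 0 n = 0"
  by (simp add: zero_ell2_def Abs_ell2_inverse)

lemma coord_add: "coord (x + y) n = coord x n + coord y n"
  using square_summable_add[OF summable_coord_power2 summable_coord_power2]
  by (simp add: plus_ell2_def Abs_ell2_inverse)

lemma coord_uminus: "coord (- x) n = - coord x n"
  using summable_coord_power2 by (simp add: uminus_ell2_def Abs_ell2_inverse)

lemma coord_diff: "coord (x - y) n = coord x n - coord y n"
  using square_summable_add[OF summable_coord_power2, of "\<lambda>n. - coord y n" x]
    summable_coord_power2
  by (simp add: minus_ell2_def Abs_ell2_inverse)

lemma coord_scaleR: "coord (c *\<^sub>R x) n = c * coord x n"
  using summable_mult[OF summable_coord_power2[of x], of "c\<^sup>2"]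
  by (simp add: scaleR_ell2_def Abs_ell2_inverse power_mult_distrib)

instance
  by standard
    (auto intro!: ell2_eqI simp: coord_zero coord_add coord_uminus coord_diff coord_scaleR
      algebra_simps)

end

lemmas coord_simps [simp] = coord_zero coord_add coord_uminus coord_diff coord_scaleR

instantiation ell2 :: real_inner
begin

definition inner_ell2 :: "ell2 \<Rightarrow> ell2 \<Rightarrow> real" where
  "inner_ell2 x y = (\<Sum>n. coord x n * coord y n)"
definition norm_ell2 :: "ell2 \<Rightarrow> real" where
  "norm_ell2 x = sqrt (inner x x)"
definition sgn_ell2 :: "ell2 \<Rightarrow> ell2" where
  "sgn_ell2 x = inverse (norm x) *\<^sub>R x"
definition dist_ell2 :: "ell2 \<Rightarrow> ell2 \<Rightarrow> real" where
  "dist_ell2 x y = norm (x - y)"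
definition uniformity_ell2 :: "(ell2 \<times> ell2) filter" where
  "uniformity_ell2 = (INF e\<in>{0<..}. principal {(x, y). dist x y < e})"
definition open_ell2 :: "ell2 set \<Rightarrow> bool" where
  "open_ell2 U = (\<forall>x\<in>U. \<forall>\<^sub>F (x', y) in uniformity. x' = x \<longrightarrow> y \<in> U)"

instance
proof
  fix x y z :: ell2 and r :: real and U :: "ell2 set"
  show "dist x y = norm (x - y)" by (rule dist_ell2_def)
  show "sgn x = x /\<^sub>R norm x" by (simp add: sgn_ell2_def)
  show "uniformity = (INF e\<in>{0<..}. principal {(x, y :: ell2). dist x y < e})"
    by (rule uniformity_ell2_def)
  show "open U = (\<forall>x\<in>U. \<forall>\<^sub>F (x', y) in uniformity. x' = x \<longrightarrow> y \<in> U)"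
    by (rule open_ell2_def)
  show "inner x y = inner y x" by (simp add: inner_ell2_def mult.commute)
  show "inner (x + y) z = inner x z + inner y z"
    by (simp add: inner_ell2_def distrib_right suminf_add summable_coord_mult)
  show "inner (r *\<^sub>R x) y = r * inner x y"
    by (simp add: inner_ell2_def mult.assoc suminf_mult summable_coord_mult)
  show "0 \<le> inner x x"
    by (simp add: inner_ell2_def suminf_nonneg summable_coord_mult)
  show "inner x x = 0 \<longleftrightarrow> x = 0"
  proof
    assume "inner x x = 0"
    hence "\<forall>n. coord x n * coord x n = 0"
      by (subst (asm) inner_ell2_def, subst (asm) suminf_eq_zero_iff)
        (auto simp: summable_coord_mult)
    thus "x = 0" by (auto intro!: ell2_eqI)
  qed (simp add: inner_ell2_def)
  show "norm x = sqrt (inner x x)" by (rule norm_ell2_def)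
qed

end

lemma norm_ell2_power2: "(norm x)\<^sup>2 = (\<Sum>n. (coord x n)\<^sup>2)"
  unfolding power2_norm_eq_inner inner_ell2_def by (simp add: power2_eq_square)

lemma sum_coord_power2_le: "(\<Sum>n<N. (coord x n)\<^sup>2) \<le> (norm x)\<^sup>2"
  unfolding norm_ell2_power2 by (intro sum_le_suminf summable_coord_power2) auto

lemma abs_coord_le_norm: "\<bar>coord x n\<bar> \<le> norm x"
proof -
  have "(coord x n)\<^sup>2 \<le> (\<Sum>i<Suc n. (coord x i)\<^sup>2)"
    by (simp add: sum_nonneg)
  also have "\<dots> \<le> (norm x)\<^sup>2" by (rule sum_coord_power2_le)
  finally show ?thesis by (simp add: abs_le_square_iff[symmetric])
qed

instance ell2 :: complete_space
proof
  fix X :: "nat \<Rightarrow> ell2"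
  assume X: "Cauchy X"
  have "\<exists>l. (\<lambda>i. coord (X i) n) \<longlonglongrightarrow> l" for n
  proof -
    have "Cauchy (\<lambda>i. coord (X i) n)"
      unfolding Cauchy_def
    proof (intro allI impI)
      fix e :: real assume "e > 0"
      then obtain M where M: "\<And>i j. i \<ge> M \<Longrightarrow> j \<ge> M \<Longrightarrow> dist (X i) (X j) < e"
        using X unfolding Cauchy_def by metis
      show "\<exists>M. \<forall>i\<ge>M. \<forall>j\<ge>M. dist (coord (X i) n) (coord (X j) n) < e"
      proof (intro exI allI impI)
        fix i j assume "i \<ge> M" "j \<ge> M"
        have "dist (coord (X i) n) (coord (X j) n) \<le> dist (X i) (X j)"
          using abs_coord_le_norm[of "X i - X j" n] by (simp add: dist_norm)
        also have "\<dots> < e" using M \<open>i \<ge> M\<close> \<open>j \<ge> M\<close> by blast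
        finally show "dist (coord (X i) n) (coord (X j) n) < e" .
      qed
    qed
    thus ?thesis using Cauchy_convergent convergent_def by metis
  qed
  then obtain l where l: "\<And>n. (\<lambda>i. coord (X i) n) \<longlonglongrightarrow> l n" by metis
  have tail: "(\<Sum>n<N. (coord (X i) n - l n)\<^sup>2) \<le> e\<^sup>2"
    if "\<And>j. j \<ge> M \<Longrightarrow> norm (X i - X j) \<le> e" for i M N and e :: real
  proof (rule tendsto_upperbound)
    show "(\<lambda>j. \<Sum>n<N. (coord (X i) n - coord (X j) n)\<^sup>2) \<longlonglongrightarrow> (\<Sum>n<N. (coord (X i) n - l n)\<^sup>2)"
      by (intro tendsto_intros l)
    show "\<forall>\<^sub>F j in sequentially. (\<Sum>n<N. (coord (X i) n - coord (X j) n)\<^sup>2) \<le> e\<^sup>2"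
    proof (rule eventually_sequentiallyI[of M])
      fix j assume "j \<ge> M"
      have "(\<Sum>n<N. (coord (X i) n - coord (X j) n)\<^sup>2) \<le> (norm (X i - X j))\<^sup>2"
        using sum_coord_power2_le[of "X i - X j" N] by simp
      also have "\<dots> \<le> e\<^sup>2" using that[OF \<open>j \<ge> M\<close>] by (simp add: power_mono)
      finally show "(\<Sum>n<N. (coord (X i) n - coord (X j) n)\<^sup>2) \<le> e\<^sup>2" .
    qed
  qed simp
  have sq: "summable (\<lambda>n. (coord (X i) n - l n)\<^sup>2)"
    if "\<And>j. j \<ge> M \<Longrightarrow> norm (X i - X j) \<le> e" for i M and e :: real
    by (rule summableI_nonneg_bounded[where x = "e\<^sup>2"]) (use tail[OF that] in auto)
  obtain M1 where M1: "\<And>i j. i \<ge> M1 \<Longrightarrow> j \<ge> M1 \<Longrightarrow> dist (X i) (X j) < 1"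
    using X unfolding Cauchy_def by (metis zero_less_one)
  have "summable (\<lambda>n. (coord (X M1) n - l n)\<^sup>2)"
    by (rule sq[where M = M1 and e = 1]) (use M1 in \<open>auto simp: dist_norm less_imp_le\<close>)
  hence "summable (\<lambda>n. (- (coord (X M1) n - l n) + coord (X M1) n)\<^sup>2)"
    by (intro square_summable_add summable_coord_power2) (simp add: power2_commute)
  hence "summable (\<lambda>n. (l n)\<^sup>2)" by simp
  hence cl: "coord (Abs_ell2 l) = l" by (simp add: Abs_ell2_inverse)
  have "X \<longlonglongrightarrow> Abs_ell2 l"
    unfolding lim_sequentially
  proof (intro allI impI)
    fix r :: real assume "r > 0"
    then obtain M where M: "\<And>i j. i \<ge> M \<Longrightarrow> j \<ge> M \<Longrightarrow> dist (X i) (X j) < r / 2"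
      using X unfolding Cauchy_def by (metis half_gt_zero)
    show "\<exists>M. \<forall>i\<ge>M. dist (X i) (Abs_ell2 l) < r"
    proof (intro exI allI impI)
      fix i assume "i \<ge> M"
      hence *: "\<And>j. j \<ge> M \<Longrightarrow> norm (X i - X j) \<le> r / 2"
        using M by (auto simp: dist_norm less_imp_le)
      have "(norm (X i - Abs_ell2 l))\<^sup>2 = (\<Sum>n. (coord (X i) n - l n)\<^sup>2)"
        by (simp add: norm_ell2_power2 cl)
      also have "\<dots> \<le> (r / 2)\<^sup>2"
        by (rule suminf_le_const[OF sq[OF *] tail[OF *]])
      finally have "norm (X i - Abs_ell2 l) \<le> r / 2"
        using \<open>r > 0\<close> by (simp add: power2_le_iff_abs_le)
      thus "dist (X i) (Abs_ell2 l) < r" using \<open>r > 0\<close> by (simp add: dist_norm)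
    qed
  qed
  thus "convergent X" by (auto simp: convergent_def)
qed

definition finitely_supported :: "ell2 set" where
  "finitely_supported = {t. finite {j. coord t j \<noteq> 0}}"

definition pairing :: "ell2 \<Rightarrow> (nat \<Rightarrow> real) \<Rightarrow> real" where
  "pairing t x = (\<Sum>j | coord t j \<noteq> 0. coord t j * x j)"

text \<open>The copy of $\mathbb{R}^N$ in \<open>ell2\<close> given by $z \mapsto (z, 0, 0, \ldots)$.\<close>

definition RN :: "nat \<Rightarrow> ell2 set" where
  "RN N = {x. \<forall>n\<ge>N. coord x n = 0}"

text \<open>The space $\mathbb{R}^k$ is represented by \<open>PiM {..<k} (\<lambda>_. borel)\<close>, whose elements are the
  functions that are \<open>undefined\<close> outside \<open>{..<k}\<close>.\<close>

definition first_coords :: "nat \<Rightarrow> (nat \<Rightarrow> real) \<Rightarrow> (nat \<Rightarrow> real)" where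
  "first_coords k z = restrict z {..<k}"

definition orthogonal_projection :: "'a::real_inner set \<Rightarrow> 'a \<Rightarrow> 'a" where
  "orthogonal_projection V x = (THE y. y \<in> V \<and> (\<forall>v\<in>V. inner (x - y) v = 0))"


section \<open>Hausdorff measure\<close>

text \<open>The convention $0^0 = 1$ applies to nonempty covering sets when \<open>d = 0\<close>.\<close>

definition diameter_weight :: "nat \<Rightarrow> 'a::metric_space set \<Rightarrow> ennreal" where
  "diameter_weight d U = (if U = {} then 0 else ennreal (diameter U ^ d))"

text \<open>The boundedness condition is needed because \<^const>\<open>diameter\<close> has no meaningful value on
  unbounded sets.\<close>

definition delta_covers :: "real \<Rightarrow> 'a::metric_space set \<Rightarrow> (nat \<Rightarrow> 'a set) set" where
  "delta_covers \<delta> A = {U. A \<subseteq> (\<Union>i. U i) \<and> (\<forall>i. bounded (U i) \<and> diameter (U i) \<le> \<delta>)}"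

definition hausdorff_pre :: "nat \<Rightarrow> real \<Rightarrow> 'a::metric_space set \<Rightarrow> ennreal" where
  "hausdorff_pre d \<delta> A = (INF U\<in>delta_covers \<delta> A. \<Sum>i. diameter_weight d (U i))"

definition hausdorff_outer :: "nat \<Rightarrow> 'a::metric_space set \<Rightarrow> ennreal" where
  "hausdorff_outer d A = (SUP \<delta>\<in>{0<..}. hausdorff_pre d \<delta> A)"

text \<open>The dimensional constant that makes this agree with Lebesgue measure is left out; it is
  immaterial for the normalized measures below.\<close>

definition hausdorff_measure :: "nat \<Rightarrow> 'a::metric_space measure" where
  "hausdorff_measure d = measure_of UNIV (sets borel) (hausdorff_outer d)"

lemma sets_hausdorff_measure [simp, measurable_cong]: "sets (hausdorff_measure d) = sets borel"
  unfolding hausdorff_measure_def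
  by (metis sets.sigma_sets_eq sets_measure_of space_borel top_greatest Pow_UNIV)

lemma space_hausdorff_measure [simp]: "space (hausdorff_measure d) = UNIV"
  unfolding hausdorff_measure_def by (simp add: space_measure_of_conv)

text \<open>\<^const>\<open>measure_of\<close> yields the null measure unless the given set function is countably additive,
  so we verify that it is, by Caratheodory's criterion for metric outer measures.\<close>

lemma hausdorff_pre_mono: "A \<subseteq> B \<Longrightarrow> hausdorff_pre d \<delta> A \<le> hausdorff_pre d \<delta> B"
  unfolding hausdorff_pre_def by (rule INF_superset_mono) (auto simp: delta_covers_def)

lemma hausdorff_pre_antimono: "\<delta> \<le> \<epsilon> \<Longrightarrow> hausdorff_pre d \<epsilon> A \<le> hausdorff_pre d \<delta> A"
  unfolding hausdorff_pre_def
  by (rule INF_superset_mono) (auto simp: delta_covers_def intro: order_trans)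

lemma hausdorff_pre_le_outer: "0 < \<delta> \<Longrightarrow> hausdorff_pre d \<delta> A \<le> hausdorff_outer d A"
  unfolding hausdorff_outer_def by (rule SUP_upper) simp

lemma hausdorff_outer_mono: "A \<subseteq> B \<Longrightarrow> hausdorff_outer d A \<le> hausdorff_outer d B"
  unfolding hausdorff_outer_def by (rule SUP_mono') (rule hausdorff_pre_mono)

lemma hausdorff_outer_empty: "hausdorff_outer d {} = 0"
proof -
  have "hausdorff_pre d \<delta> {} \<le> 0" if "\<delta> > 0" for \<delta>
    unfolding hausdorff_pre_def
    by (rule INF_lower2[where i = "\<lambda>_. {}"]) (use that in \<open>auto simp: delta_covers_def diameter_weight_def\<close>)
  thus ?thesis unfolding hausdorff_outer_def
    by (metis SUP_least greaterThan_iff le_zero_eq)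
qed

lemma hausdorff_pre_countably_subadditive:
  "hausdorff_pre d \<delta> (\<Union>n. A n) \<le> (\<Sum>n. hausdorff_pre d \<delta> (A n))"
proof (rule ennreal_le_epsilon)
  fix e :: real
  assume "0 < e" and fin: "(\<Sum>n. hausdorff_pre d \<delta> (A n)) < top"
  have "hausdorff_pre d \<delta> (A n) < hausdorff_pre d \<delta> (A n) + e * (1/2) ^ Suc n" for n
    using fin \<open>0 < e\<close> by (auto simp add: less_top dest!: ennreal_suminf_lessD)
  hence "\<exists>U\<in>delta_covers \<delta> (A n). (\<Sum>i. diameter_weight d (U i)) < hausdorff_pre d \<delta> (A n) + e * (1/2) ^ Suc n" for n
    by (subst (asm) hausdorff_pre_def, subst (asm) INF_less_iff) 
  then obtain B where B: "\<And>n. B n \<in> delta_covers \<delta> (A n)"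
    and Ble: "\<And>n. (\<Sum>i. diameter_weight d (B n i)) < hausdorff_pre d \<delta> (A n) + e * (1/2) ^ Suc n"
    by metis
  define C where "C = case_prod B o prod_decode"
  have "C \<in> delta_covers \<delta> (\<Union>n. A n)"
    unfolding delta_covers_def
  proof (intro CollectI conjI allI)
    show "(\<Union>n. A n) \<subseteq> (\<Union>i. C i)"
    proof
      fix x assume "x \<in> (\<Union>n. A n)"
      then obtain n i where "x \<in> B n i" using B unfolding delta_covers_def by blast
      hence "x \<in> C (prod_encode (n, i))" by (simp add: C_def)
      thus "x \<in> (\<Union>i. C i)" by blast
    qed
    fix i
    show "bounded (C i)" "diameter (C i) \<le> \<delta>"
      using B unfolding C_def delta_covers_def by (auto simp: split_def)
  qed
  hence "hausdorff_pre d \<delta> (\<Union>n. A n) \<le> (\<Sum>i. diameter_weight d (C i))"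
    unfolding hausdorff_pre_def by (rule INF_lower)
  also have "\<dots> = (\<Sum>n. \<Sum>i. diameter_weight d (B n i))"
    unfolding C_def comp_def
    using suminf_ennreal_2dimen[where f = "\<lambda>(n, i). diameter_weight d (B n i)"
        and g = "\<lambda>n. \<Sum>i. diameter_weight d (B n i)"]
    by (simp add: split_def)
  also have "\<dots> \<le> (\<Sum>n. hausdorff_pre d \<delta> (A n) + e * (1/2) ^ Suc n)"
    using Ble by (intro suminf_le) (auto intro: less_imp_le)
  also have "\<dots> = (\<Sum>n. hausdorff_pre d \<delta> (A n)) + (\<Sum>n. ennreal e * ennreal ((1/2) ^ Suc n))"
    using \<open>0 < e\<close>
    by (subst suminf_add[symmetric])
      (auto simp del: ennreal_suminf_cmult simp add: ennreal_mult[symmetric])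
  also have "\<dots> = (\<Sum>n. hausdorff_pre d \<delta> (A n)) + e"
    unfolding ennreal_suminf_cmult
    by (subst suminf_ennreal_eq[OF zero_le_power power_half_series]) auto
  finally show "hausdorff_pre d \<delta> (\<Union>n. A n) \<le> (\<Sum>n. hausdorff_pre d \<delta> (A n)) + e" .
qed

lemma hausdorff_outer_countably_subadditive:
  "hausdorff_outer d (\<Union>n. A n) \<le> (\<Sum>n. hausdorff_outer d (A n))"
proof -
  have "hausdorff_pre d \<delta> (\<Union>n. A n) \<le> (\<Sum>n. hausdorff_outer d (A n))" if "\<delta> > 0" for \<delta>
    using hausdorff_pre_countably_subadditive[of d \<delta> A]
    by (rule order_trans) (intro suminf_le hausdorff_pre_le_outer that summableI)
  thus ?thesis
    unfolding hausdorff_outer_def[of d "\<Union>n. A n"] by (intro SUP_least) auto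
qed

lemma outer_measure_space_hausdorff_outer: "outer_measure_space (Pow UNIV) (hausdorff_outer d)"
  using hausdorff_outer_mono hausdorff_outer_countably_subadditive hausdorff_outer_empty
  by (auto simp: outer_measure_space_def positive_def increasing_def countably_subadditive_def)

lemma hausdorff_pre_separated:
  fixes A B :: "'a::metric_space set"
  assumes r: "\<And>x y. x \<in> A \<Longrightarrow> y \<in> B \<Longrightarrow> r \<le> dist x y" and "\<delta> < r"
  shows "hausdorff_pre d \<delta> A + hausdorff_pre d \<delta> B \<le> hausdorff_pre d \<delta> (A \<union> B)"
  unfolding hausdorff_pre_def[of d \<delta> "A \<union> B"]
proof (rule INF_greatest)
  fix U assume U: "U \<in> delta_covers \<delta> (A \<union> B)"
  have \<delta>: "0 \<le> \<delta>"
    using U diameter_ge_0 unfolding delta_covers_def by (blast intro: order_trans)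
  define V where "V D i = (if U i \<inter> D = {} then {} else U i)" for D i
  have cov: "V D \<in> delta_covers \<delta> D" if "D \<subseteq> A \<union> B" for D
    using that U \<delta> unfolding delta_covers_def V_def by (auto split: if_splits) blast
  have disj: "V A i = {} \<or> V B i = {}" for i
  proof (rule ccontr)
    assume "\<not> ?thesis"
    then obtain x y where xy: "x \<in> U i" "x \<in> A" "y \<in> U i" "y \<in> B"
      unfolding V_def by (auto split: if_splits)
    have "dist x y \<le> \<delta>"
      using diameter_bounded_bound[of "U i" x y] U xy unfolding delta_covers_def
      by (blast intro: order_trans)
    with r[of x y] xy \<open>\<delta> < r\<close> show False by simp
  qed
  have le: "diameter_weight d (V A i) + diameter_weight d (V B i) \<le> diameter_weight d (U i)" for i
  proof -
    have "diameter_weight d (V D i) \<le> diameter_weight d (U i)" for D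
      by (simp add: V_def diameter_weight_def)
    thus ?thesis using disj[of i] by (auto simp: diameter_weight_def[of d "{}"])
  qed
  have "hausdorff_pre d \<delta> A + hausdorff_pre d \<delta> B
      \<le> (\<Sum>i. diameter_weight d (V A i)) + (\<Sum>i. diameter_weight d (V B i))"
    unfolding hausdorff_pre_def by (intro add_mono INF_lower cov) auto
  also have "\<dots> = (\<Sum>i. diameter_weight d (V A i) + diameter_weight d (V B i))"
    by (intro suminf_add summableI)
  also have "\<dots> \<le> (\<Sum>i. diameter_weight d (U i))"
    by (intro suminf_le le summableI)
  finally show "hausdorff_pre d \<delta> A + hausdorff_pre d \<delta> B \<le> (\<Sum>i. diameter_weight d (U i))" .
qed

lemma hausdorff_outer_separated:
  fixes A B :: "'a::metric_space set"
  assumes r: "\<And>x y. x \<in> A \<Longrightarrow> y \<in> B \<Longrightarrow> r \<le> dist x y" and "0 < r"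
  shows "hausdorff_outer d A + hausdorff_outer d B \<le> hausdorff_outer d (A \<union> B)"
proof -
  have "hausdorff_outer d A + hausdorff_outer d B
      = (SUP \<delta>\<in>{0<..}. hausdorff_pre d \<delta> A + hausdorff_pre d \<delta> B)"
    unfolding hausdorff_outer_def
  proof (rule SUP_add_directed_ennreal[symmetric])
    fix i j :: real assume "i \<in> {0<..}" "j \<in> {0<..}"
    thus "\<exists>k\<in>{0<..}. hausdorff_pre d i A + hausdorff_pre d j B
        \<le> hausdorff_pre d k A + hausdorff_pre d k B"
      by (intro bexI[of _ "min i j"] add_mono hausdorff_pre_antimono) auto
  qed
  also have "\<dots> \<le> hausdorff_outer d (A \<union> B)"
  proof (rule SUP_least)
    fix \<delta> :: real assume \<delta>: "\<delta> \<in> {0<..}"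
    let ?e = "min \<delta> (r / 2)"
    have "hausdorff_pre d \<delta> A + hausdorff_pre d \<delta> B \<le> hausdorff_pre d ?e A + hausdorff_pre d ?e B"
      by (intro add_mono hausdorff_pre_antimono) auto
    also have "\<dots> \<le> hausdorff_pre d ?e (A \<union> B)"
      using \<open>0 < r\<close> by (intro hausdorff_pre_separated[where r = r] r) auto
    also have "\<dots> \<le> hausdorff_outer d (A \<union> B)"
      using \<open>0 < r\<close> \<delta> by (intro hausdorff_pre_le_outer) auto
    finally show "hausdorff_pre d \<delta> A + hausdorff_pre d \<delta> B \<le> hausdorff_outer d (A \<union> B)" .
  qed
  finally show ?thesis .
qed

lemma closed_in_lambda_system:
  fixes F :: "'a::metric_space set"
  assumes F: "closed F"
  shows "F \<in> lambda_system UNIV (Pow UNIV) (hausdorff_outer d)"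
proof (cases "F = {}")
  case True
  thus ?thesis by (simp add: lambda_system_def hausdorff_outer_empty)
next
  case ne: False
  let ?H = "hausdorff_outer d :: 'a set \<Rightarrow> ennreal"
  have oms: "outer_measure_space (Pow UNIV) ?H" by (rule outer_measure_space_hausdorff_outer)
  have sub2: "?H (A \<union> B) \<le> ?H A + ?H B" for A B
  proof -
    have "subadditive (Pow UNIV) ?H"
      using oms unfolding outer_measure_space_def
      by (intro ring_of_sets.countably_subadditive_subadditive[OF ring_of_sets_Pow]) blast+
    hence "?H (A \<union> (B - A)) \<le> ?H A + ?H (B - A)"
      by (rule subadditiveD) auto
    also have "\<dots> \<le> ?H A + ?H B" by (intro add_left_mono hausdorff_outer_mono) auto
    finally show ?thesis by simp
  qed
  have "?H (A \<inter> F) + ?H (A - F) \<le> ?H A" for A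
  proof (cases "?H A = top")
    case True thus ?thesis by simp
  next
    case fin: False
    define B where "B n = {x \<in> A. 1 / real (Suc n) < infdist x F}" for n
    define C where "C n = B (Suc n) - B n" for n
    have infdist_diff: "infdist x F - infdist y F \<le> dist x y" for x y
      using infdist_triangle[of x F y] by simp
    have B_mono: "B i \<subseteq> B j" if "i \<le> j" for i j
    proof -
      have "1 / real (Suc j) \<le> 1 / real (Suc i)" using that by (simp add: frac_le)
      thus ?thesis unfolding B_def by auto
    qed
    have B_AF: "B n \<subseteq> A - F" for n
      unfolding B_def using ne by auto
    have U: "A - F = (\<Union>n. B n)"
    proof
      show "A - F \<subseteq> (\<Union>n. B n)"
      proof
        fix x assume x: "x \<in> A - F"
        hence "0 < infdist x F" using F ne in_closed_iff_infdist_zero[of F x] infdist_nonneg[of x F] by force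
        then obtain n where "inverse (real (Suc n)) < infdist x F" using reals_Archimedean by blast
        thus "x \<in> (\<Union>n. B n)" using x by (auto simp: B_def inverse_eq_divide)
      qed
    qed (use B_AF in blast)
    have C_bounds: "x \<in> A" "1 / real (n + 2) < infdist x F" "infdist x F \<le> 1 / real (n + 1)" if "x \<in> C n" for x n
      using that unfolding C_def B_def by auto
    have sep: "?H (\<Union>i<n. C (2 * i + a)) + ?H (C (2 * n + a)) \<le> ?H ((\<Union>i<n. C (2 * i + a)) \<union> C (2 * n + a))" for n a
    proof (rule hausdorff_outer_separated)
      define r where "r = 1 / real (2 * n + a) - 1 / real (2 * n + a + 1)"
      have "r > 0" if "n > 0"
        unfolding r_def using that by (simp add: frac_less2)
      thus "(if n = 0 then 1 else r) > 0" by simp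
      fix x y assume x: "x \<in> (\<Union>i<n. C (2 * i + a))" and y: "y \<in> C (2 * n + a)"
      from x obtain i where i: "i < n" "x \<in> C (2 * i + a)" by blast
      have "1 / real (2 * n + a) \<le> 1 / real (2 * i + a + 2)" using i by (intro divide_left_mono) auto
      also have "\<dots> < infdist x F" using C_bounds(2)[OF i(2)] by simp
      finally have "r \<le> infdist x F - infdist y F"
        using C_bounds(3)[OF y] unfolding r_def by simp
      also have "\<dots> \<le> dist x y" by (rule infdist_diff)
      finally show "(if n = 0 then 1 else r) \<le> dist x y" using i by simp
    qed
    have fsum: "(\<Sum>i<n. ?H (C (2 * i + a))) \<le> ?H (\<Union>i<n. C (2 * i + a))" for n a
    proof (induction n)
      case 0 show ?case by simp
    next
      case (Suc n)
      have "(\<Sum>i<Suc n. ?H (C (2 * i + a))) \<le> ?H (\<Union>i<n. C (2 * i + a)) + ?H (C (2 * n + a))"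
        using Suc by (simp add: add_right_mono)
      also have "\<dots> \<le> ?H ((\<Union>i<n. C (2 * i + a)) \<union> C (2 * n + a))" by (rule sep)
      also have "(\<Union>i<n. C (2 * i + a)) \<union> C (2 * n + a) = (\<Union>i<Suc n. C (2 * i + a))"
        by (auto simp: lessThan_Suc)
      finally show ?case .
    qed
    have bound: "(\<Sum>i<n. ?H (C (2 * i + a))) \<le> ?H A" for n a
      using fsum[of a n] by (rule order_trans) (rule hausdorff_outer_mono, use C_bounds(1) in blast)
    have total: "(\<Sum>i<n. ?H (C i)) \<le> ?H A + ?H A" for n
    proof -
      have "(\<Sum>i<n. ?H (C i)) \<le> (\<Sum>i<2 * n. ?H (C i))" by (rule sum_mono2) auto
      also have "\<dots> = (\<Sum>i<n. ?H (C (2 * i + 0))) + (\<Sum>i<n. ?H (C (2 * i + 1)))"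
        by (induction n) (auto simp: algebra_simps)
      also have "\<dots> \<le> ?H A + ?H A" by (intro add_mono bound)
      finally show ?thesis .
    qed
    have sumfin: "(\<Sum>i. ?H (C i)) \<noteq> top"
    proof -
      have "(\<Sum>i. ?H (C i)) \<le> ?H A + ?H A"
        by (rule suminf_le_const[OF summableI]) (rule total)
      also have "\<dots> < top" using fin by (simp add: less_top)
      finally show ?thesis by simp
    qed
    have tl: "?H (A - F) \<le> ?H (B n) + (\<Sum>i. ?H (C (i + n)))" for n
    proof -
      have "A - F \<subseteq> B n \<union> (\<Union>i. C (i + n))"
      proof
        fix x assume x: "x \<in> A - F"
        show "x \<in> B n \<union> (\<Union>i. C (i + n))"
        proof (cases "x \<in> B n")
          case False
          define k where "k = (LEAST k. x \<in> B k)"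
          have "\<exists>k. x \<in> B k" using x U by blast
          hence k: "x \<in> B k" unfolding k_def by (rule LeastI_ex)
          have "n < k" using False k B_mono[of k n] by (meson not_le subsetD)
          then obtain i where i: "k = Suc (i + n)" by (metis add.commute less_imp_Suc_add)
          have "x \<notin> B (i + n)" using not_less_Least[of "i + n" "\<lambda>k. x \<in> B k"] i k_def by simp
          thus ?thesis using k i unfolding C_def by blast
        qed simp
      qed
      hence "?H (A - F) \<le> ?H (B n \<union> (\<Union>i. C (i + n)))" by (rule hausdorff_outer_mono)
      also have "\<dots> \<le> ?H (B n) + ?H (\<Union>i. C (i + n))" by (rule sub2)
      also have "\<dots> \<le> ?H (B n) + (\<Sum>i. ?H (C (i + n)))"
        by (intro add_left_mono hausdorff_outer_countably_subadditive)
      finally show ?thesis .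
    qed
    have AFB: "?H (A \<inter> F) + ?H (B n) \<le> ?H A" for n
    proof -
      have "?H (A \<inter> F) + ?H (B n) \<le> ?H (A \<inter> F \<union> B n)"
      proof (rule hausdorff_outer_separated)
        fix x y assume "x \<in> A \<inter> F" "y \<in> B n"
        hence "1 / real (Suc n) < infdist y F" "infdist x F = 0" unfolding B_def by auto
        thus "1 / real (Suc n) \<le> dist x y" using infdist_diff[of y x] by (simp add: dist_commute)
      qed simp
      also have "\<dots> \<le> ?H A" using B_AF[of n] by (intro hausdorff_outer_mono) auto
      finally show ?thesis .
    qed
    have step: "?H (A \<inter> F) + ?H (A - F) \<le> ?H A + (\<Sum>i. ?H (C (i + n)))" for n
    proof -
      have "?H (A \<inter> F) + ?H (A - F) \<le> ?H (A \<inter> F) + (?H (B n) + (\<Sum>i. ?H (C (i + n))))"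
        by (intro add_left_mono tl)
      also have "\<dots> \<le> ?H A + (\<Sum>i. ?H (C (i + n)))"
        using AFB[of n] by (simp add: add.assoc[symmetric] add_right_mono)
      finally show ?thesis .
    qed
    define c where "c i = enn2real (?H (C i))" for i
    have Cfin: "?H (C i) \<noteq> top" for i
      using sumfin ennreal_suminf_lessD[of "\<lambda>i. ?H (C i)" top i] by (auto simp: less_top)
    have HC: "?H (C i) = ennreal (c i)" for i
      using Cfin[of i] by (simp add: c_def less_top)
    have c0: "c i \<ge> 0" for i by (simp add: c_def)
    have cs: "summable c"
      using sumfin unfolding HC by (intro summable_suminf_not_top c0)
    have "(\<lambda>n. ?H A + ennreal (\<Sum>i. c (i + n))) \<longlonglongrightarrow> ?H A + ennreal 0"
      by (intro tendsto_add tendsto_const tendsto_ennrealI suminf_exist_split2 cs)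
    moreover have "(\<Sum>i. ?H (C (i + n))) = ennreal (\<Sum>i. c (i + n))" for n
      unfolding HC by (intro suminf_ennreal2 c0) (simp add: cs summable_iff_shift)
    ultimately have "(\<lambda>n. ?H A + (\<Sum>i. ?H (C (i + n)))) \<longlonglongrightarrow> ?H A" by simp
    thus ?thesis by (rule LIMSEQ_le_const) (use step in blast)
  qed
  moreover have "?H A \<le> ?H (A \<inter> F) + ?H (A - F)" for A
    using sub2[of "A \<inter> F" "A - F"] by (simp add: Int_Diff_Un)
  ultimately have "?H (A \<inter> F) + ?H (A - F) = ?H A" for A
    by (meson antisym)
  thus ?thesis
    by (subst algebra.lambda_system_eq[OF algebra_Pow]) auto
qed

lemma emeasure_hausdorff_measure:
  fixes A :: "'a::metric_space set"
  assumes "A \<in> sets borel"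
  shows "emeasure (hausdorff_measure d) A = hausdorff_outer d A"
proof -
  let ?L = "lambda_system UNIV (Pow UNIV) (hausdorff_outer d :: 'a set \<Rightarrow> ennreal)"
  have ms: "measure_space UNIV ?L (hausdorff_outer d)"
    by (rule sigma_algebra.caratheodory_lemma[OF sigma_algebra_Pow outer_measure_space_hausdorff_outer])
  hence sa: "sigma_algebra UNIV ?L" by (simp add: measure_space_def)
  have "sets (borel :: 'a measure) = sigma_sets UNIV (Collect closed)"
    by (simp add: borel_eq_closed)
  also have "\<dots> \<subseteq> ?L"
    by (intro sigma_algebra.sigma_sets_subset[OF sa] subsetI closed_in_lambda_system) blast
  finally have "sets (borel :: 'a measure) \<subseteq> ?L" .
  hence "measure_space UNIV (sets (borel :: 'a measure)) (hausdorff_outer d)"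
    using measure_down[OF ms] sets.sigma_algebra_axioms[of "borel :: 'a measure"] by simp
  thus ?thesis
    unfolding hausdorff_measure_def
    by (intro emeasure_measure_of_sigma assms) (simp_all add: measure_space_def)
qed

text \<open>The surface area measure on a \<open>d\<close>-dimensional sphere \<open>S\<close> is the restriction to \<open>S\<close> of the
  \<open>d\<close>-dimensional Hausdorff measure. As a measure on the ambient space it is carried by \<open>S\<close>.
  In an affine subspace of \<open>RN N\<close> of codimension \<open>m\<close>, spheres have \<open>d = N - m - 1\<close>.\<close>

definition normalized_surface_measure :: "nat \<Rightarrow> 'a::metric_space set \<Rightarrow> 'a measure" where
  "normalized_surface_measure d S = uniform_measure (hausdorff_measure d) S"

end

theory Submission
  imports Defs
begin

text \<open>The normalized surface measure of a sphere is invariant under the reflections of its affine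
  hull, so its characteristic function, in orthonormal coordinates, depends only on the norm of the
  frequency. Lebesgue measure on a thin shell has the same property, and exchanging the roles of
  variable and frequency shows that the shell approximates the sphere. Computing the marginal of the
  shell with Fubini's theorem and letting its thickness tend to 0 gives the density of the first
  \<open>k\<close> coordinates on the sphere of radius \<open>r\<close> in \<open>n\<close> dimensions: it is proportional to
  \<open>(r\<^sup>2 - \<bar>y\<bar>\<^sup>2)\<close> to the power \<open>(n - k) / 2 - 1\<close>, which after normalization tends to the Gaussian density.

  Applying the Gram-Schmidt process to the truncated \<open>w\<^sub>1, \<dots>, w\<^sub>m\<close> followed by the first
  \<open>k\<close> standard basis vectors yields coordinates in which the projection to $\mathbb{R}^k$ is a triangular
  affine map. Its coefficients converge as \<open>N \<rightarrow> \<infinity>\<close>, and the limit is nonsingular because \<open>L\<close>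
  projects onto $\mathbb{R}^k$. Hence the densities on $\mathbb{R}^k$ converge pointwise, and
  Scheffe's lemma gives convergence in total variation, which covers bounded Borel functions.\<close>


section \<open>Characteristic functions on finite products\<close>

text \<open>The affine maps vary with N and \<open>\<phi>\<close> need not be continuous, so the
  maps are moved into densities on one fixed space. Of the Hausdorff measure of a sphere three facts
  enter: it is finite, positive and invariant under reflections. One reflection carries a frequency
  to any given one of the same norm, so reflections do the work of rotations. The exponent
  \<open>(n - k) / 2 - 1\<close> is that of the derivative, in the squared radius, of the volume of
  a ball of dimension n - k; the constant of that volume cancels. The truncated w are no longer
  orthonormal, but their Gram matrix tends to the identity, and the Gram-Schmidt coefficients are
  continuous functions of Gram matrices with nonzero residuals; so frames for different N need not
  be compared as vectors. The measure \<open>\<mu>\<close> enters only at the end: its marginal on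
  the first k entries is recognized, by characteristic functions, as the image of the standard
  Gaussian under the limiting triangular map.\<close>

abbreviation borel_fun :: "'i set \<Rightarrow> ('i \<Rightarrow> real) measure" where
  "borel_fun I \<equiv> PiM I (\<lambda>_. borel)"

abbreviation lebesgue_fun :: "'i set \<Rightarrow> ('i \<Rightarrow> real) measure" where
  "lebesgue_fun I \<equiv> PiM I (\<lambda>_. lborel)"

abbreviation gauss_fun :: "'i set \<Rightarrow> ('i \<Rightarrow> real) measure" where
  "gauss_fun I \<equiv> PiM I (\<lambda>_. std_normal_distribution)"

definition char_fun :: "'i set \<Rightarrow> ('i \<Rightarrow> real) measure \<Rightarrow> ('i \<Rightarrow> real) \<Rightarrow> complex" where
  "char_fun I M t = (CLINT x|M. iexp (\<Sum>i\<in>I. t i * x i))"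

interpretation lborel_prod: product_sigma_finite "\<lambda>_::'i. lborel :: real measure"
  by standard

interpretation normal_prob: prob_space std_normal_distribution
  by (rule prob_space_normal_density) simp

interpretation normal_prod: product_prob_space "\<lambda>_::'i. std_normal_distribution" for I :: "'i set"
  by standard

lemma prob_space_gauss_fun: "prob_space (gauss_fun I)"
  by (rule prob_space_PiM) (rule normal_prob.prob_space_axioms)

lemma sets_lebesgue_fun [measurable_cong]: "sets (lebesgue_fun I) = sets (borel_fun I)"
  by (intro sets_PiM_cong) simp_all

lemma sets_gauss_fun [measurable_cong]: "sets (gauss_fun I) = sets (borel_fun I)"
  by (intro sets_PiM_cong) simp_all

lemma char_fun_gauss:
  assumes "finite I"
  shows "char_fun I (gauss_fun I) t = complex_of_real (exp (- (\<Sum>i\<in>I. (t i)\<^sup>2) / 2))"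
proof -
  have "char_fun I (gauss_fun I) t = (CLINT x|gauss_fun I. (\<Prod>i\<in>I. iexp (t i * x i)))"
    unfolding char_fun_def by (simp add: exp_sum assms sum_distrib_left flip: of_real_mult)
  also have "\<dots> = (\<Prod>i\<in>I. CLINT x|std_normal_distribution. iexp (t i * x))"
  proof (rule normal_prod.product_integral_prod[OF assms])
    fix i
    show "integrable std_normal_distribution (\<lambda>x. iexp (t i * x))"
      by (rule normal_prob.integrable_iexp) auto
  qed
  also have "\<dots> = (\<Prod>i\<in>I. complex_of_real (exp (- (t i)\<^sup>2 / 2)))"
    using char_std_normal_distribution unfolding char_def fun_eq_iff by simp
  also have "\<dots> = complex_of_real (\<Prod>i\<in>I. exp (- (t i)\<^sup>2 / 2))"
    by simp
  also have "(\<Prod>i\<in>I. exp (- (t i)\<^sup>2 / 2)) = exp (- (\<Sum>i\<in>I. (t i)\<^sup>2) / 2)"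
    by (simp add: exp_sum[OF assms, symmetric] sum_negf sum_divide_distrib)
  finally show ?thesis .
qed

section \<open>Gaussian smoothing and uniqueness of characteristic functions\<close>

abbreviation gauss_kernel :: "'i set \<Rightarrow> real \<Rightarrow> ('i \<Rightarrow> real) \<Rightarrow> ('i \<Rightarrow> real) \<Rightarrow> real" where
  "gauss_kernel I \<tau> x y \<equiv> (\<Prod>i\<in>I. exp (- (\<tau> * (x i - y i))\<^sup>2 / 2))"

text \<open>The Gaussian kernel is itself the characteristic function of a Gaussian, at the
  frequency \<tau> (x - y), so Fubini turns the smoothed measure into an integral of
  \<open>char_fun I M\<close>. Integrating over the probability measure \<open>gauss_fun I\<close>
  avoids the integrability of \<open>char_fun I M\<close> that Fourier inversion would
  demand.\<close>

lemma integral_gaussian_kernel_char_fun: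
  assumes I: "finite I" and M: "prob_space M" "sets M = sets (borel_fun I)"
  shows "complex_of_real (\<integral>x. gauss_kernel I \<tau> x y \<partial>M) =
    (CLINT s|gauss_fun I. iexp (- (\<Sum>i\<in>I. \<tau> * s i * y i)) * char_fun I M (\<lambda>i. \<tau> * s i))"
proof -
  note [measurable_cong] = M(2)
  interpret M: prob_space M by fact
  interpret G: prob_space "gauss_fun I" by (rule prob_space_gauss_fun)
  interpret MG: pair_prob_space M "gauss_fun I" ..
  let ?f = "\<lambda>x s. iexp (\<Sum>i\<in>I. (\<tau> * (x i - y i)) * s i)"
  have f: "iexp (\<Sum>i\<in>I. (\<tau> * (x i - y i)) * s i) =
      iexp (- (\<Sum>i\<in>I. \<tau> * s i * y i)) * iexp (\<Sum>i\<in>I. \<tau> * s i * x i)" for x s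
  proof -
    have "(\<Sum>i\<in>I. (\<tau> * (x i - y i)) * s i) = - (\<Sum>i\<in>I. \<tau> * s i * y i) + (\<Sum>i\<in>I. \<tau> * s i * x i)"
      by (simp add: algebra_simps sum_subtractf)
    thus ?thesis by (simp only: of_real_add distrib_left exp_add)
  qed
  have "complex_of_real (gauss_kernel I \<tau> x y) = (CLINT s|gauss_fun I. ?f x s)" for x
    using char_fun_gauss[OF I, of "\<lambda>i. \<tau> * (x i - y i)"] unfolding char_fun_def
    by (simp add: exp_sum[OF I, symmetric] sum_negf sum_divide_distrib[symmetric])
  hence "complex_of_real (\<integral>x. gauss_kernel I \<tau> x y \<partial>M) =
      (CLINT x|M. (CLINT s|gauss_fun I. ?f x s))"
    by (simp flip: integral_complex_of_real)
  also have "\<dots> = (CLINT s|gauss_fun I. (CLINT x|M. ?f x s))"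
  proof (rule MG.Fubini_integral[symmetric])
    show "integrable (M \<Otimes>\<^sub>M gauss_fun I) (\<lambda>(x, s). ?f x s)"
      by (rule MG.P.integrable_const_bound[where B = 1])
         (auto simp del: of_real_sum of_real_mult)
  qed
  also have "\<dots> = (CLINT s|gauss_fun I. iexp (- (\<Sum>i\<in>I. \<tau> * s i * y i)) * char_fun I M (\<lambda>i. \<tau> * s i))"
    by (simp only: f char_fun_def integral_mult_right_zero)
  finally show ?thesis .
qed

text \<open>The substitution y = x + z / (n + 1) turns the integral into the mean of f (x + z / (n +
  1)) over a standard normal z; dominated convergence then applies since f is continuous and at most
  1.\<close>

lemma nn_integral_normal_kernel_tendsto:
  fixes f :: "real \<Rightarrow> real"
  assumes f: "continuous_on UNIV f" and f0: "\<And>x. 0 \<le> f x" and f1: "\<And>x. f x \<le> 1"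
  shows "(\<lambda>n. \<integral>\<^sup>+y. ennreal (f y) * ennreal (real (Suc n) / sqrt (2 * pi) * exp (- (real (Suc n) * (x - y))\<^sup>2 / 2)) \<partial>lborel)
    \<longlonglongrightarrow> ennreal (f x)"
proof -
  have [measurable]: "f \<in> borel_measurable borel"
    using f by (rule borel_measurable_continuous_onI)
  have "(\<integral>\<^sup>+y. ennreal (f y) * ennreal (real (Suc n) / sqrt (2 * pi) * exp (- (real (Suc n) * (x - y))\<^sup>2 / 2)) \<partial>lborel)
      = (\<integral>\<^sup>+z. ennreal (f (x + z / real (Suc n))) \<partial>std_normal_distribution)" for n
  proof -
    have "(\<integral>\<^sup>+y. ennreal (f y) * ennreal (real (Suc n) / sqrt (2 * pi) * exp (- (real (Suc n) * (x - y))\<^sup>2 / 2)) \<partial>lborel)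
      = ennreal (1 / real (Suc n)) * (\<integral>\<^sup>+z. ennreal (f (x + (1 / real (Suc n)) * z)) *
          ennreal (real (Suc n) / sqrt (2 * pi) * exp (- (real (Suc n) * (x - (x + (1 / real (Suc n)) * z)))\<^sup>2 / 2)) \<partial>lborel)"
      by (subst nn_integral_real_affine[where t = x and c = "1 / real (Suc n)"]) auto
    also have "\<dots> = (\<integral>\<^sup>+z. ennreal (1 / real (Suc n)) * (ennreal (f (x + (1 / real (Suc n)) * z)) *
          ennreal (real (Suc n) / sqrt (2 * pi) * exp (- (real (Suc n) * (x - (x + (1 / real (Suc n)) * z)))\<^sup>2 / 2))) \<partial>lborel)"
      by (rule nn_integral_cmult[symmetric]) measurable
    also have "\<dots> = (\<integral>\<^sup>+z. ennreal (std_normal_density z) * ennreal (f (x + z / real (Suc n))) \<partial>lborel)"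
    proof (intro nn_integral_cong)
      fix z
      define s where "s = real (Suc n)"
      have s: "s > 0" by (simp add: s_def)
      have "s * (x - (x + (1 / s) * z)) = - z" using s by (simp add: field_simps)
      hence "(1 / s) * (f (x + (1 / s) * z) * (s / sqrt (2 * pi) * exp (- (s * (x - (x + (1 / s) * z)))\<^sup>2 / 2)))
          = std_normal_density z * f (x + z / s)"
        using s by (simp add: std_normal_density_def)
      thus "ennreal (1 / real (Suc n)) * (ennreal (f (x + (1 / real (Suc n)) * z)) *
          ennreal (real (Suc n) / sqrt (2 * pi) * exp (- (real (Suc n) * (x - (x + (1 / real (Suc n)) * z)))\<^sup>2 / 2)))
          = ennreal (std_normal_density z) * ennreal (f (x + z / real (Suc n)))"
        using s unfolding s_def[symmetric]
        by (simp add: f0 ennreal_mult[symmetric] del: of_nat_Suc)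
    qed
    also have "\<dots> = (\<integral>\<^sup>+z. ennreal (f (x + z / real (Suc n))) \<partial>std_normal_distribution)"
      by (subst nn_integral_density) auto
    finally show ?thesis .
  qed
  moreover have "(\<lambda>n. \<integral>\<^sup>+z. ennreal (f (x + z / real (Suc n))) \<partial>std_normal_distribution)
      \<longlonglongrightarrow> (\<integral>\<^sup>+z. ennreal (f x) \<partial>std_normal_distribution)"
  proof (rule nn_integral_dominated_convergence[where w = "\<lambda>_. 1"])
    show "AE z in std_normal_distribution. (\<lambda>n. ennreal (f (x + z / real (Suc n)))) \<longlonglongrightarrow> ennreal (f x)"
    proof (intro AE_I2 tendsto_ennrealI)
      fix z :: real
      have "(\<lambda>n. z / real (Suc n)) \<longlonglongrightarrow> 0"
        using tendsto_mult[OF tendsto_const LIMSEQ_inverse_real_of_nat, of z] by (simp add: divide_inverse)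
      hence "(\<lambda>n. x + z / real (Suc n)) \<longlonglongrightarrow> x + 0" by (intro tendsto_intros)
      thus "(\<lambda>n. f (x + z / real (Suc n))) \<longlonglongrightarrow> f x"
        using continuous_on_tendsto_compose[OF f, of _ x sequentially] by simp
    qed
  qed (auto simp: f1 normal_prob.emeasure_space_1[simplified])
  ultimately show ?thesis by (simp add: normal_prob.emeasure_space_1[simplified])
qed

text \<open>After convolving the product with a narrow Gaussian, Fubini leaves M only inside
  integrals of \<open>gauss_kernel\<close>, which its characteristic function determines. Letting
  the width tend to 0 recovers the product itself.\<close>

lemma nn_integral_prod_eq_of_char_fun_eq:
  fixes f :: "'i \<Rightarrow> real \<Rightarrow> real"
  assumes I: "finite I"
    and M: "prob_space M" "sets M = sets (borel_fun I)"
    and M': "prob_space M'" "sets M' = sets (borel_fun I)"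
    and eq: "\<And>t. char_fun I M t = char_fun I M' t"
    and f: "\<And>i. continuous_on UNIV (f i)" and f0: "\<And>i x. 0 \<le> f i x" and f1: "\<And>i x. f i x \<le> 1"
  shows "(\<integral>\<^sup>+x. (\<Prod>i\<in>I. ennreal (f i (x i))) \<partial>M) = (\<integral>\<^sup>+x. (\<Prod>i\<in>I. ennreal (f i (x i))) \<partial>M')"
proof -
  have fm[measurable]: "f i \<in> borel_measurable borel" for i
    using f by (rule borel_measurable_continuous_onI)
  \<comment> \<open>\<open>K n\<close> is the centred normal density of standard deviation 1 / (n +
    1); \<open>C n\<close> gathers its normalizing factors over all coordinates.\<close>
  define K where "K n u = real (Suc n) / sqrt (2 * pi) * exp (- (real (Suc n) * u)\<^sup>2 / 2)" for n u
  have K0: "0 \<le> K n u" for n u by (simp add: K_def)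
  have Km[measurable]: "K n \<in> borel_measurable borel" for n unfolding K_def by measurable
  define F where "F n x = (\<Prod>i\<in>I. \<integral>\<^sup>+y. ennreal (f i y) * ennreal (K n (x i - y)) \<partial>lborel)" for n x
  define C where "C n = (real (Suc n) / sqrt (2 * pi)) ^ card I" for n
  have C0: "0 \<le> C n" for n by (simp add: C_def)
  have F_eq: "F n x = (\<integral>\<^sup>+y. ennreal (\<Prod>i\<in>I. f i (y i)) * ennreal (\<Prod>i\<in>I. K n (x i - y i)) \<partial>lebesgue_fun I)" for n x
    unfolding F_def
    by (subst lborel_prod.product_nn_integral_prod[OF I, symmetric])
       (auto simp: prod_ennreal K0 f0 prod.distrib prod_nonneg simp flip: ennreal_mult)
  have int_F: "(\<integral>\<^sup>+x. F n x \<partial>N) = (\<integral>\<^sup>+y. ennreal (\<Prod>i\<in>I. f i (y i)) * ennreal (C n) *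
        ennreal (\<integral>x. gauss_kernel I (real (Suc n)) x y \<partial>N) \<partial>lebesgue_fun I)"
    if N: "prob_space N" "sets N = sets (borel_fun I)" for N n
  proof -
    note [measurable_cong] = N(2)
    interpret N: prob_space N by fact
    interpret L: sigma_finite_measure "lebesgue_fun I" by (rule lborel_prod.sigma_finite[OF I])
    interpret NL: pair_sigma_finite N "lebesgue_fun I" ..
    have "(\<integral>\<^sup>+x. F n x \<partial>N) = (\<integral>\<^sup>+y. (\<integral>\<^sup>+x. ennreal (\<Prod>i\<in>I. f i (y i)) * ennreal (\<Prod>i\<in>I. K n (x i - y i)) \<partial>N) \<partial>lebesgue_fun I)"
      unfolding F_eq by (rule NL.Fubini'[symmetric]) measurable
    also have "\<dots> = (\<integral>\<^sup>+y. ennreal (\<Prod>i\<in>I. f i (y i)) * ennreal (C n) *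
        ennreal (\<integral>x. gauss_kernel I (real (Suc n)) x y \<partial>N) \<partial>lebesgue_fun I)"
    proof (intro nn_integral_cong)
      fix y
      have "(\<integral>\<^sup>+x. ennreal (\<Prod>i\<in>I. f i (y i)) * ennreal (\<Prod>i\<in>I. K n (x i - y i)) \<partial>N)
        = (\<integral>\<^sup>+x. (ennreal (\<Prod>i\<in>I. f i (y i)) * ennreal (C n)) * ennreal (gauss_kernel I (real (Suc n)) x y) \<partial>N)"
      proof (intro nn_integral_cong)
        fix x
        have "(\<Prod>i\<in>I. K n (x i - y i)) = C n * gauss_kernel I (real (Suc n)) x y"
          unfolding K_def C_def prod.distrib prod_constant by (rule refl)
        thus "ennreal (\<Prod>i\<in>I. f i (y i)) * ennreal (\<Prod>i\<in>I. K n (x i - y i)) =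
            (ennreal (\<Prod>i\<in>I. f i (y i)) * ennreal (C n)) * ennreal (gauss_kernel I (real (Suc n)) x y)"
          by (simp only: ennreal_mult[OF C0 prod_nonneg] exp_ge_zero mult.assoc)
      qed
      also have "\<dots> = (ennreal (\<Prod>i\<in>I. f i (y i)) * ennreal (C n)) *
          (\<integral>\<^sup>+x. ennreal (gauss_kernel I (real (Suc n)) x y) \<partial>N)"
        by (rule nn_integral_cmult) measurable
      also have "(\<integral>\<^sup>+x. ennreal (gauss_kernel I (real (Suc n)) x y) \<partial>N)
         = ennreal (\<integral>x. gauss_kernel I (real (Suc n)) x y \<partial>N)"
        by (intro nn_integral_eq_integral N.integrable_const_bound[where B = 1])
           (auto intro!: prod_le_1 simp: abs_prod prod_nonneg)
      finally show "(\<integral>\<^sup>+x. ennreal (\<Prod>i\<in>I. f i (y i)) * ennreal (\<Prod>i\<in>I. K n (x i - y i)) \<partial>N) =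
          ennreal (\<Prod>i\<in>I. f i (y i)) * ennreal (C n) *
            ennreal (\<integral>x. gauss_kernel I (real (Suc n)) x y \<partial>N)" .
    qed
    finally show ?thesis .
  qed
  have "(\<integral>x. gauss_kernel I \<tau> x y \<partial>M) = (\<integral>x. gauss_kernel I \<tau> x y \<partial>M')" for \<tau> y
  proof -
    have "complex_of_real (\<integral>x. gauss_kernel I \<tau> x y \<partial>M) =
        complex_of_real (\<integral>x. gauss_kernel I \<tau> x y \<partial>M')"
      unfolding integral_gaussian_kernel_char_fun[OF I M] integral_gaussian_kernel_char_fun[OF I M'] eq ..
    thus ?thesis by (rule of_real_eq_iff[THEN iffD1])
  qed
  hence FF: "(\<integral>\<^sup>+x. F n x \<partial>M) = (\<integral>\<^sup>+x. F n x \<partial>M')" for n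
    by (simp only: int_F[OF M] int_F[OF M'])
  have lim: "(\<lambda>n. \<integral>\<^sup>+x. F n x \<partial>N) \<longlonglongrightarrow> (\<integral>\<^sup>+x. (\<Prod>i\<in>I. ennreal (f i (x i))) \<partial>N)"
    if N: "prob_space N" "sets N = sets (borel_fun I)" for N
  proof (rule nn_integral_dominated_convergence[where w = "\<lambda>_. 1"])
    note [measurable_cong] = N(2)
    interpret N: prob_space N by fact
    show "(\<integral>\<^sup>+x. 1 \<partial>N) < \<infinity>" by (simp add: N.emeasure_space_1)
    show "F n \<in> borel_measurable N" for n unfolding F_def by measurable
    show "(\<lambda>x. \<Prod>i\<in>I. ennreal (f i (x i))) \<in> borel_measurable N" by measurable
    \<comment> \<open>Each factor of \<open>F n x\<close> averages a function bounded by 1 against a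
      normal density centred at x i, so the constant 1 is an integrable majorant.\<close>
    have "F n x \<le> 1" for n x
    proof -
      have "(\<integral>\<^sup>+y. ennreal (f i y) * ennreal (K n (x i - y)) \<partial>lborel) \<le> (\<integral>\<^sup>+y. ennreal (normal_density (x i) (1 / real (Suc n)) y) \<partial>lborel)" for i
      proof (intro nn_integral_mono)
        fix y
        have "K n (x i - y) = normal_density (x i) (1 / real (Suc n)) y"
        proof -
          define s where "s = real (Suc n)"
          have s: "s > 0" by (simp add: s_def)
          have "sqrt (2 * pi * (1 / s)\<^sup>2) = sqrt (2 * pi) / s"
            using s by (simp add: real_sqrt_mult real_sqrt_divide)
          moreover have "- (y - x i)\<^sup>2 / (2 * (1 / s)\<^sup>2) = - (s * (x i - y))\<^sup>2 / 2"
            using s by (simp add: power_mult_distrib power2_commute[of y] power_divide)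
          ultimately show ?thesis unfolding K_def normal_density_def s_def by simp
        qed
        moreover have "ennreal (f i y) * ennreal (K n (x i - y)) \<le> 1 * ennreal (K n (x i - y))"
          by (intro mult_right_mono) (auto simp: f1)
        ultimately show "ennreal (f i y) * ennreal (K n (x i - y)) \<le> ennreal (normal_density (x i) (1 / real (Suc n)) y)"
          by simp
      qed
      also have "(\<integral>\<^sup>+y. ennreal (normal_density (x i) (1 / real (Suc n)) y) \<partial>lborel) = 1" for i
        by (subst nn_integral_eq_integral) auto
      finally show ?thesis unfolding F_def by (intro prod_le_1) auto
    qed
    thus "AE x in N. F n x \<le> 1" for n by simp
    show "AE x in N. (\<lambda>n. F n x) \<longlonglongrightarrow> (\<Prod>i\<in>I. ennreal (f i (x i)))"
    proof (intro AE_I2)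
      fix x
      have *: "(\<lambda>n. \<integral>\<^sup>+y. ennreal (f i y) * ennreal (K n (x i - y)) \<partial>lborel) \<longlonglongrightarrow> ennreal (f i (x i))" for i
        using nn_integral_normal_kernel_tendsto[OF f f0 f1, of i "x i"] by (simp add: K_def)
      have "finite J \<Longrightarrow> (\<lambda>n. \<Prod>i\<in>J. \<integral>\<^sup>+y. ennreal (f i y) * ennreal (K n (x i - y)) \<partial>lborel) \<longlonglongrightarrow> (\<Prod>i\<in>J. ennreal (f i (x i)))" for J
      proof (induction J rule: finite_induct)
        case (insert j J)
        have "(\<lambda>n. (\<integral>\<^sup>+y. ennreal (f j y) * ennreal (K n (x j - y)) \<partial>lborel) * (\<Prod>i\<in>J. \<integral>\<^sup>+y. ennreal (f i y) * ennreal (K n (x i - y)) \<partial>lborel))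
            \<longlonglongrightarrow> ennreal (f j (x j)) * (\<Prod>i\<in>J. ennreal (f i (x i)))"
          by (intro tendsto_mult_ennreal * insert.IH) (auto simp: prod_ennreal f0)
        thus ?case using insert.hyps by simp
      qed simp
      thus "(\<lambda>n. F n x) \<longlonglongrightarrow> (\<Prod>i\<in>I. ennreal (f i (x i)))" unfolding F_def using I by blast
    qed
  qed measurable
  show ?thesis
    using lim[OF M] lim[OF M'] unfolding FF by (rule LIMSEQ_unique)
qed

lemma sets_borel_fun_orthants:
  assumes I: "finite I"
  shows "sets (borel_fun I) = sigma_sets (\<Pi>\<^sub>E i\<in>I. UNIV) {\<Pi>\<^sub>E i\<in>I. {a i<..} | a. True}"
proof -
  have b: "(borel :: real measure) = sigma UNIV (range greaterThan)"
    by (simp add: borel_Ioi)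
  have "sets (borel_fun I) = sets (\<Pi>\<^sub>M i\<in>I. sigma UNIV (range (greaterThan :: real \<Rightarrow> _)))"
    unfolding b ..
  also have "\<dots> = sets (sigma (\<Pi>\<^sub>E i\<in>I. UNIV) {{f\<in>(\<Pi>\<^sub>E i\<in>I. UNIV). \<forall>i\<in>j. f i \<in> A i} | A j. j \<in> {I} \<and> A \<in> Pi j (\<lambda>_. range (greaterThan :: real \<Rightarrow> _))})"
  proof (rule sets_PiM_sigma)
    show "\<exists>S\<subseteq>range greaterThan. countable S \<and> (UNIV :: real set) = \<Union> S" for i
    proof (intro exI[of _ "range (\<lambda>n. {- real n<..})"] conjI)
      show "UNIV = \<Union> (range (\<lambda>n. {- real n<..}))"
      proof (intro set_eqI iffI)
        fix x :: real
        obtain n where "- x < real n" using reals_Archimedean2 by blast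
        thus "x \<in> \<Union> (range (\<lambda>n. {- real n<..}))" by (auto intro!: exI[of _ n])
      qed simp
    qed auto
  qed (use I in auto)
  also have "{{f\<in>(\<Pi>\<^sub>E i\<in>I. UNIV). \<forall>i\<in>j. f i \<in> A i} | A j. j \<in> {I} \<and> A \<in> Pi j (\<lambda>_. range (greaterThan :: real \<Rightarrow> _))}
      = {\<Pi>\<^sub>E i\<in>I. {a i<..} | a. True}" (is "?A = ?B")
  proof (intro set_eqI iffI)
    fix X assume "X \<in> ?A"
    then obtain A where A: "X = {f\<in>(\<Pi>\<^sub>E i\<in>I. UNIV). \<forall>i\<in>I. f i \<in> A i}" "A \<in> I \<rightarrow> range greaterThan"
      by blast
    have "\<forall>i\<in>I. \<exists>a. A i = {a<..}" using A(2) by (auto simp: Pi_iff)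
    then obtain a where "\<forall>i\<in>I. A i = {a i<..}" by metis
    hence "X = (\<Pi>\<^sub>E i\<in>I. {a i<..})" using A(1)
      by (auto simp: PiE_iff intro: extensional_arb)
    thus "X \<in> ?B" by blast
  next
    fix X assume "X \<in> ?B"
    then obtain a where "X = (\<Pi>\<^sub>E i\<in>I. {a i<..})" by blast
    hence "X = {f\<in>(\<Pi>\<^sub>E i\<in>I. UNIV). \<forall>i\<in>I. f i \<in> {a i<..}}"
      by (auto simp: PiE_iff extensional_def)
    thus "X \<in> ?A" by (intro CollectI exI[of _ "\<lambda>i. {a i<..}"] exI[of _ I]) auto
  qed
  also have "sets (sigma (\<Pi>\<^sub>E i\<in>I. UNIV) ?B) = sigma_sets (\<Pi>\<^sub>E i\<in>I. UNIV) ?B"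
    by (rule sets_measure_of) (auto simp: PiE_iff)
  finally show ?thesis .
qed

text \<open>Open upper orthants form an intersection-stable generator, and their indicators are
  limits of products of continuous ramps, to which \<open>nn_integral_prod_eq_of_char_fun_eq\<close>
  applies.\<close>

theorem char_fun_unique:
  assumes I: "finite I"
    and M: "prob_space M" "sets M = sets (borel_fun I)"
    and M': "prob_space M'" "sets M' = sets (borel_fun I)"
    and eq: "\<And>t. char_fun I M t = char_fun I M' t"
  shows "M = M'"
proof -
  interpret M: prob_space M by fact
  interpret M': prob_space M' by fact
  let ?E = "{\<Pi>\<^sub>E i\<in>I. {a i<..} | a :: 'a \<Rightarrow> real. True}"
  \<comment> \<open>Ramps that for n > 0 vanish up to a i and equal 1 from a i + 1 / n on; at a
    fixed x their product equals the indicator of the open orthant from some n on.\<close>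
  let ?c = "\<lambda>n a x. \<Prod>i\<in>I. ennreal (min 1 (max 0 (real n * (x i - a i))))"
  have lim: "(\<lambda>n. \<integral>\<^sup>+x. ?c n a x \<partial>N) \<longlonglongrightarrow> emeasure N (\<Pi>\<^sub>E i\<in>I. {a i<..})"
    if N: "prob_space N" "sets N = sets (borel_fun I)" for N a
  proof -
    note [measurable_cong] = N(2)
    interpret N: prob_space N by fact
    have sp: "space N = (\<Pi>\<^sub>E i\<in>I. UNIV)" using sets_eq_imp_space_eq[OF N(2)] by (simp add: space_PiM)
    have [measurable]: "(\<Pi>\<^sub>E i\<in>I. {a i<..}) \<in> sets N" unfolding N(2) using I by (intro sets_PiM_I_finite) auto
    have "(\<lambda>n. \<integral>\<^sup>+x. ?c n a x \<partial>N) \<longlonglongrightarrow> (\<integral>\<^sup>+x. indicator (\<Pi>\<^sub>E i\<in>I. {a i<..}) x \<partial>N)"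
    proof (rule nn_integral_dominated_convergence[where w = "\<lambda>_. 1"])
      show "AE x in N. ?c n a x \<le> 1" for n
        by (intro AE_I2 prod_le_1) auto
      show "AE x in N. (\<lambda>n. ?c n a x) \<longlonglongrightarrow> indicator (\<Pi>\<^sub>E i\<in>I. {a i<..}) x"
      proof (intro AE_I2)
        fix x assume x: "x \<in> space N"
        show "(\<lambda>n. ?c n a x) \<longlonglongrightarrow> indicator (\<Pi>\<^sub>E i\<in>I. {a i<..}) x"
        proof (cases "\<forall>i\<in>I. a i < x i")
          case True
          have "\<forall>\<^sub>F n in sequentially. \<forall>i\<in>I. 1 \<le> real n * (x i - a i)"
          proof (intro eventually_ball_finite I ballI)
            fix i assume "i \<in> I"
            then have d: "0 < x i - a i" using True by simp
            obtain m where "1 / (x i - a i) < real m" using reals_Archimedean2 by blast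
            hence "1 < real m * (x i - a i)" using d by (simp add: field_simps)
            thus "\<forall>\<^sub>F n in sequentially. 1 \<le> real n * (x i - a i)"
              using d by (intro eventually_sequentiallyI[of m]) (smt (verit) mult_right_mono of_nat_mono)
          qed
          hence "\<forall>\<^sub>F n in sequentially. ?c n a x = indicator (\<Pi>\<^sub>E i\<in>I. {a i<..}) x"
          proof eventually_elim
            case (elim n)
            have "?c n a x = (\<Prod>i\<in>I. 1)"
              using elim by (intro prod.cong) (auto simp: min_def max_def)
            moreover have "x \<in> (\<Pi>\<^sub>E i\<in>I. {a i<..})" using x True by (auto simp: sp PiE_iff)
            ultimately show ?case by simp
          qed
          thus ?thesis by (rule tendsto_eventually)
        next
          case False
          then obtain i where i: "i \<in> I" "x i \<le> a i" by force
          have "?c n a x = 0" for n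
            using i I by (auto simp: mult_nonneg_nonpos intro!: bexI[of _ i] prod_zero)
          moreover have "\<not> a i < x i" using i(2) by simp
          hence "x \<notin> (\<Pi>\<^sub>E i\<in>I. {a i<..})" using i(1) by blast
          hence "indicator (\<Pi>\<^sub>E i\<in>I. {a i<..}) x = (0 :: ennreal)" by simp
          ultimately show ?thesis by (simp only: tendsto_const)
        qed
      qed
    qed (auto simp: N.emeasure_space_1)
    thus ?thesis by simp
  qed
  have eqE: "emeasure M (\<Pi>\<^sub>E i\<in>I. {a i<..}) = emeasure M' (\<Pi>\<^sub>E i\<in>I. {a i<..})" for a
  proof -
    have "(\<integral>\<^sup>+x. ?c n a x \<partial>M) = (\<integral>\<^sup>+x. ?c n a x \<partial>M')" for n
      by (rule nn_integral_prod_eq_of_char_fun_eq[OF I M M' eq, of "\<lambda>i x. min 1 (max 0 (real n * (x - a i)))"])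
         (auto intro!: continuous_intros)
    thus ?thesis using lim[OF M, of a] lim[OF M', of a] LIMSEQ_unique by (simp only:) blast
  qed
  show ?thesis
  proof (rule measure_eqI_generator_eq[where E = ?E and \<Omega> = "\<Pi>\<^sub>E i\<in>I. UNIV" and A = "\<lambda>n. \<Pi>\<^sub>E i\<in>I. {- real n<..}"])
    show "Int_stable ?E"
    proof (rule Int_stableI)
      fix X Y assume "X \<in> ?E" "Y \<in> ?E"
      then obtain a b where "X = (\<Pi>\<^sub>E i\<in>I. {a i<..})" "Y = (\<Pi>\<^sub>E i\<in>I. {b i<..})" by blast
      hence "X \<inter> Y = (\<Pi>\<^sub>E i\<in>I. {max (a i) (b i)<..})" by (auto simp: PiE_iff)
      thus "X \<inter> Y \<in> ?E" by (intro CollectI exI[of _ "\<lambda>i. max (a i) (b i)"]) simp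
    qed
    show "(\<Union>n. \<Pi>\<^sub>E i\<in>I. {- real n<..}) = (\<Pi>\<^sub>E i\<in>I. UNIV)"
    proof (intro set_eqI iffI)
      fix x assume x: "x \<in> (\<Pi>\<^sub>E i\<in>I. UNIV :: real set)"
      obtain n where "(\<Sum>i\<in>I. \<bar>x i\<bar>) < real n" using reals_Archimedean2 by blast
      hence "- real n < x i" if "i \<in> I" for i
        using member_le_sum[OF that, of "\<lambda>i. \<bar>x i\<bar>"] I by force
      thus "x \<in> (\<Union>n. \<Pi>\<^sub>E i\<in>I. {- real n<..})" using x by (auto simp: PiE_iff intro!: exI[of _ n])
    qed (auto simp: PiE_iff)
    show "range (\<lambda>n. \<Pi>\<^sub>E i\<in>I. {- real n<..}) \<subseteq> ?E" by auto
    show "sets M = sigma_sets (\<Pi>\<^sub>E i\<in>I. UNIV) ?E" "sets M' = sigma_sets (\<Pi>\<^sub>E i\<in>I. UNIV) ?E"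
      using M(2) M'(2) sets_borel_fun_orthants[OF I] by auto
  qed (use eqE in \<open>auto simp: PiE_iff\<close>)
qed


section \<open>Lebesgue measure on finite products\<close>

definition triangular_map :: "nat \<Rightarrow> (nat \<Rightarrow> real) \<Rightarrow> (nat \<Rightarrow> (nat \<Rightarrow> real) \<Rightarrow> real) \<Rightarrow> (nat \<Rightarrow> real) \<Rightarrow> (nat \<Rightarrow> real)" where
  "triangular_map k d l a = (\<lambda>j\<in>{..<k}. d j * a j + l j (restrict a {..<j}))"

lemma measurable_triangular_map:
  assumes l: "\<And>j. j < k \<Longrightarrow> l j \<in> borel_measurable (borel_fun {..<j})"
  shows "triangular_map k d l \<in> measurable (borel_fun {..<k}) (borel_fun {..<k})"
  unfolding triangular_map_def
proof (rule measurable_restrict)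
  fix j assume j: "j \<in> {..<k}"
  have "(\<lambda>a. restrict a {..<j}) \<in> measurable (borel_fun {..<k}) (borel_fun {..<j})"
    using j by (intro measurable_restrict_subset) auto
  from measurable_compose[OF this l] j
  have [measurable]: "(\<lambda>a. l j (restrict a {..<j})) \<in> borel_measurable (borel_fun {..<k})" by simp
  have [measurable]: "(\<lambda>a. a j) \<in> borel_measurable (borel_fun {..<k})"
    using j by (rule measurable_component_singleton)
  show "(\<lambda>a. d j * a j + l j (restrict a {..<j})) \<in> borel_measurable (borel_fun {..<k})"
    by measurable
qed

lemma measurable_fun_upd_pair:
  fixes F :: "('i \<Rightarrow> real) \<Rightarrow> ennreal"
  assumes "F \<in> borel_measurable (borel_fun (insert i J))"
  shows "(\<lambda>p. F ((fst p)(i := snd p))) \<in> borel_measurable (borel_fun J \<Otimes>\<^sub>M borel)"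
  using measurable_compose[OF measurable_add_dim[of i J "\<lambda>_. borel :: real measure"] assms]
  by (simp add: case_prod_beta')

lemma measurable_nn_integral_fun_upd:
  fixes F :: "('i \<Rightarrow> real) \<Rightarrow> ennreal"
  assumes "F \<in> borel_measurable (borel_fun (insert i J))"
  shows "(\<lambda>b. \<integral>\<^sup>+s. F (b(i := s)) \<partial>lborel) \<in> borel_measurable (borel_fun J)"
  using measurable_fun_upd_pair[OF assms]
  by (intro sigma_finite_measure.borel_measurable_nn_integral)
    (auto intro: lborel.sigma_finite_measure_axioms simp: case_prod_beta' cong: measurable_cong_sets)

lemma nn_integral_affine_fun_upd:
  fixes F :: "('i \<Rightarrow> real) \<Rightarrow> ennreal"
  assumes F: "F \<in> borel_measurable (borel_fun (insert i J))" and b: "b \<in> space (borel_fun J)" and d: "0 < d"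
  shows "(\<integral>\<^sup>+y. F (b(i := t + d * y)) \<partial>lborel) = ennreal (1 / d) * (\<integral>\<^sup>+s. F (b(i := s)) \<partial>lborel)"
proof -
  have [measurable]: "(\<lambda>s. F (b(i := s))) \<in> borel_measurable borel"
    using measurable_Pair2[OF measurable_fun_upd_pair[OF F] b] by simp
  have "(\<integral>\<^sup>+s. F (b(i := s)) \<partial>lborel) = ennreal d * (\<integral>\<^sup>+y. F (b(i := t + d * y)) \<partial>lborel)"
    using d by (subst nn_integral_real_affine[where c = d and t = t]) auto
  hence "ennreal (1 / d) * (\<integral>\<^sup>+s. F (b(i := s)) \<partial>lborel) = ennreal (1 / d * d) * (\<integral>\<^sup>+y. F (b(i := t + d * y)) \<partial>lborel)"
    using d by (subst ennreal_mult) (auto simp: mult.assoc)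
  thus ?thesis using d by simp
qed

text \<open>Induction on k, integrating the last coordinate first: with the earlier ones fixed the
  map is affine in it with slope d k, so the inner integral contributes the factor 1 / d k. The
  offset l k acts as a translation and may therefore be any measurable function of the earlier
  coordinates.\<close>

lemma nn_integral_triangular_map:
  assumes d: "\<And>j. j < k \<Longrightarrow> 0 < d j"
    and l: "\<And>j. j < k \<Longrightarrow> l j \<in> borel_measurable (borel_fun {..<j})"
    and F: "F \<in> borel_measurable (borel_fun {..<k})"
  shows "(\<integral>\<^sup>+a. F (triangular_map k d l a) \<partial>lebesgue_fun {..<k}) =
    ennreal (\<Prod>j<k. 1 / d j) * (\<integral>\<^sup>+a. F a \<partial>lebesgue_fun {..<k})"
  using assms
proof (induction k arbitrary: F)
  case 0
  thus ?case by (simp add: PiM_empty nn_integral_count_space_finite triangular_map_def restrict_def)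
next
  case (Suc k)
  note [measurable] = Suc.prems(3)
  have lm[measurable]: "l k \<in> borel_measurable (borel_fun {..<k})" using Suc.prems(2) by simp
  have F_ins: "F \<in> borel_measurable (borel_fun (insert k {..<k}))"
    unfolding lessThan_Suc[symmetric] by fact
  define F' where "F' b = (\<integral>\<^sup>+s. F (b(k := s)) \<partial>lborel)" for b
  have F': "F' \<in> borel_measurable (borel_fun {..<k})"
    unfolding F'_def by (rule measurable_nn_integral_fun_upd[OF F_ins])
  have Tm: "triangular_map (Suc k) d l \<in> measurable (borel_fun {..<Suc k}) (borel_fun {..<Suc k})"
    using Suc.prems(2) by (rule measurable_triangular_map)
  have FT: "(\<lambda>a. F (triangular_map (Suc k) d l a)) \<in> borel_measurable (lebesgue_fun (insert k {..<k}))"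
    using measurable_compose[OF Tm Suc.prems(3)]
    by (simp add: lessThan_Suc[symmetric] cong: measurable_cong_sets)
  have "(\<integral>\<^sup>+a. F (triangular_map (Suc k) d l a) \<partial>lebesgue_fun {..<Suc k}) =
     (\<integral>\<^sup>+a. (\<integral>\<^sup>+y. F (triangular_map (Suc k) d l (a(k := y))) \<partial>lborel) \<partial>lebesgue_fun {..<k})"
    unfolding lessThan_Suc using FT by (subst lborel_prod.product_nn_integral_insert) auto
  also have "\<dots> = (\<integral>\<^sup>+a. ennreal (1 / d k) * F' (triangular_map k d l a) \<partial>lebesgue_fun {..<k})"
  proof (intro nn_integral_cong)
    fix a assume a: "a \<in> space (lebesgue_fun {..<k})"
    have T: "triangular_map (Suc k) d l (a(k := y)) = (triangular_map k d l a)(k := l k a + d k * y)" for y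
    proof
      fix j
      show "triangular_map (Suc k) d l (a(k := y)) j = ((triangular_map k d l a)(k := l k a + d k * y)) j"
      proof (cases "j < k")
        case True
        hence "restrict (a(k := y)) {..<j} = restrict a {..<j}" by (auto simp: fun_eq_iff)
        thus ?thesis using True by (simp add: triangular_map_def)
      next
        case False
        \<comment> \<open>Members of the product space are \<open>undefined\<close> off their index
          set, so restricting after the update at k gives back a.\<close>
        have "restrict (a(k := y)) {..<k} = a" using a by (auto simp: fun_eq_iff space_PiM dest: PiE_arb)
        thus ?thesis using False by (auto simp: triangular_map_def)
      qed
    qed
    have Ta: "triangular_map k d l a \<in> space (borel_fun {..<k})"
      by (auto simp: triangular_map_def space_PiM)
    show "(\<integral>\<^sup>+y. F (triangular_map (Suc k) d l (a(k := y))) \<partial>lborel) = ennreal (1 / d k) * F' (triangular_map k d l a)"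
      unfolding T F'_def using Suc.prems(1) by (intro nn_integral_affine_fun_upd[OF F_ins Ta]) simp
  qed
  also have "\<dots> = ennreal (1 / d k) * (\<integral>\<^sup>+a. F' (triangular_map k d l a) \<partial>lebesgue_fun {..<k})"
    using measurable_compose[OF measurable_triangular_map F'] Suc.prems(2)
    by (intro nn_integral_cmult) (simp cong: measurable_cong_sets)
  also have "(\<integral>\<^sup>+a. F' (triangular_map k d l a) \<partial>lebesgue_fun {..<k}) =
      ennreal (\<Prod>j<k. 1 / d j) * (\<integral>\<^sup>+a. F' a \<partial>lebesgue_fun {..<k})"
    using Suc.prems F' by (intro Suc.IH) auto
  also have "(\<integral>\<^sup>+a. F' a \<partial>lebesgue_fun {..<k}) = (\<integral>\<^sup>+a. F a \<partial>lebesgue_fun {..<Suc k})"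
  proof -
    have "F \<in> borel_measurable (lebesgue_fun (insert k {..<k}))"
      using F_ins by measurable
    thus ?thesis unfolding F'_def lessThan_Suc
      by (intro lborel_prod.product_nn_integral_insert[symmetric]) auto
  qed
  also have "ennreal (1 / d k) * (ennreal (\<Prod>j<k. 1 / d j) * (\<integral>\<^sup>+a. F a \<partial>lebesgue_fun {..<Suc k})) =
      ennreal (\<Prod>j<Suc k. 1 / d j) * (\<integral>\<^sup>+a. F a \<partial>lebesgue_fun {..<Suc k})"
  proof -
    have c: "0 \<le> 1 / d k" "0 \<le> (\<Prod>j<k. 1 / d j)"
      using Suc.prems(1) by (auto intro!: prod_nonneg simp: less_imp_le)
    have "(\<Prod>j<Suc k. 1 / d j) = 1 / d k * (\<Prod>j<k. 1 / d j)" by simp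
    hence "ennreal (\<Prod>j<Suc k. 1 / d j) = ennreal (1 / d k) * ennreal (\<Prod>j<k. 1 / d j)"
      by (simp only: ennreal_mult[OF c])
    thus ?thesis by (simp only: mult.assoc)
  qed
  finally show ?case .
qed

text \<open>The left inverse U lets h be read as a function of the image point alone, so that the
  substitution rule for integrals applies.\<close>

lemma distr_density_triangular_map:
  assumes d: "\<And>j. j < k \<Longrightarrow> 0 < d j"
    and l: "\<And>j. j < k \<Longrightarrow> l j \<in> borel_measurable (borel_fun {..<j})"
    and h: "h \<in> borel_measurable (borel_fun {..<k})"
    and U: "U \<in> measurable (borel_fun {..<k}) (borel_fun {..<k})"
    and UT: "\<And>a. a \<in> space (borel_fun {..<k}) \<Longrightarrow> U (triangular_map k d l a) = a"
  shows "distr (density (lebesgue_fun {..<k}) h) (borel_fun {..<k}) (triangular_map k d l) =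
    density (lebesgue_fun {..<k}) (\<lambda>y. ennreal (\<Prod>j<k. 1 / d j) * h (U y))"
proof (rule measure_eqI)
  note [measurable] = h U measurable_triangular_map[OF l]
  fix A assume "A \<in> sets (distr (density (lebesgue_fun {..<k}) h) (borel_fun {..<k}) (triangular_map k d l))"
  hence A[measurable]: "A \<in> sets (borel_fun {..<k})" by simp
  have T: "triangular_map k d l \<in> measurable (density (lebesgue_fun {..<k}) h) (borel_fun {..<k})"
    by measurable
  have sp: "space (lebesgue_fun {..<k}) = space (borel_fun {..<k})" by (simp add: space_PiM)
  have "emeasure (distr (density (lebesgue_fun {..<k}) h) (borel_fun {..<k}) (triangular_map k d l)) A =
     emeasure (density (lebesgue_fun {..<k}) h) (triangular_map k d l -` A \<inter> space (lebesgue_fun {..<k}))"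
    using T A by (simp add: emeasure_distr)
  also have "\<dots> = (\<integral>\<^sup>+a. h a * indicator (triangular_map k d l -` A \<inter> space (lebesgue_fun {..<k})) a \<partial>lebesgue_fun {..<k})"
    by (rule emeasure_density) (use measurable_sets[OF T A] in auto)
  also have "\<dots> = (\<integral>\<^sup>+a. h (U (triangular_map k d l a)) * indicator A (triangular_map k d l a) \<partial>lebesgue_fun {..<k})"
    by (intro nn_integral_cong) (auto simp: UT sp split: split_indicator)
  also have "\<dots> = ennreal (\<Prod>j<k. 1 / d j) * (\<integral>\<^sup>+y. h (U y) * indicator A y \<partial>lebesgue_fun {..<k})"
    by (rule nn_integral_triangular_map[where F = "\<lambda>y. h (U y) * indicator A y", OF d l]) measurable
  also have "\<dots> = (\<integral>\<^sup>+y. ennreal (\<Prod>j<k. 1 / d j) * (h (U y) * indicator A y) \<partial>lebesgue_fun {..<k})"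
    by (rule nn_integral_cmult[symmetric]) measurable
  also have "\<dots> = emeasure (density (lebesgue_fun {..<k}) (\<lambda>y. ennreal (\<Prod>j<k. 1 / d j) * h (U y))) A"
    by (subst emeasure_density) (auto simp: mult.assoc cong: measurable_cong_sets)
  finally show "emeasure (distr (density (lebesgue_fun {..<k}) h) (borel_fun {..<k}) (triangular_map k d l)) A = \<dots>" .
qed (simp add: sets_lebesgue_fun)

section \<open>Scaling of Lebesgue measure and volumes of balls\<close>

lemma nn_integral_scale_lebesgue_fun:
  assumes "finite J" and s: "0 < s" and F: "F \<in> borel_measurable (borel_fun J)"
  shows "(\<integral>\<^sup>+a. F (\<lambda>j\<in>J. s * a j) \<partial>lebesgue_fun J) = ennreal ((1 / s) ^ card J) * (\<integral>\<^sup>+a. F a \<partial>lebesgue_fun J)"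
  using assms(1) F
proof (induction J arbitrary: F rule: finite_induct)
  case empty
  thus ?case by (simp add: PiM_empty nn_integral_count_space_finite restrict_def)
next
  case (insert i J)
  note [measurable] = insert.prems
  define F' where "F' b = (\<integral>\<^sup>+t. F (b(i := t)) \<partial>lborel)" for b
  have F'[measurable]: "F' \<in> borel_measurable (borel_fun J)"
    unfolding F'_def by (rule measurable_nn_integral_fun_upd) fact
  have "(\<integral>\<^sup>+a. F (\<lambda>j\<in>insert i J. s * a j) \<partial>lebesgue_fun (insert i J)) =
     (\<integral>\<^sup>+a. (\<integral>\<^sup>+y. F (\<lambda>j\<in>insert i J. s * (a(i := y)) j) \<partial>lborel) \<partial>lebesgue_fun J)"
    using insert.hyps by (intro lborel_prod.product_nn_integral_insert) measurable
  also have "\<dots> = (\<integral>\<^sup>+a. ennreal (1 / s) * F' (\<lambda>j\<in>J. s * a j) \<partial>lebesgue_fun J)"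
  proof (intro nn_integral_cong)
    fix a
    have T: "(\<lambda>j\<in>insert i J. s * (a(i := y)) j) = (\<lambda>j\<in>J. s * a j)(i := 0 + s * y)" for y
      using insert.hyps by (auto simp: fun_eq_iff)
    have Ta: "(\<lambda>j\<in>J. s * a j) \<in> space (borel_fun J)" by (auto simp: space_PiM)
    show "(\<integral>\<^sup>+y. F (\<lambda>j\<in>insert i J. s * (a(i := y)) j) \<partial>lborel) = ennreal (1 / s) * F' (\<lambda>j\<in>J. s * a j)"
      unfolding T F'_def by (rule nn_integral_affine_fun_upd[OF insert.prems Ta s])
  qed
  also have "\<dots> = ennreal (1 / s) * (\<integral>\<^sup>+a. F' (\<lambda>j\<in>J. s * a j) \<partial>lebesgue_fun J)"
    by (intro nn_integral_cmult) measurable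
  also have "(\<integral>\<^sup>+a. F' (\<lambda>j\<in>J. s * a j) \<partial>lebesgue_fun J) = ennreal ((1 / s) ^ card J) * (\<integral>\<^sup>+a. F' a \<partial>lebesgue_fun J)"
    by (intro insert.IH F')
  also have "(\<integral>\<^sup>+a. F' a \<partial>lebesgue_fun J) = (\<integral>\<^sup>+a. F a \<partial>lebesgue_fun (insert i J))"
    unfolding F'_def using insert.hyps
    by (intro lborel_prod.product_nn_integral_insert[symmetric]) measurable
  also have "ennreal (1 / s) * (ennreal ((1 / s) ^ card J) * (\<integral>\<^sup>+a. F a \<partial>lebesgue_fun (insert i J))) =
      ennreal ((1 / s) ^ card (insert i J)) * (\<integral>\<^sup>+a. F a \<partial>lebesgue_fun (insert i J))"
  proof -
    have c: "0 \<le> 1 / s" "0 \<le> (1 / s) ^ card J" using s by auto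
    have "(1 / s) ^ card (insert i J) = 1 / s * (1 / s) ^ card J" using insert.hyps by simp
    hence "ennreal ((1 / s) ^ card (insert i J)) = ennreal (1 / s) * ennreal ((1 / s) ^ card J)"
      by (simp only: ennreal_mult[OF c])
    thus ?thesis by (simp only: mult.assoc)
  qed
  finally show ?case .
qed

text \<open>The volume scales as the power card J of the radius, and comparison with two cubes shows
  that the unit ball has finite positive volume. The parameter s is the squared radius, whence the
  exponent card J / 2, and \<open>max 0 s\<close> covers negative s, where the ball is empty. The
  value of \<omega> is left open because it cancels upon normalization.\<close>

lemma emeasure_lebesgue_fun_ball:
  fixes J :: "'i set"
  assumes J: "finite J" "J \<noteq> {}"
  obtains \<omega> :: real where "0 < \<omega>"
    "\<And>s. emeasure (lebesgue_fun J) {z \<in> space (lebesgue_fun J). (\<Sum>j\<in>J. (z j)\<^sup>2) \<le> s} =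
      ennreal (\<omega> * max 0 s powr (real (card J) / 2))"
proof -
  define B where "B s = {z \<in> space (lebesgue_fun J). (\<Sum>j\<in>J. (z j)\<^sup>2) \<le> s}" for s
  have Bm[measurable]: "B s \<in> sets (lebesgue_fun J)" for s unfolding B_def by measurable
  have cJ: "0 < card J" using J by (simp add: card_gt_0_iff)
  define V where "V = emeasure (lebesgue_fun J) (B 1)"
  have box: "emeasure (lebesgue_fun J) (\<Pi>\<^sub>E j\<in>J. {- e..e}) = ennreal (2 * e) ^ card J" if "e \<ge> 0" for e :: real
    using that J(1) by (subst lborel_prod.emeasure_PiM) auto
  have "V \<le> emeasure (lebesgue_fun J) (\<Pi>\<^sub>E j\<in>J. {- 1..1})"
    unfolding V_def
  proof (rule emeasure_mono)
    show "B 1 \<subseteq> (\<Pi>\<^sub>E j\<in>J. {- 1..1})"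
    proof
      fix z assume z: "z \<in> B 1"
      have "\<bar>z j\<bar> \<le> 1" if "j \<in> J" for j
      proof -
        have "(z j)\<^sup>2 \<le> (\<Sum>j\<in>J. (z j)\<^sup>2)" using J that by (intro member_le_sum) auto
        also have "\<dots> \<le> 1" using z by (simp add: B_def)
        finally show ?thesis by (simp add: abs_square_le_1)
      qed
      thus "z \<in> (\<Pi>\<^sub>E j\<in>J. {- 1..1})" using z by (force simp: B_def space_PiM PiE_iff abs_le_iff)
    qed
  qed (use J in \<open>auto intro!: sets_PiM_I_finite\<close>)
  also have "\<dots> < \<infinity>" unfolding box[OF zero_le_one] by (subst ennreal_power) auto
  finally have Vfin: "V < \<infinity>" .
  \<comment> \<open>The cube of half-side 1 / card J lies in the unit ball: each of the card J
    squares is at most 1 / card J.\<close>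
  have "0 < ennreal (2 * (1 / real (card J))) ^ card J"
  proof -
    have "0 < (2 * (1 / real (card J))) ^ card J" using cJ by simp
    thus ?thesis by (subst ennreal_power) (simp, subst ennreal_less_zero_iff)
  qed
  also have "\<dots> = emeasure (lebesgue_fun J) (\<Pi>\<^sub>E j\<in>J. {- (1 / real (card J))..1 / real (card J)})"
    by (rule box[symmetric]) simp
  also have "\<dots> \<le> V"
    unfolding V_def
  proof (intro emeasure_mono subsetI Bm)
    fix z assume z: "z \<in> (\<Pi>\<^sub>E j\<in>J. {- (1 / real (card J))..1 / real (card J)})"
    have "(\<Sum>j\<in>J. (z j)\<^sup>2) \<le> (\<Sum>j\<in>J. 1 / real (card J))"
    proof (rule sum_mono)
      fix j assume j: "j \<in> J"
      have a: "\<bar>z j\<bar> \<le> 1 / real (card J)" using z j by (auto simp: PiE_iff abs_le_iff)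
      have b: "1 / real (card J) \<le> 1" using cJ by simp
      have "(z j)\<^sup>2 = \<bar>z j\<bar> * \<bar>z j\<bar>" by (simp add: power2_eq_square)
      also have "\<dots> \<le> 1 / real (card J) * 1" using a b by (intro mult_mono) auto
      finally show "(z j)\<^sup>2 \<le> 1 / real (card J)" by simp
    qed
    also have "\<dots> = 1" using cJ by simp
    finally show "z \<in> B 1" using z by (auto simp: B_def space_PiM PiE_iff)
  qed
  finally have Vpos: "0 < V" .
  obtain \<omega> where \<omega>: "V = ennreal \<omega>" "0 < \<omega>" using Vfin Vpos by (cases V) (auto simp: ennreal_less_zero_iff)
  have "emeasure (lebesgue_fun J) (B s) = ennreal (\<omega> * max 0 s powr (real (card J) / 2))" for s
  proof (cases s "0 :: real" rule: linorder_cases)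
    case less
    have "0 \<le> (\<Sum>j\<in>J. (z j)\<^sup>2)" for z :: "'i \<Rightarrow> real" by (simp add: sum_nonneg)
    hence "B s = {}" using less unfolding B_def by (auto simp: not_le intro: less_le_trans)
    thus ?thesis using less by simp
  next
    case equal
    \<comment> \<open>A degenerate cube, of volume 0 since J is nonempty; this agrees with
      \<open>0 powr p = 0\<close> on the other side.\<close>
    have "B s \<subseteq> (\<Pi>\<^sub>E j\<in>J. {- 0..0})"
    proof
      fix z assume z: "z \<in> B s"
      have "(\<Sum>j\<in>J. (z j)\<^sup>2) = 0" using z unfolding B_def equal by (auto intro!: antisym sum_nonneg)
      hence "\<forall>j\<in>J. z j = 0" using J(1) by (simp add: sum_nonneg_eq_0_iff)
      thus "z \<in> (\<Pi>\<^sub>E j\<in>J. {- 0..0})" using z by (auto simp: B_def space_PiM PiE_iff extensional_def)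
    qed
    hence "emeasure (lebesgue_fun J) (B s) \<le> emeasure (lebesgue_fun J) (\<Pi>\<^sub>E j\<in>J. {- 0..0})"
      using J by (intro emeasure_mono sets_PiM_I_finite) auto
    also have "\<dots> = 0" using box[of 0] cJ by simp
    finally show ?thesis using equal by simp
  next
    case greater
    have Bi: "indicator (B s) \<in> borel_measurable (borel_fun J)" using Bm[of s]
      by (simp add: sets_lebesgue_fun)
    have "V = (\<integral>\<^sup>+a. indicator (B 1) a \<partial>lebesgue_fun J)" unfolding V_def by simp
    \<comment> \<open>Scaling by sqrt s carries the unit ball onto the ball of squared radius
      s.\<close>
    also have "\<dots> = (\<integral>\<^sup>+a. indicator (B s) (\<lambda>j\<in>J. sqrt s * a j) \<partial>lebesgue_fun J)"
    proof (intro nn_integral_cong)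
      fix a assume "a \<in> space (lebesgue_fun J)"
      moreover have "(\<Sum>j\<in>J. (sqrt s * a j)\<^sup>2) \<le> s \<longleftrightarrow> (\<Sum>j\<in>J. (a j)\<^sup>2) \<le> 1"
        using greater by (simp add: power_mult_distrib sum_distrib_left[symmetric])
      ultimately show "indicator (B 1) a = (indicator (B s) (\<lambda>j\<in>J. sqrt s * a j) :: ennreal)"
        by (auto simp: B_def space_PiM split: split_indicator)
    qed
    also have "\<dots> = ennreal ((1 / sqrt s) ^ card J) * (\<integral>\<^sup>+a. indicator (B s) a \<partial>lebesgue_fun J)"
      using greater J Bi by (intro nn_integral_scale_lebesgue_fun) auto
    finally have "V = ennreal ((1 / sqrt s) ^ card J) * emeasure (lebesgue_fun J) (B s)" by simp
    hence "ennreal (sqrt s ^ card J) * V = ennreal (sqrt s ^ card J * (1 / sqrt s) ^ card J) * emeasure (lebesgue_fun J) (B s)"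
      using greater by (subst ennreal_mult) (auto simp: mult.assoc)
    also have "sqrt s ^ card J * (1 / sqrt s) ^ card J = 1"
      using greater by (simp add: power_mult_distrib[symmetric])
    finally have "emeasure (lebesgue_fun J) (B s) = ennreal (\<omega> * sqrt s ^ card J)"
      using \<omega> greater by (simp add: ennreal_mult[symmetric] mult.commute)
    also have "sqrt s ^ card J = s powr (real (card J) / 2)"
      using greater by (simp add: powr_half_sqrt[symmetric] powr_realpow[symmetric] powr_powr)
    finally show ?thesis using greater by simp
  qed
  thus thesis using that \<omega>(2) unfolding B_def by blast
qed


section \<open>Reflections and radial measures\<close>

text \<open>Reflection in the hyperplane orthogonal to d. If d vanishes on I, division by 0 yields 0
  and the map merely restricts x to I.\<close>

definition reflect :: "'i set \<Rightarrow> ('i \<Rightarrow> real) \<Rightarrow> ('i \<Rightarrow> real) \<Rightarrow> ('i \<Rightarrow> real)" where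
  "reflect I d x = (\<lambda>i\<in>I. x i - 2 * (\<Sum>j\<in>I. d j * x j) / (\<Sum>j\<in>I. (d j)\<^sup>2) * d i)"

lemma measurable_reflect [measurable]:
  assumes "finite I"
  shows "reflect I d \<in> measurable (borel_fun I) (borel_fun I)"
  unfolding reflect_def by measurable

text \<open>Reflections are self-adjoint; this moves a reflection of the variable onto the
  frequency.\<close>

lemma sum_mult_reflect:
  "(\<Sum>i\<in>I. t i * reflect I d x i) = (\<Sum>i\<in>I. reflect I d t i * x i)"
proof -
  have *: "(\<Sum>i\<in>I. u i * (y i - c * d i)) = (\<Sum>i\<in>I. u i * y i) - c * (\<Sum>i\<in>I. d i * u i)" for u y c
    by (simp add: right_diff_distrib sum_subtractf sum_distrib_left mult_ac)
  define D where "D = (\<Sum>j\<in>I. (d j)\<^sup>2)"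
  have "(\<Sum>i\<in>I. t i * reflect I d x i) = (\<Sum>i\<in>I. t i * (x i - (2 * (\<Sum>j\<in>I. d j * x j) / D) * d i))"
    by (simp add: reflect_def D_def)
  also have "\<dots> = (\<Sum>i\<in>I. t i * x i) - (2 * (\<Sum>j\<in>I. d j * x j) / D) * (\<Sum>j\<in>I. d j * t j)"
    by (rule *)
  also have "\<dots> = (\<Sum>i\<in>I. x i * t i) - (2 * (\<Sum>j\<in>I. d j * t j) / D) * (\<Sum>j\<in>I. d j * x j)"
    by (simp add: mult.commute)
  also have "\<dots> = (\<Sum>i\<in>I. x i * (t i - (2 * (\<Sum>j\<in>I. d j * t j) / D) * d i))"
    by (rule *[symmetric])
  also have "\<dots> = (\<Sum>i\<in>I. reflect I d t i * x i)"
    by (intro sum.cong) (auto simp: reflect_def D_def)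
  finally show ?thesis .
qed

lemma sum_power2_reflect: "(\<Sum>i\<in>I. (reflect I d x i)\<^sup>2) = (\<Sum>i\<in>I. (x i)\<^sup>2)"
proof -
  define D where "D = (\<Sum>j\<in>I. (d j)\<^sup>2)"
  define c where "c = (\<Sum>j\<in>I. d j * x j)"
  define q where "q = 2 * c / D"
  have "(\<Sum>i\<in>I. (reflect I d x i)\<^sup>2) = (\<Sum>i\<in>I. (x i - q * d i)\<^sup>2)"
    by (simp add: reflect_def D_def c_def q_def)
  also have "\<dots> = (\<Sum>i\<in>I. (x i)\<^sup>2 - 2 * q * (d i * x i) + q\<^sup>2 * (d i)\<^sup>2)"
    by (intro sum.cong) (auto simp: power2_eq_square algebra_simps)
  also have "\<dots> = (\<Sum>i\<in>I. (x i)\<^sup>2) - 2 * q * c + q\<^sup>2 * D"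
    by (simp add: sum.distrib sum_subtractf sum_distrib_left[symmetric] c_def D_def)
  also have "\<dots> = (\<Sum>i\<in>I. (x i)\<^sup>2)" unfolding q_def
    by (cases "D = 0") (simp_all add: power2_eq_square field_simps)
  finally show ?thesis .
qed

text \<open>For vectors of equal norm, s - t is orthogonal to s + t, so the reflection along s - t
  exchanges them. If s and t agree on I, it acts as the identity there.\<close>

lemma reflect_diff:
  assumes "finite I" and eq: "(\<Sum>i\<in>I. (s i)\<^sup>2) = (\<Sum>i\<in>I. (t i)\<^sup>2)" and i: "i \<in> I"
  shows "reflect I (\<lambda>i. s i - t i) t i = s i"
proof (cases "(\<Sum>j\<in>I. (s j - t j)\<^sup>2) = 0")
  case True
  hence "s i = t i" using assms by (simp add: sum_nonneg_eq_0_iff)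
  thus ?thesis using True i by (simp add: reflect_def)
next
  case False
  have "(\<Sum>j\<in>I. (s j - t j)\<^sup>2) = - 2 * (\<Sum>j\<in>I. (s j - t j) * t j) + ((\<Sum>i\<in>I. (s i)\<^sup>2) - (\<Sum>i\<in>I. (t i)\<^sup>2))"
    unfolding sum_distrib_left sum_subtractf[symmetric] sum.distrib[symmetric]
    by (intro sum.cong) (auto simp: power2_eq_square algebra_simps)
  hence "2 * (\<Sum>j\<in>I. (s j - t j) * t j) / (\<Sum>j\<in>I. (s j - t j)\<^sup>2) = - 1"
    using eq False by (simp add: field_simps)
  thus ?thesis using i by (simp add: reflect_def)
qed

text \<open>The characteristic function of the Gaussian depends on the frequency only through its
  norm, which a reflection preserves.\<close>

lemma distr_gauss_fun_reflect:
  assumes I: "finite I"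
  shows "distr (gauss_fun I) (borel_fun I) (reflect I d) = gauss_fun I"
proof (rule char_fun_unique[OF I])
  note [measurable] = measurable_reflect[OF I]
  show "prob_space (distr (gauss_fun I) (borel_fun I) (reflect I d))"
    by (rule prob_space.prob_space_distr[OF prob_space_gauss_fun]) measurable
  show "prob_space (gauss_fun I)" by (rule prob_space_gauss_fun)
  fix t
  have "char_fun I (distr (gauss_fun I) (borel_fun I) (reflect I d)) t =
      (CLINT x|gauss_fun I. iexp (\<Sum>i\<in>I. t i * reflect I d x i))"
    unfolding char_fun_def by (subst integral_distr) (auto simp del: of_real_sum of_real_mult)
  also have "\<dots> = char_fun I (gauss_fun I) (reflect I d t)"
    unfolding char_fun_def sum_mult_reflect ..
  also have "\<dots> = char_fun I (gauss_fun I) t"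
    unfolding char_fun_gauss[OF I] sum_power2_reflect ..
  finally show "char_fun I (distr (gauss_fun I) (borel_fun I) (reflect I d)) t = char_fun I (gauss_fun I) t" .
qed (simp_all add: sets_gauss_fun)

lemma gauss_fun_eq_density:
  assumes I: "finite I"
  shows "gauss_fun I = density (lebesgue_fun I) (\<lambda>x. ennreal (\<Prod>i\<in>I. std_normal_density (x i)))"
proof (rule normal_prod.PiM_eqI[symmetric, OF I])
  show "sets (density (lebesgue_fun I) (\<lambda>x. ennreal (\<Prod>i\<in>I. std_normal_density (x i)))) = sets (gauss_fun I)"
    by (simp add: sets_lebesgue_fun sets_gauss_fun)
  fix A :: "'a \<Rightarrow> real set" assume "\<And>i. i \<in> I \<Longrightarrow> A i \<in> sets std_normal_distribution"
  hence A: "\<And>i. i \<in> I \<Longrightarrow> A i \<in> sets borel" by simp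
  hence PA: "Pi\<^sub>E I A \<in> sets (lebesgue_fun I)" using I by (intro sets_PiM_I_finite) auto
  have "emeasure (density (lebesgue_fun I) (\<lambda>x. ennreal (\<Prod>i\<in>I. std_normal_density (x i)))) (Pi\<^sub>E I A) =
      (\<integral>\<^sup>+x. ennreal (\<Prod>i\<in>I. std_normal_density (x i)) * indicator (Pi\<^sub>E I A) x \<partial>lebesgue_fun I)"
    by (intro emeasure_density PA) measurable
  also have "\<dots> = (\<integral>\<^sup>+x. (\<Prod>i\<in>I. ennreal (std_normal_density (x i)) * indicator (A i) (x i)) \<partial>lebesgue_fun I)"
  proof (intro nn_integral_cong)
    fix x assume x: "x \<in> space (lebesgue_fun I)"
    have "indicator (Pi\<^sub>E I A) x = (\<Prod>i\<in>I. indicator (A i) (x i) :: ennreal)"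
    proof (cases "x \<in> Pi\<^sub>E I A")
      case True
      hence "(\<Prod>i\<in>I. indicator (A i) (x i) :: ennreal) = 1" by (intro prod.neutral) (auto simp: PiE_iff)
      thus ?thesis using True by simp
    next
      case False
      then obtain i where "i \<in> I" "x i \<notin> A i" using x by (auto simp: PiE_iff space_PiM)
      hence "(\<Prod>i\<in>I. indicator (A i) (x i) :: ennreal) = 0" using I by (intro prod_zero bexI[of _ i]) auto
      thus ?thesis using False by simp
    qed
    thus "ennreal (\<Prod>i\<in>I. std_normal_density (x i)) * indicator (Pi\<^sub>E I A) x =
        (\<Prod>i\<in>I. ennreal (std_normal_density (x i)) * indicator (A i) (x i))"
      by (simp add: prod.distrib prod_ennreal)
  qed
  also have "\<dots> = (\<Prod>i\<in>I. \<integral>\<^sup>+x. ennreal (std_normal_density x) * indicator (A i) x \<partial>lborel)"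
    using A by (intro lborel_prod.product_nn_integral_prod[OF I]) auto
  also have "\<dots> = (\<Prod>i\<in>I. emeasure std_normal_distribution (A i))"
    using A by (intro prod.cong refl) (simp add: emeasure_density)
  finally show "emeasure (density (lebesgue_fun I) (\<lambda>x. ennreal (\<Prod>i\<in>I. std_normal_density (x i)))) (Pi\<^sub>E I A) = \<dots>" .
qed

text \<open>Lebesgue measure is not finite in general, so its invariance cannot be read off a
  characteristic function. It is the Gaussian weighted by the reciprocal of the Gaussian density,
  and this weight is a function of the norm; so the invariance of the Gaussian carries over.\<close>

lemma nn_integral_lebesgue_fun_reflect:
  assumes I: "finite I" and F[measurable]: "F \<in> borel_measurable (borel_fun I)"
  shows "(\<integral>\<^sup>+x. F (reflect I d x) \<partial>lebesgue_fun I) = (\<integral>\<^sup>+x. F x \<partial>lebesgue_fun I)"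
proof -
  note [measurable] = measurable_reflect[OF I]
  define w where "w x = ennreal (1 / (\<Prod>i\<in>I. std_normal_density (x i)))" for x
  \<comment> \<open>The weight in terms of the squared norm, so that
    \<open>sum_power2_reflect\<close> applies.\<close>
  have w: "w x = ennreal (1 / ((1 / sqrt (2 * pi)) ^ card I * exp (- (\<Sum>i\<in>I. (x i)\<^sup>2) / 2)))" for x
    unfolding w_def std_normal_density_def prod.distrib
    by (simp add: exp_sum[OF I, symmetric] sum_negf sum_divide_distrib)
  have wm[measurable]: "w \<in> borel_measurable (borel_fun I)" unfolding w_def by measurable
  have *: "(\<integral>\<^sup>+x. H x * w x \<partial>gauss_fun I) = (\<integral>\<^sup>+x. H x \<partial>lebesgue_fun I)"
    if [measurable]: "H \<in> borel_measurable (borel_fun I)" for H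
  proof -
    have "(\<integral>\<^sup>+x. H x * w x \<partial>gauss_fun I) = (\<integral>\<^sup>+x. ennreal (\<Prod>i\<in>I. std_normal_density (x i)) * (H x * w x) \<partial>lebesgue_fun I)"
      unfolding gauss_fun_eq_density[OF I] by (rule nn_integral_density) measurable
    also have "\<dots> = (\<integral>\<^sup>+x. H x \<partial>lebesgue_fun I)"
    proof (intro nn_integral_cong)
      fix x
      have p: "0 < (\<Prod>i\<in>I. std_normal_density (x i))" by (intro prod_pos) (auto simp: normal_density_pos)
      hence "ennreal (\<Prod>i\<in>I. std_normal_density (x i)) * w x = 1"
        unfolding w_def by (subst ennreal_mult[symmetric]) auto
      thus "ennreal (\<Prod>i\<in>I. std_normal_density (x i)) * (H x * w x) = H x"
        by (metis mult.left_commute mult.right_neutral)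
    qed
    finally show ?thesis .
  qed
  have "(\<integral>\<^sup>+x. F (reflect I d x) \<partial>lebesgue_fun I) = (\<integral>\<^sup>+x. F (reflect I d x) * w (reflect I d x) \<partial>gauss_fun I)"
    by (subst *[symmetric]) (auto simp: w sum_power2_reflect)
  also have "\<dots> = (\<integral>\<^sup>+x. F x * w x \<partial>distr (gauss_fun I) (borel_fun I) (reflect I d))"
    by (rule nn_integral_distr[symmetric]) measurable
  also have "\<dots> = (\<integral>\<^sup>+x. F x \<partial>lebesgue_fun I)"
    unfolding distr_gauss_fun_reflect[OF I] by (rule *) measurable
  finally show ?thesis .
qed

section \<open>Measures with radial characteristic function\<close>

definition radial_char :: "'i set \<Rightarrow> ('i \<Rightarrow> real) measure \<Rightarrow> bool" where
  "radial_char I M \<longleftrightarrow> (\<forall>s t. (\<Sum>i\<in>I. (s i)\<^sup>2) = (\<Sum>i\<in>I. (t i)\<^sup>2) \<longrightarrow> char_fun I M s = char_fun I M t)"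

lemma radial_charD:
  assumes "radial_char I M" "(\<Sum>i\<in>I. (s i)\<^sup>2) = (\<Sum>i\<in>I. (t i)\<^sup>2)"
  shows "char_fun I M s = char_fun I M t"
  by (rule assms(1)[unfolded radial_char_def, rule_format, OF assms(2)])

lemma radial_char_density_lebesgue_fun:
  assumes I: "finite I" and f[measurable]: "f \<in> borel_measurable borel"
  shows "radial_char I (density (lebesgue_fun I) (\<lambda>x. f (\<Sum>i\<in>I. (x i)\<^sup>2)))"
  unfolding radial_char_def
proof (intro allI impI)
  fix s t :: "'a \<Rightarrow> real"
  assume eq: "(\<Sum>i\<in>I. (s i)\<^sup>2) = (\<Sum>i\<in>I. (t i)\<^sup>2)"
  note [measurable] = measurable_reflect[OF I]
  \<comment> \<open>The reflection along s - t carries t to s, and it preserves the measure because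
    the density depends only on the norm.\<close>
  define d where "d i = s i - t i" for i
  let ?M = "density (lebesgue_fun I) (\<lambda>x. f (\<Sum>i\<in>I. (x i)\<^sup>2))"
  have inv: "distr ?M (borel_fun I) (reflect I d) = ?M"
  proof (rule measure_eqI)
    fix A assume "A \<in> sets (distr ?M (borel_fun I) (reflect I d))"
    hence A[measurable]: "A \<in> sets (borel_fun I)" by simp
    have T: "reflect I d \<in> measurable ?M (borel_fun I)" by measurable
    have "emeasure (distr ?M (borel_fun I) (reflect I d)) A = emeasure ?M (reflect I d -` A \<inter> space ?M)"
      using T A by (simp add: emeasure_distr)
    also have "\<dots> = (\<integral>\<^sup>+x. f (\<Sum>i\<in>I. (x i)\<^sup>2) * indicator (reflect I d -` A \<inter> space ?M) x \<partial>lebesgue_fun I)"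
      by (rule emeasure_density) (use measurable_sets[OF T A] in auto)
    also have "\<dots> = (\<integral>\<^sup>+x. f (\<Sum>i\<in>I. (reflect I d x i)\<^sup>2) * indicator A (reflect I d x) \<partial>lebesgue_fun I)"
      by (intro nn_integral_cong) (auto simp: sum_power2_reflect split: split_indicator)
    also have "\<dots> = (\<integral>\<^sup>+x. f (\<Sum>i\<in>I. (x i)\<^sup>2) * indicator A x \<partial>lebesgue_fun I)"
      by (rule nn_integral_lebesgue_fun_reflect[OF I, of "\<lambda>x. f (\<Sum>i\<in>I. (x i)\<^sup>2) * indicator A x"]) measurable
    also have "\<dots> = emeasure ?M A" by (rule emeasure_density[symmetric]) measurable
    finally show "emeasure (distr ?M (borel_fun I) (reflect I d)) A = emeasure ?M A" .
  qed (simp add: sets_lebesgue_fun)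
  have "char_fun I ?M t = (CLINT x|distr ?M (borel_fun I) (reflect I d). iexp (\<Sum>i\<in>I. t i * x i))"
    unfolding char_fun_def inv ..
  also have "\<dots> = (CLINT x|?M. iexp (\<Sum>i\<in>I. t i * reflect I d x i))"
    by (rule integral_distr) measurable
  also have "\<dots> = (CLINT x|?M. iexp (\<Sum>i\<in>I. s i * x i))"
  proof -
    have "(\<Sum>i\<in>I. reflect I d t i * x i) = (\<Sum>i\<in>I. s i * x i)" for x
      using reflect_diff[OF I eq] by (intro sum.cong) (auto simp: d_def[abs_def])
    thus ?thesis unfolding sum_mult_reflect by simp
  qed
  finally show "char_fun I ?M s = char_fun I ?M t" by (simp add: char_fun_def)
qed

lemma norm_iexp_diff_le: "norm (iexp a - iexp b) \<le> \<bar>a - b\<bar>"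
proof -
  have "iexp a - iexp b = iexp b * (iexp (a - b) - 1)"
    by (simp add: algebra_simps exp_diff of_real_diff right_diff_distrib)
  hence "norm (iexp a - iexp b) = norm (iexp (a - b) - 1)" by (simp add: norm_mult)
  also have "\<dots> \<le> \<bar>a - b\<bar>" using iexp_approx1[of "a - b" 0] by simp
  finally show ?thesis .
qed

text \<open>If \<open>x\<close> is distributed according to \<open>\<Lambda>\<close> and \<open>a\<close> according to \<open>\<nu>\<close> independently, then
  \<open>x\<close> and \<open>(\<bar>x\<bar> / r) a\<close> have the same characteristic function: by the two invariances, the roles
  of the frequency and of the variable can be exchanged.\<close>

lemma radial_char_approx:
  assumes I: "finite I" and \<Lambda>: "finite_measure \<Lambda>" "sets \<Lambda> = sets (borel_fun I)"
    and \<nu>: "prob_space \<nu>" "sets \<nu> = sets (borel_fun I)"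
    and rad: "radial_char I \<Lambda>" "radial_char I \<nu>"
    and r: "0 < r" and sphere: "AE a in \<nu>. (\<Sum>i\<in>I. (a i)\<^sup>2) = r\<^sup>2"
    and shell: "AE x in \<Lambda>. r\<^sup>2 \<le> (\<Sum>i\<in>I. (x i)\<^sup>2) \<and> (\<Sum>i\<in>I. (x i)\<^sup>2) \<le> (r + \<delta>)\<^sup>2" and \<delta>: "0 \<le> \<delta>"
  shows "norm (char_fun I \<Lambda> t - of_real (measure \<Lambda> (space \<Lambda>)) * char_fun I \<nu> t) \<le>
    measure \<Lambda> (space \<Lambda>) * ((\<Sum>i\<in>I. \<bar>t i\<bar>) * \<delta>)"
proof -
  note [measurable_cong] = \<Lambda>(2) \<nu>(2)
  interpret \<Lambda>: finite_measure \<Lambda> by fact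
  interpret \<nu>: prob_space \<nu> by fact
  interpret \<Lambda>\<nu>: pair_sigma_finite \<Lambda> \<nu> ..
  interpret P: finite_measure "\<Lambda> \<Otimes>\<^sub>M \<nu>"
    by (rule finite_measure_pair_measure[OF \<nu>.finite_measure_axioms \<Lambda>.finite_measure_axioms])
  define l where "l x = sqrt (\<Sum>i\<in>I. (x i)\<^sup>2)" for x :: "'a \<Rightarrow> real"
  have l2: "(l x)\<^sup>2 = (\<Sum>i\<in>I. (x i)\<^sup>2)" for x by (simp add: l_def sum_nonneg)
  have l0: "0 \<le> l x" for x by (simp add: l_def sum_nonneg)
  have scale: "(\<Sum>i\<in>I. (c * x i)\<^sup>2) = (c * l x)\<^sup>2" for c and x :: "'a \<Rightarrow> real"
    by (simp add: power_mult_distrib sum_distrib_left l2)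
  have [measurable]: "l \<in> borel_measurable (borel_fun I)" unfolding l_def by measurable
  \<comment> \<open>Both frequencies have norm l x * l t / r; here the variable x and the frequency
    t change places.\<close>
  have swap: "char_fun I \<nu> (\<lambda>i. l x / r * t i) = char_fun I \<nu> (\<lambda>i. l t / r * x i)" for x
  proof -
    have "l x / r * l t = l t / r * l x" by simp
    hence "(\<Sum>i\<in>I. (l x / r * t i)\<^sup>2) = (\<Sum>i\<in>I. (l t / r * x i)\<^sup>2)" unfolding scale by (simp add: mult.commute)
    thus ?thesis by (rule radial_charD[OF rad(2)])
  qed
  \<comment> \<open>On the sphere l a = r, so the frequency (l t / r) a has the same norm as t;
    after Fubini the inner integral is constant almost everywhere.\<close>
  have const_char: "AE a in \<nu>. char_fun I \<Lambda> (\<lambda>i. l t / r * a i) = char_fun I \<Lambda> t"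
    using sphere
  proof eventually_elim
    case (elim a)
    have "l a = r" using elim r by (simp add: l_def)
    hence "(\<Sum>i\<in>I. (l t / r * a i)\<^sup>2) = (\<Sum>i\<in>I. (t i)\<^sup>2)" using r unfolding scale by (simp add: l2)
    thus ?case by (rule radial_charD[OF rad(1)])
  qed
  have "(CLINT x|\<Lambda>. char_fun I \<nu> (\<lambda>i. l x / r * t i)) = (CLINT x|\<Lambda>. (CLINT a|\<nu>. iexp (\<Sum>i\<in>I. l t / r * x i * a i)))"
    unfolding swap by (simp add: char_fun_def)
  also have "\<dots> = (CLINT a|\<nu>. (CLINT x|\<Lambda>. iexp (\<Sum>i\<in>I. l t / r * x i * a i)))"
    by (rule \<Lambda>\<nu>.Fubini_integral[symmetric], rule P.integrable_const_bound[where B = 1])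
       (auto simp del: of_real_sum of_real_mult)
  also have "\<dots> = (CLINT a|\<nu>. char_fun I \<Lambda> (\<lambda>i. l t / r * a i))"
    by (simp add: char_fun_def mult_ac)
  also have "\<dots> = (CLINT a|\<nu>. char_fun I \<Lambda> t)"
  proof (rule integral_cong_AE[OF _ _ const_char])
    show "(\<lambda>a. char_fun I \<Lambda> (\<lambda>i. l t / r * a i)) \<in> borel_measurable \<nu>"
      unfolding char_fun_def by measurable
  qed simp
  also have "\<dots> = char_fun I \<Lambda> t" by (simp add: \<nu>.prob_space)
  finally have Q: "(CLINT x|\<Lambda>. char_fun I \<nu> (\<lambda>i. l x / r * t i)) = char_fun I \<Lambda> t" .
  \<comment> \<open>Replacing l x / r by 1 changes the phase by at most (l x - r) / r times the sum
    of |t i| |a i|, where |a i| \<le> r and l x - r \<le> \<delta>.\<close>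
  have near: "norm (char_fun I \<nu> (\<lambda>i. l x / r * t i) - char_fun I \<nu> t) \<le> (\<Sum>i\<in>I. \<bar>t i\<bar>) * \<delta>"
    if x: "r \<le> l x" "l x \<le> r + \<delta>" for x
  proof -
    have "norm (char_fun I \<nu> (\<lambda>i. l x / r * t i) - char_fun I \<nu> t) =
        norm (CLINT a|\<nu>. iexp (\<Sum>i\<in>I. l x / r * t i * a i) - iexp (\<Sum>i\<in>I. t i * a i))"
      unfolding char_fun_def
      by (subst Bochner_Integration.integral_diff)
         (auto intro!: \<nu>.integrable_const_bound[where B = 1] simp del: of_real_sum of_real_mult)
    also have "\<dots> \<le> (\<integral>a. norm (iexp (\<Sum>i\<in>I. l x / r * t i * a i) - iexp (\<Sum>i\<in>I. t i * a i)) \<partial>\<nu>)"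
      by (rule integral_norm_bound)
    also have "\<dots> \<le> (\<integral>a. (\<Sum>i\<in>I. \<bar>t i\<bar>) * \<delta> \<partial>\<nu>)"
    proof (rule integral_mono_AE')
      show "AE a in \<nu>. norm (iexp (\<Sum>i\<in>I. l x / r * t i * a i) - iexp (\<Sum>i\<in>I. t i * a i)) \<le> (\<Sum>i\<in>I. \<bar>t i\<bar>) * \<delta>"
        using sphere
      proof eventually_elim
        case (elim a)
        have a: "\<bar>a i\<bar> \<le> r" if "i \<in> I" for i
        proof -
          have "(a i)\<^sup>2 \<le> r\<^sup>2" using member_le_sum[OF that, of "\<lambda>i. (a i)\<^sup>2"] I elim by simp
          thus ?thesis using r by (simp add: abs_le_square_iff[symmetric])
        qed
        have "norm (iexp (\<Sum>i\<in>I. l x / r * t i * a i) - iexp (\<Sum>i\<in>I. t i * a i)) \<le>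
            \<bar>(\<Sum>i\<in>I. l x / r * t i * a i) - (\<Sum>i\<in>I. t i * a i)\<bar>"
          by (rule norm_iexp_diff_le)
        also have "(\<Sum>i\<in>I. l x / r * t i * a i) - (\<Sum>i\<in>I. t i * a i) = (\<Sum>i\<in>I. (l x - r) / r * (t i * a i))"
          unfolding sum_subtractf[symmetric] using r by (intro sum.cong) (auto simp: field_simps)
        also have "\<bar>\<dots>\<bar> \<le> (\<Sum>i\<in>I. \<bar>t i\<bar> * \<delta>)"
        proof (rule order_trans[OF sum_abs], rule sum_mono)
          fix i assume i: "i \<in> I"
          have "\<bar>(l x - r) / r * (t i * a i)\<bar> = (l x - r) / r * (\<bar>t i\<bar> * \<bar>a i\<bar>)"
            using x r by (simp add: abs_mult)
          also have "\<dots> \<le> \<delta> / r * (\<bar>t i\<bar> * r)"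
            using x r \<delta> a[OF i] by (intro mult_mono divide_right_mono) auto
          finally show "\<bar>(l x - r) / r * (t i * a i)\<bar> \<le> \<bar>t i\<bar> * \<delta>" using r by (simp add: field_simps)
        qed
        finally show ?case by (simp add: sum_distrib_right)
      qed
    qed (use \<delta> in \<open>auto intro!: mult_nonneg_nonneg sum_nonneg\<close>)
    also have "\<dots> = (\<Sum>i\<in>I. \<bar>t i\<bar>) * \<delta>" by (simp add: \<nu>.prob_space)
    finally show ?thesis .
  qed
  have bd: "norm (char_fun I \<nu> s) \<le> 1" for s
  proof -
    have "norm (char_fun I \<nu> s) \<le> (\<integral>a. norm (iexp (\<Sum>i\<in>I. s i * a i)) \<partial>\<nu>)"
      unfolding char_fun_def by (rule integral_norm_bound)
    thus ?thesis by (simp add: \<nu>.prob_space del: of_real_sum of_real_mult)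
  qed
  have m: "(\<lambda>x. char_fun I \<nu> (\<lambda>i. l x / r * t i)) \<in> borel_measurable \<Lambda>"
    unfolding char_fun_def by measurable
  have "norm (char_fun I \<Lambda> t - of_real (measure \<Lambda> (space \<Lambda>)) * char_fun I \<nu> t) =
     norm (CLINT x|\<Lambda>. char_fun I \<nu> (\<lambda>i. l x / r * t i) - char_fun I \<nu> t)"
    unfolding Q[symmetric] using m bd
    by (subst Bochner_Integration.integral_diff)
       (auto intro!: \<Lambda>.integrable_const_bound[where B = 1] simp: scaleR_conv_of_real)
  also have "\<dots> \<le> (\<integral>x. norm (char_fun I \<nu> (\<lambda>i. l x / r * t i) - char_fun I \<nu> t) \<partial>\<Lambda>)"
    by (rule integral_norm_bound)
  also have "\<dots> \<le> (\<integral>x. (\<Sum>i\<in>I. \<bar>t i\<bar>) * \<delta> \<partial>\<Lambda>)"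
  proof (rule integral_mono_AE')
    show "AE x in \<Lambda>. norm (char_fun I \<nu> (\<lambda>i. l x / r * t i) - char_fun I \<nu> t) \<le> (\<Sum>i\<in>I. \<bar>t i\<bar>) * \<delta>"
      using shell
    proof eventually_elim
      case (elim x)
      hence "r \<le> l x" "l x \<le> r + \<delta>" using r \<delta> l0[of x]
        by (auto simp: l2[symmetric] intro: power2_le_imp_le)
      thus ?case by (rule near)
    qed
  qed (use \<delta> in \<open>auto intro!: mult_nonneg_nonneg sum_nonneg\<close>)
  also have "\<dots> = measure \<Lambda> (space \<Lambda>) * ((\<Sum>i\<in>I. \<bar>t i\<bar>) * \<delta>)" by simp
  finally show ?thesis .
qed


section \<open>Marginals of the uniform distribution on a sphere\<close>

lemma powr_diff_bounds:
  fixes u v q :: real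
  assumes "0 < q" "0 \<le> u" "u \<le> v"
  shows "(q + 1) * u powr q * (v - u) \<le> v powr (q + 1) - u powr (q + 1)"
    and "v powr (q + 1) - u powr (q + 1) \<le> (q + 1) * v powr q * (v - u)"
proof -
  have "(q + 1) * u powr q * (v - u) \<le> v powr (q + 1) - u powr (q + 1) \<and>
    v powr (q + 1) - u powr (q + 1) \<le> (q + 1) * v powr q * (v - u)"
  proof (cases "u = v \<or> u = 0")
    case True
    thus ?thesis
    proof
      assume "u = 0"
      moreover have "v powr (q + 1) = v powr q * v" using assms by (simp add: powr_add)
      moreover have "v powr q * v \<le> (q + 1) * (v powr q * v)"
        using assms by (simp add: mult_le_cancel_right1 distrib_right)
      ultimately show ?thesis using assms by (simp add: mult.assoc)
    qed simp
  next
    case False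
    hence "0 < u" "u < v" using assms by auto
    \<comment> \<open>Mean value theorem; u = 0 was set aside because the derivative of
      \<open>powr\<close> is taken at positive arguments.\<close>
    have "\<exists>z>u. z < v \<and> v powr (q + 1) - u powr (q + 1) = (v - u) * ((q + 1) * z powr q)"
      using \<open>0 < u\<close> \<open>u < v\<close> by (intro MVT2) (auto intro!: derivative_eq_intros)
    then obtain z where z: "u < z" "z < v" "v powr (q + 1) - u powr (q + 1) = (v - u) * ((q + 1) * z powr q)"
      by blast
    have "u powr q \<le> z powr q" "z powr q \<le> v powr q"
      using z \<open>0 < u\<close> assms by (auto intro!: powr_mono2)
    thus ?thesis unfolding z(3) using assms \<open>u < v\<close>
      by (auto simp: mult.commute[of "v - u"] intro!: mult_right_mono mult_left_mono)
  qed
  thus "(q + 1) * u powr q * (v - u) \<le> v powr (q + 1) - u powr (q + 1)"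
    "v powr (q + 1) - u powr (q + 1) \<le> (q + 1) * v powr q * (v - u)" by auto
qed

text \<open>Truncation at 0 shortens the interval from s to s', which favours the upper bound, and
  for negative s the lower bound is 0. With s and s' the squared radii of the fibre of a shell, the
  two bounds give both the limit and an integrable majorant for the difference quotient of its
  volume.\<close>

lemma max_powr_diff_bounds:
  fixes s s' q :: real
  assumes "0 < q" "s \<le> s'"
  shows "(q + 1) * max 0 s powr q * (s' - s) \<le> max 0 s' powr (q + 1) - max 0 s powr (q + 1)"
    and "max 0 s' powr (q + 1) - max 0 s powr (q + 1) \<le> (q + 1) * max 0 s' powr q * (s' - s)"
proof -
  note b = powr_diff_bounds[of q "max 0 s" "max 0 s'"]
  show "(q + 1) * max 0 s powr q * (s' - s) \<le> max 0 s' powr (q + 1) - max 0 s powr (q + 1)"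
  proof (cases "0 \<le> s")
    case True
    thus ?thesis using b(1) assms by simp
  next
    case False
    thus ?thesis using assms by simp
  qed
  have "max 0 s' powr (q + 1) - max 0 s powr (q + 1) \<le> (q + 1) * max 0 s' powr q * (max 0 s' - max 0 s)"
    using b(2) assms by simp
  also have "\<dots> \<le> (q + 1) * max 0 s' powr q * (s' - s)"
    using assms by (intro mult_left_mono) auto
  finally show "max 0 s' powr (q + 1) - max 0 s powr (q + 1) \<le> (q + 1) * max 0 s' powr q * (s' - s)" .
qed

section \<open>Thin shells and their marginals\<close>

lemma distr_shell_restrict:
  fixes k n :: nat
  assumes kn: "k < n"
    and \<omega>: "0 < \<omega>" "\<And>s. emeasure (lebesgue_fun {k..<n}) {z \<in> space (lebesgue_fun {k..<n}). (\<Sum>j\<in>{k..<n}. (z j)\<^sup>2) \<le> s} =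
      ennreal (\<omega> * max 0 s powr p)"
    and ab: "a \<le> b"
  shows "distr (density (lebesgue_fun {..<n}) (\<lambda>x. indicator {a<..b} (\<Sum>i<n. (x i)\<^sup>2))) (borel_fun {..<k}) (\<lambda>x. restrict x {..<k}) =
    density (lebesgue_fun {..<k}) (\<lambda>y. ennreal (\<omega> * (max 0 (b - (\<Sum>i<k. (y i)\<^sup>2)) powr p - max 0 (a - (\<Sum>i<k. (y i)\<^sup>2)) powr p)))"
    (is "distr ?M _ ?r = density _ ?g")
proof (rule measure_eqI)
  have un: "{..<k} \<union> {k..<n} = {..<n}" and disj: "{..<k} \<inter> {k..<n} = {}" using kn by auto
  fix A assume "A \<in> sets (distr ?M (borel_fun {..<k}) ?r)"
  hence A[measurable]: "A \<in> sets (borel_fun {..<k})" by simp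
  have R: "?r \<in> measurable (borel_fun {..<n}) (borel_fun {..<k})"
    using kn by (intro measurable_restrict_subset) auto
  note [measurable] = R
  have T: "?r \<in> measurable ?M (borel_fun {..<k})" by measurable
  have "emeasure (distr ?M (borel_fun {..<k}) ?r) A = emeasure ?M (?r -` A \<inter> space ?M)"
    using T A by (simp add: emeasure_distr)
  also have "\<dots> = (\<integral>\<^sup>+x. indicator {a<..b} (\<Sum>i<n. (x i)\<^sup>2) * indicator (?r -` A \<inter> space ?M) x \<partial>lebesgue_fun {..<n})"
    by (rule emeasure_density) (use measurable_sets[OF T A] in auto)
  also have "\<dots> = (\<integral>\<^sup>+x. indicator {a<..b} (\<Sum>i<n. (x i)\<^sup>2) * indicator A (?r x) \<partial>lebesgue_fun {..<n})"
    by (intro nn_integral_cong) (auto split: split_indicator)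
  also have "\<dots> = (\<integral>\<^sup>+y. (\<integral>\<^sup>+z. indicator {a<..b} (\<Sum>i<n. (merge {..<k} {k..<n} (y, z) i)\<^sup>2) * indicator A (?r (merge {..<k} {k..<n} (y, z)))
      \<partial>lebesgue_fun {k..<n}) \<partial>lebesgue_fun {..<k})"
  proof -
    have "(\<lambda>x. indicator {a<..b} (\<Sum>i<n. (x i)\<^sup>2) * indicator A (?r x) :: ennreal) \<in> borel_measurable (lebesgue_fun {..<n})"
      by measurable
    from lborel_prod.product_nn_integral_fold[OF disj, unfolded un, OF _ _ this] show ?thesis by simp
  qed
  also have "\<dots> = (\<integral>\<^sup>+y. ?g y * indicator A y \<partial>lebesgue_fun {..<k})"
  proof (intro nn_integral_cong)
    fix y assume y: "y \<in> space (lebesgue_fun {..<k})"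
    define B where "B s = {z \<in> space (lebesgue_fun {k..<n}). (\<Sum>j\<in>{k..<n}. (z j)\<^sup>2) \<le> s}" for s
    have Bm: "B s \<in> sets (lebesgue_fun {k..<n})" for s unfolding B_def by measurable
    let ?y = "\<Sum>i<k. (y i)\<^sup>2"
    have r: "?r (merge {..<k} {k..<n} (y, z)) = y" for z
      using y by (auto simp: merge_def fun_eq_iff space_PiM PiE_iff extensional_def)
    \<comment> \<open>Over a fixed y the shell is the difference of two balls in the remaining n - k
      coordinates, with squared radii b - |y|^2 and a - |y|^2.\<close>
    have "(\<Sum>i<n. (merge {..<k} {k..<n} (y, z) i)\<^sup>2) = ?y + (\<Sum>j\<in>{k..<n}. (z j)\<^sup>2)" for z
      unfolding un[symmetric] by (subst sum.union_disjoint) (auto simp: merge_def intro!: arg_cong2[where f = "(+)"] sum.cong)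
    hence "(\<integral>\<^sup>+z. indicator {a<..b} (\<Sum>i<n. (merge {..<k} {k..<n} (y, z) i)\<^sup>2) * indicator A (?r (merge {..<k} {k..<n} (y, z)))
      \<partial>lebesgue_fun {k..<n}) = (\<integral>\<^sup>+z. indicator A y * indicator (B (b - ?y) - B (a - ?y)) z \<partial>lebesgue_fun {k..<n})"
      unfolding r by (intro nn_integral_cong) (auto simp: B_def split: split_indicator)
    also have "\<dots> = indicator A y * emeasure (lebesgue_fun {k..<n}) (B (b - ?y) - B (a - ?y))"
      by (rule nn_integral_cmult_indicator) (use Bm in auto)
    also have "emeasure (lebesgue_fun {k..<n}) (B (b - ?y) - B (a - ?y)) =
        emeasure (lebesgue_fun {k..<n}) (B (b - ?y)) - emeasure (lebesgue_fun {k..<n}) (B (a - ?y))"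
      using ab \<omega>(2)[of "a - ?y"] by (intro emeasure_Diff Bm) (auto simp: B_def)
    also have "\<dots> = ?g y"
      unfolding B_def \<omega>(2) using \<omega>(1) by (simp add: ennreal_minus right_diff_distrib)
    also have "indicator A y * ?g y = ?g y * indicator A y" by (rule mult.commute)
    finally show "(\<integral>\<^sup>+z. indicator {a<..b} (\<Sum>i<n. (merge {..<k} {k..<n} (y, z) i)\<^sup>2) * indicator A (?r (merge {..<k} {k..<n} (y, z)))
      \<partial>lebesgue_fun {k..<n}) = ?g y * indicator A y" .
  qed
  also have "\<dots> = emeasure (density (lebesgue_fun {..<k}) ?g) A"
    by (rule emeasure_density[symmetric]) measurable
  finally show "emeasure (distr ?M (borel_fun {..<k}) ?r) A = emeasure (density (lebesgue_fun {..<k}) ?g) A" .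
qed (simp add: sets_lebesgue_fun)

lemma integrable_max_powr:
  assumes J: "finite J" "J \<noteq> {}" and p: "0 \<le> p"
  shows "integrable (lebesgue_fun J) (\<lambda>y. max 0 (s - (\<Sum>i\<in>J. (y i)\<^sup>2)) powr p)"
proof -
  obtain \<omega> where \<omega>: "\<And>s. emeasure (lebesgue_fun J) {z \<in> space (lebesgue_fun J). (\<Sum>j\<in>J. (z j)\<^sup>2) \<le> s} =
      ennreal (\<omega> * max 0 s powr (real (card J) / 2))"
    using emeasure_lebesgue_fun_ball[OF J] by blast
  let ?B = "{z \<in> space (lebesgue_fun J). (\<Sum>j\<in>J. (z j)\<^sup>2) \<le> s}"
  have "integrable (lebesgue_fun J) (\<lambda>y. max 0 s powr p * indicator ?B y)"
  proof (intro integrable_mult_right integrable_real_indicator)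
    show "?B \<in> sets (lebesgue_fun J)" by measurable
    show "emeasure (lebesgue_fun J) ?B < \<infinity>" unfolding \<omega> by simp
  qed
  thus ?thesis
  proof (rule Bochner_Integration.integrable_bound)
    show "AE y in lebesgue_fun J. norm (max 0 (s - (\<Sum>i\<in>J. (y i)\<^sup>2)) powr p) \<le> norm (max 0 s powr p * indicator ?B y)"
    proof (intro AE_I2)
      fix y assume y: "y \<in> space (lebesgue_fun J)"
      have n: "0 \<le> (\<Sum>i\<in>J. (y i)\<^sup>2)" by (simp add: sum_nonneg)
      show "norm (max 0 (s - (\<Sum>i\<in>J. (y i)\<^sup>2)) powr p) \<le> norm (max 0 s powr p * indicator ?B y)"
      proof (cases "y \<in> ?B")
        case True
        have "max 0 (s - (\<Sum>i\<in>J. (y i)\<^sup>2)) powr p \<le> max 0 s powr p"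
          using n p by (intro powr_mono2) auto
        thus ?thesis using True by simp
      next
        case False
        thus ?thesis using y by simp
      qed
    qed
  qed measurable
qed

text \<open>The ball of squared radius s / 2 has positive volume, and on it the integrand is at
  least (s / 2) powr p.\<close>

lemma integral_max_powr_pos:
  assumes J: "finite J" "J \<noteq> {}" and p: "0 \<le> p" and s: "0 < s"
  shows "0 < (\<integral>y. max 0 (s - (\<Sum>i\<in>J. (y i)\<^sup>2)) powr p \<partial>lebesgue_fun J)"
proof -
  obtain \<omega> where \<omega>: "0 < \<omega>" "\<And>s. emeasure (lebesgue_fun J) {z \<in> space (lebesgue_fun J). (\<Sum>j\<in>J. (z j)\<^sup>2) \<le> s} =
      ennreal (\<omega> * max 0 s powr (real (card J) / 2))"
    using emeasure_lebesgue_fun_ball[OF J] by blast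
  let ?B = "{z \<in> space (lebesgue_fun J). (\<Sum>j\<in>J. (z j)\<^sup>2) \<le> s / 2}"
  have Bm: "?B \<in> sets (lebesgue_fun J)" by measurable
  have B: "measure (lebesgue_fun J) ?B = \<omega> * (s / 2) powr (real (card J) / 2)"
    unfolding measure_def \<omega>(2) using \<omega>(1) s by simp
  have "0 < (s / 2) powr p * measure (lebesgue_fun J) ?B" unfolding B using \<omega>(1) s by simp
  also have "\<dots> = (\<integral>y. (s / 2) powr p * indicator ?B y \<partial>lebesgue_fun J)"
    using Bm by simp
  also have "\<dots> \<le> (\<integral>y. max 0 (s - (\<Sum>i\<in>J. (y i)\<^sup>2)) powr p \<partial>lebesgue_fun J)"
  proof (rule integral_mono')
    fix y
    show "(s / 2) powr p * indicator ?B y \<le> max 0 (s - (\<Sum>i\<in>J. (y i)\<^sup>2)) powr p"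
    proof (cases "y \<in> ?B")
      case True
      hence "(s / 2) powr p \<le> max 0 (s - (\<Sum>i\<in>J. (y i)\<^sup>2)) powr p"
        using s p by (intro powr_mono2) auto
      thus ?thesis using True by simp
    qed simp
  qed (rule integrable_max_powr[OF J p], simp)
  finally show ?thesis .
qed

text \<open>The error in \<open>radial_char_approx\<close> is the mass of the shell times a multiple
  of its thickness. Division by the width of the shell keeps the mass bounded while the error
  vanishes, so in the limit the characteristic function of the marginal is the transform of h
  divided by its total mass.\<close>

theorem distr_restrict_radial_sphere:
  fixes \<nu> :: "(nat \<Rightarrow> real) measure"
  assumes \<nu>: "prob_space \<nu>" "sets \<nu> = sets (borel_fun {..<n})" and rad: "radial_char {..<n} \<nu>"
    and r: "0 < r" and sphere: "AE a in \<nu>. (\<Sum>i<n. (a i)\<^sup>2) = r\<^sup>2"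
    and k: "0 < k" and kn: "k + 3 \<le> n"
  defines "h \<equiv> \<lambda>y. max 0 (r\<^sup>2 - (\<Sum>i<k. (y i)\<^sup>2)) powr (real (n - k) / 2 - 1)"
  shows "distr \<nu> (borel_fun {..<k}) (\<lambda>x. restrict x {..<k}) =
    density (lebesgue_fun {..<k}) (\<lambda>y. ennreal (h y / (\<integral>y. h y \<partial>lebesgue_fun {..<k})))"
proof -
  note [measurable_cong] = \<nu>(2)
  interpret \<nu>: prob_space \<nu> by fact
  have R[measurable]: "(\<lambda>x. restrict x {..<k}) \<in> measurable (borel_fun {..<n}) (borel_fun {..<k})"
    using kn by (intro measurable_restrict_subset) auto
  \<comment> \<open>The fibre over y has dimension n - k, so its volume is a multiple of the power q
    + 1 = (n - k) / 2 of the squared radius. The derivative has exponent q, and k + 3 \<le> n makes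
    q positive, as the mean value bounds require.\<close>
  define q where "q = real (n - k) / 2 - 1"
  have q: "0 < q" using kn by (simp add: q_def)
  have h: "h = (\<lambda>y. max 0 (r\<^sup>2 - (\<Sum>i<k. (y i)\<^sup>2)) powr q)" unfolding h_def q_def ..
  have J: "finite {..<k}" "{..<k} \<noteq> {}" using k by auto
  have hint: "integrable (lebesgue_fun {..<k}) h" unfolding h using J q by (intro integrable_max_powr) auto
  have hpos: "0 < (\<integral>y. h y \<partial>lebesgue_fun {..<k})" unfolding h using J q r by (intro integral_max_powr_pos) auto
  have h0: "0 \<le> h y" for y by (simp add: h)
  have hm[measurable]: "h \<in> borel_measurable (borel_fun {..<k})" unfolding h by measurable
  obtain \<omega> where \<omega>: "0 < \<omega>" "\<And>s. emeasure (lebesgue_fun {k..<n}) {z \<in> space (lebesgue_fun {k..<n}). (\<Sum>j\<in>{k..<n}. (z j)\<^sup>2) \<le> s} =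
      ennreal (\<omega> * max 0 s powr (q + 1))"
  proof -
    have "finite {k..<n}" "{k..<n} \<noteq> {}" using kn by auto
    from emeasure_lebesgue_fun_ball[OF this] show thesis using that by (auto simp: q_def)
  qed
  define \<delta> where "\<delta> j = 1 / real (Suc j)" for j
  have \<delta>: "0 < \<delta> j" "\<delta> j \<le> 1" for j by (auto simp: \<delta>_def)
  have \<delta>_lim: "\<delta> \<longlonglongrightarrow> 0" unfolding \<delta>_def using LIMSEQ_inverse_real_of_nat by (simp add: inverse_eq_divide)
  \<comment> \<open>The width of the shell in the squared radius; dividing by it makes
    \<open>g j\<close> a difference quotient, with limit (q + 1) h.\<close>
  define c where "c j = (r + \<delta> j)\<^sup>2 - r\<^sup>2" for j
  have c: "0 < c j" for j using \<delta>[of j] r by (simp add: c_def power2_sum add_pos_pos)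
  define g where "g j y = (max 0 ((r + \<delta> j)\<^sup>2 - (\<Sum>i<k. (y i)\<^sup>2)) powr (q + 1) - max 0 (r\<^sup>2 - (\<Sum>i<k. (y i)\<^sup>2)) powr (q + 1)) / c j"
    for j and y :: "nat \<Rightarrow> real"
  have gm[measurable]: "g j \<in> borel_measurable (borel_fun {..<k})" for j unfolding g_def by measurable
  have g_lower: "(q + 1) * h y \<le> g j y" for j y
    using max_powr_diff_bounds(1)[OF q, of "r\<^sup>2 - (\<Sum>i<k. (y i)\<^sup>2)" "(r + \<delta> j)\<^sup>2 - (\<Sum>i<k. (y i)\<^sup>2)"] c[of j]
    by (simp add: g_def h c_def pos_le_divide_eq)
  have g_upper: "g j y \<le> (q + 1) * max 0 ((r + \<delta> j)\<^sup>2 - (\<Sum>i<k. (y i)\<^sup>2)) powr q" for j y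
    using max_powr_diff_bounds(2)[OF q, of "r\<^sup>2 - (\<Sum>i<k. (y i)\<^sup>2)" "(r + \<delta> j)\<^sup>2 - (\<Sum>i<k. (y i)\<^sup>2)"] c[of j]
    by (simp add: g_def c_def pos_divide_le_eq)
  have g0: "0 \<le> g j y" for j y
    by (rule order_trans[OF _ g_lower]) (use q h0 in auto)
  \<comment> \<open>As \<open>\<delta> j\<close> is at most 1, one integrable majorant serves all
    shells.\<close>
  define W where "W y = (q + 1) * max 0 ((r + 1)\<^sup>2 - (\<Sum>i<k. (y i)\<^sup>2)) powr q" for y :: "nat \<Rightarrow> real"
  have W: "integrable (lebesgue_fun {..<k}) W" unfolding W_def
    using J q by (intro integrable_mult_right integrable_max_powr) auto
  have g_le_W: "g j y \<le> W y" for j y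
  proof (rule order_trans[OF g_upper])
    have "(r + \<delta> j)\<^sup>2 \<le> (r + 1)\<^sup>2" using \<delta>[of j] r by (intro power_mono) auto
    thus "(q + 1) * max 0 ((r + \<delta> j)\<^sup>2 - (\<Sum>i<k. (y i)\<^sup>2)) powr q \<le> W y"
      unfolding W_def using q by (intro mult_left_mono powr_mono2) auto
  qed
  have g_lim: "(\<lambda>j. g j y) \<longlonglongrightarrow> (q + 1) * h y" for y
  proof (rule tendsto_sandwich[where f = "\<lambda>_. (q + 1) * h y"])
    have "(\<lambda>j. max 0 ((r + \<delta> j)\<^sup>2 - (\<Sum>i<k. (y i)\<^sup>2))) \<longlonglongrightarrow> max 0 ((r + 0)\<^sup>2 - (\<Sum>i<k. (y i)\<^sup>2))"
      by (intro tendsto_intros \<delta>_lim)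
    hence "(\<lambda>j. max 0 ((r + \<delta> j)\<^sup>2 - (\<Sum>i<k. (y i)\<^sup>2)) powr q) \<longlonglongrightarrow> max 0 ((r + 0)\<^sup>2 - (\<Sum>i<k. (y i)\<^sup>2)) powr q"
      by (rule tendsto_powr2) (use q in auto)
    thus "(\<lambda>j. (q + 1) * max 0 ((r + \<delta> j)\<^sup>2 - (\<Sum>i<k. (y i)\<^sup>2)) powr q) \<longlonglongrightarrow> (q + 1) * h y"
      unfolding h by (intro tendsto_mult tendsto_const) simp
  qed (use g_lower g_upper in auto)
  define G where "G j t = (CLINT y|lebesgue_fun {..<k}. g j y *\<^sub>R iexp (\<Sum>i<k. t i * y i))" for j t
  define H where "H t = (CLINT y|lebesgue_fun {..<k}. h y *\<^sub>R iexp (\<Sum>i<k. t i * y i))" for t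
  define \<nu>k where "\<nu>k = distr \<nu> (borel_fun {..<k}) (\<lambda>x. restrict x {..<k})"
  have G_lim: "(\<lambda>j. G j t) \<longlonglongrightarrow> (q + 1) *\<^sub>R H t" for t
  proof -
    have "(\<lambda>j. G j t) \<longlonglongrightarrow> (CLINT y|lebesgue_fun {..<k}. ((q + 1) * h y) *\<^sub>R iexp (\<Sum>i<k. t i * y i))"
      unfolding G_def
    proof (rule integral_dominated_convergence[where w = W])
      show "AE y in lebesgue_fun {..<k}. (\<lambda>j. g j y *\<^sub>R iexp (\<Sum>i<k. t i * y i)) \<longlonglongrightarrow> ((q + 1) * h y) *\<^sub>R iexp (\<Sum>i<k. t i * y i)"
        by (intro AE_I2 tendsto_scaleR g_lim tendsto_const)
      show "AE y in lebesgue_fun {..<k}. norm (g j y *\<^sub>R iexp (\<Sum>i<k. t i * y i)) \<le> W y" for j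
        using g_le_W[of j] g0[of j] by (simp del: of_real_sum of_real_mult)
    qed (use W in measurable)
    thus ?thesis unfolding H_def scaleR_scaleR[symmetric] integral_scaleR_right .
  qed
  have approx: "norm (G j t - G j (\<lambda>_. 0) * char_fun {..<k} \<nu>k t) \<le> norm (G j (\<lambda>_. 0)) * ((\<Sum>i<k. \<bar>t i\<bar>) * \<delta> j)" for j t
  proof -
    define \<Lambda> where "\<Lambda> = density (lebesgue_fun {..<n}) (\<lambda>x. indicator {r\<^sup>2<..(r + \<delta> j)\<^sup>2} (\<Sum>i<n. (x i)\<^sup>2))"
    have s\<Lambda>[measurable_cong]: "sets \<Lambda> = sets (borel_fun {..<n})" by (simp add: \<Lambda>_def sets_lebesgue_fun)
    \<comment> \<open>Extending the frequency by zero turns characteristic functions in dimension n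
      into those of the marginals.\<close>
    define t' where "t' i = (if i < k then t i else 0)" for i
    have t': "(\<Sum>i<n. t' i * x i) = (\<Sum>i<k. t i * restrict x {..<k} i)" for x
    proof -
      have "(\<Sum>i<n. t' i * x i) = (\<Sum>i\<in>{..<k}. t' i * x i)"
        using kn by (intro sum.mono_neutral_right) (auto simp: t'_def)
      thus ?thesis by (simp add: t'_def)
    qed
    have t'_abs: "(\<Sum>i<n. \<bar>t' i\<bar>) = (\<Sum>i<k. \<bar>t i\<bar>)"
    proof -
      have "(\<Sum>i<n. \<bar>t' i\<bar>) = (\<Sum>i\<in>{..<k}. \<bar>t' i\<bar>)"
        using kn by (intro sum.mono_neutral_right) (auto simp: t'_def)
      thus ?thesis by (simp add: t'_def)
    qed
    have \<omega>c: "0 < \<omega> * c j" using \<omega>(1) c by simp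
    have marg: "distr \<Lambda> (borel_fun {..<k}) (\<lambda>x. restrict x {..<k}) = density (lebesgue_fun {..<k}) (\<lambda>y. ennreal (\<omega> * c j * g j y))"
      unfolding \<Lambda>_def using kn \<delta>[of j] r c[of j]
      by (subst distr_shell_restrict[OF _ \<omega>]) (auto simp: g_def intro!: power_mono)
    have ch: "(CLINT x|\<Lambda>. iexp (\<Sum>i<k. s i * restrict x {..<k} i)) = of_real (\<omega> * c j) * G j s" for s
    proof -
      have "(CLINT x|\<Lambda>. iexp (\<Sum>i<k. s i * restrict x {..<k} i)) = (CLINT y|distr \<Lambda> (borel_fun {..<k}) (\<lambda>x. restrict x {..<k}). iexp (\<Sum>i<k. s i * y i))"
        by (rule integral_distr[symmetric]) measurable
      also have "\<dots> = (CLINT y|lebesgue_fun {..<k}. (\<omega> * c j * g j y) *\<^sub>R iexp (\<Sum>i<k. s i * y i))"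
        unfolding marg by (rule integral_density) (use \<omega>c g0 in \<open>auto simp del: of_real_sum of_real_mult\<close>)
      also have "\<dots> = of_real (\<omega> * c j) * G j s"
        unfolding G_def scaleR_scaleR[symmetric] integral_scaleR_right by (simp add: scaleR_conv_of_real)
      finally show ?thesis .
    qed
    have fin: "finite_measure \<Lambda>"
    proof (rule finite_measureI)
      have sp: "(\<lambda>x. restrict x {..<k}) -` space (borel_fun {..<k}) \<inter> space \<Lambda> = space \<Lambda>"
        by (auto simp: space_PiM)
      have "emeasure \<Lambda> (space \<Lambda>) = emeasure (distr \<Lambda> (borel_fun {..<k}) (\<lambda>x. restrict x {..<k})) (space (borel_fun {..<k}))"
        by (subst emeasure_distr) (auto simp: sp)
      also have "\<dots> = (\<integral>\<^sup>+y. ennreal (\<omega> * c j * g j y) \<partial>lebesgue_fun {..<k})"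
        unfolding marg by (subst emeasure_density) (auto simp: space_PiM intro!: nn_integral_cong)
      also have "\<dots> < \<infinity>"
      proof -
        have "integrable (lebesgue_fun {..<k}) (g j)"
        proof (rule Bochner_Integration.integrable_bound[OF W])
          have "norm (g j y) \<le> norm (W y)" for y using g0[of j y] g_le_W[of j y] by simp
          thus "AE y in lebesgue_fun {..<k}. norm (g j y) \<le> norm (W y)" by simp
        qed measurable
        hence "integrable (lebesgue_fun {..<k}) (\<lambda>y. \<omega> * c j * g j y)" by (rule integrable_mult_right)
        thus ?thesis using \<omega>c g0 by (subst nn_integral_eq_integral) auto
      qed
      finally show "emeasure \<Lambda> (space \<Lambda>) \<noteq> \<infinity>" by simp
    qed
    have vol: "of_real (measure \<Lambda> (space \<Lambda>)) = of_real (\<omega> * c j) * G j (\<lambda>_. 0)"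
      using ch[of "\<lambda>_. 0"] by (simp add: scaleR_conv_of_real)
    have ineq: "norm (char_fun {..<n} \<Lambda> t' - of_real (measure \<Lambda> (space \<Lambda>)) * char_fun {..<n} \<nu> t') \<le>
        measure \<Lambda> (space \<Lambda>) * ((\<Sum>i<n. \<bar>t' i\<bar>) * \<delta> j)"
    proof (rule radial_char_approx[OF _ fin s\<Lambda> \<nu> _ rad r sphere])
      show "radial_char {..<n} \<Lambda>" unfolding \<Lambda>_def by (rule radial_char_density_lebesgue_fun) auto
      show "AE x in \<Lambda>. r\<^sup>2 \<le> (\<Sum>i<n. (x i)\<^sup>2) \<and> (\<Sum>i<n. (x i)\<^sup>2) \<le> (r + \<delta> j)\<^sup>2"
        unfolding \<Lambda>_def by (subst AE_density) (auto split: split_indicator)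
    qed (use \<delta>[of j] in auto)
    have ch\<Lambda>: "char_fun {..<n} \<Lambda> t' = of_real (\<omega> * c j) * G j t"
      unfolding char_fun_def t' by (rule ch)
    have ch\<nu>: "char_fun {..<n} \<nu> t' = char_fun {..<k} \<nu>k t"
      unfolding char_fun_def t' \<nu>k_def by (rule integral_distr[symmetric]) measurable
    \<comment> \<open>Expressing the mass through \<open>G j (\<lambda>_. 0)\<close> makes both
      sides of the estimate multiples of \<omega> * c j, which is then cancelled.\<close>
    have vol': "measure \<Lambda> (space \<Lambda>) = \<omega> * c j * norm (G j (\<lambda>_. 0))"
      using arg_cong[OF vol, of norm] \<omega>(1) c[of j] by (simp add: norm_mult)
    have "norm (of_real (\<omega> * c j) * (G j t - G j (\<lambda>_. 0) * char_fun {..<k} \<nu>k t)) \<le>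
       (\<omega> * c j) * (norm (G j (\<lambda>_. 0)) * ((\<Sum>i<k. \<bar>t i\<bar>) * \<delta> j))"
      using ineq[unfolded vol, unfolded ch\<Lambda> ch\<nu> t'_abs vol']
      by (simp only: right_diff_distrib mult.assoc)
    thus ?thesis using \<omega>c unfolding norm_mult norm_of_real by (simp only: abs_of_pos mult_le_cancel_left_pos)
  qed
  \<comment> \<open>The values \<open>G j (\<lambda>_. 0)\<close> converge and hence stay bounded,
    so the factor \<open>\<delta> j\<close> forces equality in the limit.\<close>
  have main: "H t = H (\<lambda>_. 0) * char_fun {..<k} \<nu>k t" for t
  proof -
    have "(\<lambda>j. norm (G j t - G j (\<lambda>_. 0) * char_fun {..<k} \<nu>k t)) \<longlonglongrightarrow>
       norm ((q + 1) *\<^sub>R H t - (q + 1) *\<^sub>R H (\<lambda>_. 0) * char_fun {..<k} \<nu>k t)"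
      by (intro tendsto_intros G_lim)
    moreover have "(\<lambda>j. norm (G j (\<lambda>_. 0)) * ((\<Sum>i<k. \<bar>t i\<bar>) * \<delta> j)) \<longlonglongrightarrow> norm ((q + 1) *\<^sub>R H (\<lambda>_. 0)) * ((\<Sum>i<k. \<bar>t i\<bar>) * 0)"
      by (intro tendsto_intros G_lim \<delta>_lim)
    ultimately have "norm ((q + 1) *\<^sub>R H t - (q + 1) *\<^sub>R H (\<lambda>_. 0) * char_fun {..<k} \<nu>k t) \<le> 0"
      using approx by (intro LIMSEQ_le[of _ _ "\<lambda>j. norm (G j (\<lambda>_. 0)) * ((\<Sum>i<k. \<bar>t i\<bar>) * \<delta> j)"]) auto
    hence "(q + 1) *\<^sub>R H t = (q + 1) *\<^sub>R (H (\<lambda>_. 0) * char_fun {..<k} \<nu>k t)" by simp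
    thus ?thesis using q by simp
  qed
  define Z where "Z = (\<integral>y. h y \<partial>lebesgue_fun {..<k})"
  have Z: "0 < Z" using hpos by (simp add: Z_def)
  have H0: "H (\<lambda>_. 0) = of_real Z" unfolding H_def Z_def by (simp add: scaleR_conv_of_real)
  let ?D = "density (lebesgue_fun {..<k}) (\<lambda>y. ennreal (h y / Z))"
  have "\<nu>k = ?D"
  proof (rule char_fun_unique)
    show "prob_space \<nu>k" unfolding \<nu>k_def by (rule \<nu>.prob_space_distr) measurable
    show "sets \<nu>k = sets (borel_fun {..<k})" by (simp add: \<nu>k_def)
    show "prob_space ?D"
    proof (rule prob_spaceI)
      have "emeasure ?D (space ?D) = (\<integral>\<^sup>+y. ennreal (h y / Z) \<partial>lebesgue_fun {..<k})"
        by (subst emeasure_density) (auto intro!: nn_integral_cong)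
      also have "\<dots> = ennreal (\<integral>y. h y / Z \<partial>lebesgue_fun {..<k})"
        using hint h0 Z by (intro nn_integral_eq_integral integrable_divide) auto
      also have "(\<integral>y. h y / Z \<partial>lebesgue_fun {..<k}) = 1" using Z by (simp add: Z_def[symmetric])
      finally show "emeasure ?D (space ?D) = 1" by simp
    qed
    show "sets ?D = sets (borel_fun {..<k})" by (simp add: sets_lebesgue_fun)
    fix t
    have "char_fun {..<k} ?D t = (CLINT y|lebesgue_fun {..<k}. (h y / Z) *\<^sub>R iexp (\<Sum>i<k. t i * y i))"
      unfolding char_fun_def by (rule integral_density) (use h0 Z in \<open>auto simp del: of_real_sum of_real_mult\<close>)
    also have "\<dots> = (1 / Z) *\<^sub>R H t"
      unfolding H_def integral_scaleR_right[symmetric] by simp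
    also have "\<dots> = char_fun {..<k} \<nu>k t" unfolding main[of t] H0 using Z by (simp add: scaleR_conv_of_real)
    finally show "char_fun {..<k} \<nu>k t = char_fun {..<k} ?D t" by simp
  qed simp
  thus ?thesis unfolding \<nu>k_def Z_def .
qed


section \<open>Hausdorff measure on spheres\<close>

lemma hausdorff_pre_le_finite_cover:
  fixes A :: "'a::real_normed_vector set"
  assumes K: "finite K" and cover: "A \<subseteq> (\<Union>\<kappa>\<in>K. U \<kappa>)" and D: "0 \<le> D" "D \<le> \<delta>"
    and dist: "\<And>\<kappa> x y. \<kappa> \<in> K \<Longrightarrow> x \<in> U \<kappa> \<Longrightarrow> y \<in> U \<kappa> \<Longrightarrow> dist x y \<le> D"
  shows "hausdorff_pre d \<delta> A \<le> ennreal (real (card K) * D ^ d)"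
proof -
  obtain g where g: "bij_betw g {..<card K} K"
    using ex_bij_betw_nat_finite[OF K] by (auto simp: atLeast0LessThan)
  \<comment> \<open>Padding with empty sets, whose weight is 0 even for d = 0, makes the finite
    cover a sequence.\<close>
  define V where "V i = (if i < card K then U (g i) else {})" for i
  have gK: "g i \<in> K" if "i < card K" for i using g that by (auto simp: bij_betw_def)
  have V: "dist x y \<le> D" if "x \<in> V i" "y \<in> V i" for x y i
    using that dist[OF gK] by (auto simp: V_def split: if_splits)
  have diam: "diameter (V i) \<le> D" for i
    by (rule diameter_le) (use V D in \<open>auto simp: dist_norm\<close>)
  have bdd: "bounded (V i)" for i
  proof (cases "V i = {}")
    case False
    then obtain x where "x \<in> V i" by blast
    thus ?thesis using V unfolding bounded_def by blast
  qed simp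
  have "A \<subseteq> (\<Union>i. V i)"
  proof
    fix x assume "x \<in> A"
    then obtain \<kappa> where "\<kappa> \<in> K" "x \<in> U \<kappa>" using cover by blast
    moreover from this have "\<kappa> \<in> g ` {..<card K}" using g by (simp add: bij_betw_imp_surj_on)
    ultimately obtain i where "i < card K" "x \<in> U (g i)" by blast
    thus "x \<in> (\<Union>i. V i)" by (auto simp: V_def intro!: exI[of _ i])
  qed
  hence "V \<in> delta_covers \<delta> A"
    using diam D bdd by (auto simp: delta_covers_def intro: order_trans)
  hence "hausdorff_pre d \<delta> A \<le> (\<Sum>i. diameter_weight d (V i))"
    unfolding hausdorff_pre_def by (rule INF_lower)
  also have "\<dots> = (\<Sum>i<card K. diameter_weight d (V i))"
    by (rule suminf_finite) (auto simp: V_def diameter_weight_def)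
  also have "\<dots> \<le> (\<Sum>i<card K. ennreal (D ^ d))"
  proof (rule sum_mono)
    fix i
    have "diameter (V i) ^ d \<le> D ^ d"
      by (intro power_mono diam diameter_ge_0 bdd)
    thus "diameter_weight d (V i) \<le> ennreal (D ^ d)"
      by (auto simp: diameter_weight_def intro: ennreal_leI)
  qed
  also have "\<dots> = ennreal (real (card K) * D ^ d)"
    using D by (simp add: ennreal_mult ennreal_of_nat_eq_real_of_nat)
  finally show ?thesis .
qed

lemma hausdorff_outer_isometry_le:
  fixes f :: "'a::metric_space \<Rightarrow> 'a"
  assumes f: "\<And>x y. dist (f x) (f y) = dist x y"
  shows "hausdorff_outer d (f ` A) \<le> hausdorff_outer d A"
  unfolding hausdorff_outer_def
proof (rule SUP_mono')
  fix \<delta> :: real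
  show "hausdorff_pre d \<delta> (f ` A) \<le> hausdorff_pre d \<delta> A"
    unfolding hausdorff_pre_def
  proof (rule INF_greatest)
    fix U assume U: "U \<in> delta_covers \<delta> A"
    have diam: "diameter (f ` X) = diameter X" for X
      by (simp add: diameter_def f image_image case_prod_beta' flip: map_prod_surj_on[OF refl refl])
    have "bounded (f ` U i)" if "bounded (U i)" for i
      using that f unfolding bounded_def by (metis (no_types, lifting) imageE)
    hence "(\<lambda>i. f ` U i) \<in> delta_covers \<delta> (f ` A)"
    proof -
      have "A \<subseteq> (\<Union>i. U i)" using U by (simp add: delta_covers_def)
      hence "f ` A \<subseteq> (\<Union>i. f ` U i)" by blast
      thus ?thesis using U \<open>\<And>i. bounded (U i) \<Longrightarrow> bounded (f ` U i)\<close>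
        by (simp add: delta_covers_def diam)
    qed
    hence "(INF U\<in>delta_covers \<delta> (f ` A). \<Sum>i. diameter_weight d (U i)) \<le> (\<Sum>i. diameter_weight d (f ` U i))"
      by (rule INF_lower)
    moreover have "diameter_weight d (f ` X) = diameter_weight d X" for X
      by (cases "X = {}") (simp_all add: diameter_weight_def diam)
    ultimately show "(INF U\<in>delta_covers \<delta> (f ` A). \<Sum>i. diameter_weight d (U i)) \<le> (\<Sum>i. diameter_weight d (U i))"
      by simp
  qed
qed

text \<open>The one-sided estimate, applied to the image of A as well, gives the converse because f
  undoes itself.\<close>

lemma hausdorff_outer_involution:
  fixes f :: "'a::metric_space \<Rightarrow> 'a"
  assumes f: "\<And>x y. dist (f x) (f y) = dist x y" and inv: "\<And>x. f (f x) = x"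
  shows "hausdorff_outer d (f ` A) = hausdorff_outer d A"
proof (rule antisym)
  have "f ` f ` A = A" by (simp add: image_image inv)
  thus "hausdorff_outer d A \<le> hausdorff_outer d (f ` A)"
    using hausdorff_outer_isometry_le[OF f, of d "f ` A"] by simp
qed (rule hausdorff_outer_isometry_le[OF f])

text \<open>Put x = r / p and y = r / p', both at least 1. Then |x u - y v|^2 = (x - y)^2 r^2 + 2 x
  y (r^2 - <u, v>) is at least 2 (r^2 - <u, v>) = |u - v|^2. In other words, radial projection onto
  a sphere from its outside does not increase distances.\<close>

lemma norm_diff_le_radial:
  fixes u v :: "'a::real_inner"
  assumes u: "norm u = r" and v: "norm v = r" and p: "0 < p" "p \<le> r" and p': "0 < p'" "p' \<le> r"
  shows "norm (u - v) \<le> r * norm (u /\<^sub>R p - v /\<^sub>R p')"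
proof (rule power2_le_imp_le)
  define x where "x = r / p"
  define y where "y = r / p'"
  have r: "0 < r" using p by simp
  have x: "1 \<le> x" and y: "1 \<le> y" using p p' by (auto simp: x_def y_def)
  have uv: "inner u v \<le> r\<^sup>2" using norm_cauchy_schwarz[of u v] u v by (simp add: power2_eq_square)
  have uu: "inner u u = r\<^sup>2" and vv: "inner v v = r\<^sup>2" using u v by (simp_all add: power2_norm_eq_inner[symmetric])
  have "r *\<^sub>R (u /\<^sub>R p - v /\<^sub>R p') = x *\<^sub>R u - y *\<^sub>R v"
    by (simp add: x_def y_def scaleR_diff_right divide_inverse)
  hence "(r * norm (u /\<^sub>R p - v /\<^sub>R p'))\<^sup>2 = (norm (x *\<^sub>R u - y *\<^sub>R v))\<^sup>2"
    using r by (metis abs_of_pos norm_scaleR)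
  also have "\<dots> = (x\<^sup>2 + y\<^sup>2) * r\<^sup>2 - 2 * (x * y) * inner u v"
    unfolding power2_norm_eq_inner
    by (simp add: inner_diff_left inner_diff_right uu vv inner_commute[of v u] power2_eq_square algebra_simps)
  also have "\<dots> = (x - y)\<^sup>2 * r\<^sup>2 + 2 * (x * y) * (r\<^sup>2 - inner u v)"
    by (simp add: power2_eq_square algebra_simps)
  finally have *: "(r * norm (u /\<^sub>R p - v /\<^sub>R p'))\<^sup>2 = (x - y)\<^sup>2 * r\<^sup>2 + 2 * (x * y) * (r\<^sup>2 - inner u v)" .
  have "(norm (u - v))\<^sup>2 = 2 * 1 * (r\<^sup>2 - inner u v)"
    unfolding power2_norm_eq_inner
    by (simp add: inner_diff_left inner_diff_right uu vv inner_commute[of v u])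
  also have "\<dots> \<le> 2 * (x * y) * (r\<^sup>2 - inner u v)"
    using uv mult_mono[OF x y] x by (intro mult_right_mono mult_left_mono) auto
  also have "\<dots> \<le> (r * norm (u /\<^sub>R p - v /\<^sub>R p'))\<^sup>2" unfolding * by simp
  finally show "(norm (u - v))\<^sup>2 \<le> (r * norm (u /\<^sub>R p - v /\<^sub>R p'))\<^sup>2" .
qed (use p in auto)

text \<open>The centre c is orthogonal to the directions e, so inner products with the e l read off
  coordinates relative to the centre, and reflections along combinations of the e l fix c. The
  sphere has dimension n - 1, which is positive.\<close>

locale affine_sphere =
  fixes e :: "nat \<Rightarrow> 'a::real_inner" and c :: 'a and n :: nat and r :: real
  assumes orthonormal: "\<And>i j. i < n \<Longrightarrow> j < n \<Longrightarrow> inner (e i) (e j) = (if i = j then 1 else 0)"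
    and center: "\<And>i. i < n \<Longrightarrow> inner c (e i) = 0"
    and r_pos: "0 < r" and n_ge: "2 \<le> n"
begin

definition vec :: "(nat \<Rightarrow> real) \<Rightarrow> 'a" where
  "vec a = (\<Sum>l<n. a l *\<^sub>R e l)"

definition S :: "'a set" where
  "S = {c + vec a | a. (\<Sum>l<n. (a l)\<^sup>2) = r\<^sup>2}"

lemma inner_vec: "i < n \<Longrightarrow> inner (vec a) (e i) = a i"
proof -
  assume i: "i < n"
  have "inner (vec a) (e i) = (\<Sum>l<n. if l = i then a l else 0)"
    unfolding vec_def inner_sum_left using i by (intro sum.cong) (auto simp: orthonormal)
  thus ?thesis using i by simp
qed

lemma inner_vec_vec: "inner (vec a) (vec b) = (\<Sum>l<n. a l * b l)"
proof -
  have "inner (vec a) (vec b) = (\<Sum>l<n. b l * inner (vec a) (e l))"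
    by (simp add: vec_def[of b] inner_sum_right)
  thus ?thesis by (simp add: inner_vec mult.commute)
qed

lemma norm_vec: "(norm (vec a))\<^sup>2 = (\<Sum>l<n. (a l)\<^sup>2)"
  unfolding power2_norm_eq_inner inner_vec_vec by (simp add: power2_eq_square)

lemma vec_diff: "vec a - vec b = vec (\<lambda>l. a l - b l)"
  by (simp add: vec_def scaleR_diff_left sum_subtractf)

lemma vec_scale: "s *\<^sub>R vec a = vec (\<lambda>l. s * a l)"
  by (simp add: vec_def scaleR_sum_right)

text \<open>The faces of the cube are cut into small cubes and projected radially onto the sphere: below,
  \<open>i\<close> is the index of an entry of maximal modulus and \<open>s\<close> its sign.\<close>

lemma hausdorff_outer_S_finite: "hausdorff_outer (n - 1) S < \<infinity>"
proof -
  \<comment> \<open>There are 2 n faces with at most (M + 1)^(n - 1) cells each, and a projected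
    cell has diameter at most 2 r sqrt n / M. Since M + 1 \<le> 2 M, the powers of M cancel and the
    bound is independent of M.\<close>
  define C where "C = 2 * real n * (4 * r * sqrt (real n)) ^ (n - 1)"
  have "hausdorff_pre (n - 1) \<delta> S \<le> ennreal C" if "0 < \<delta>" for \<delta>
  proof -
    obtain M0 where M0: "2 * r * sqrt (real n) / \<delta> < real M0" using reals_Archimedean2 by blast
    define M where "M = Suc M0"
    have M: "0 < M" and M\<delta>: "2 * r * sqrt (real n) / real M \<le> \<delta>"
    proof -
      have "2 * r * sqrt (real n) \<le> real M0 * \<delta>" using M0 that by (simp add: pos_divide_less_eq less_imp_le)
      also have "\<dots> \<le> real M * \<delta>" using that by (simp add: M_def)
      finally show "2 * r * sqrt (real n) / real M \<le> \<delta>" by (simp add: M_def pos_divide_le_eq mult.commute)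
    qed (simp add: M_def)
    \<comment> \<open>A cell of the cube [-1, 1]^n has side 2 / M, hence diameter at most sqrt n * 2
      / M; radial projection to radius r costs at most the factor r.\<close>
    define D where "D = 2 * r * sqrt (real n) / real M"
    \<comment> \<open>A triple records the index of the maximal entry, its sign and the cell of the
      other entries. The cell index M itself is reached when another entry equals the maximal
      modulus.\<close>
    define K where "K = (SIGMA i:{..<n}. {1, -1 :: real} \<times> (({..<n} - {i}) \<rightarrow>\<^sub>E {..M}))"
    define U where "U = (\<lambda>(i, s, f). {c + vec a | a. (\<Sum>l<n. (a l)\<^sup>2) = r\<^sup>2 \<and> (\<forall>j<n. \<bar>a j\<bar> \<le> \<bar>a i\<bar>) \<and> s * \<bar>a i\<bar> = a i \<and>
      (\<forall>j\<in>{..<n} - {i}. real (f j) \<le> (a j / \<bar>a i\<bar> + 1) * real M / 2 \<and> (a j / \<bar>a i\<bar> + 1) * real M / 2 \<le> real (f j) + 1)})"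
    have fK: "finite K" unfolding K_def by (intro finite_SigmaI finite_cartesian_product finite_PiE) auto
    have cK: "card K = n * (2 * (M + 1) ^ (n - 1))"
    proof -
      have "card K = (\<Sum>i<n. card ({1, -1 :: real} \<times> (({..<n} - {i}) \<rightarrow>\<^sub>E {..M})))"
        unfolding K_def by (rule card_SigmaI) (auto intro!: finite_cartesian_product finite_PiE)
      also have "\<dots> = (\<Sum>i<n. 2 * (M + 1) ^ (n - 1))"
        by (intro sum.cong) (auto simp: card_cartesian_product card_PiE)
      finally show ?thesis by simp
    qed
    have "hausdorff_pre (n - 1) \<delta> S \<le> ennreal (real (card K) * D ^ (n - 1))"
    proof (rule hausdorff_pre_le_finite_cover[OF fK])
      show "S \<subseteq> (\<Union>\<kappa>\<in>K. U \<kappa>)"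
      proof
        fix x assume "x \<in> S"
        then obtain a where a: "x = c + vec a" "(\<Sum>l<n. (a l)\<^sup>2) = r\<^sup>2" unfolding S_def by blast
        obtain i where i: "i < n" "\<forall>j<n. \<bar>a j\<bar> \<le> \<bar>a i\<bar>"
        proof -
          have "Max ((\<lambda>j. \<bar>a j\<bar>) ` {..<n}) \<in> (\<lambda>j. \<bar>a j\<bar>) ` {..<n}"
            using n_ge by (intro Max_in) (auto simp: lessThan_empty_iff)
          then obtain i where "i < n" "Max ((\<lambda>j. \<bar>a j\<bar>) ` {..<n}) = \<bar>a i\<bar>" by auto
          thus thesis using that Max_ge[of "(\<lambda>j. \<bar>a j\<bar>) ` {..<n}"] by force
        qed
        have ai: "a i \<noteq> 0"
        proof
          assume "a i = 0"
          hence "(\<Sum>l<n. (a l)\<^sup>2) = 0" using i by (intro sum.neutral) auto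
          thus False using a r_pos by simp
        qed
        define f where "f = (\<lambda>j\<in>{..<n} - {i}. nat \<lfloor>(a j / \<bar>a i\<bar> + 1) * real M / 2\<rfloor>)"
        have b: "0 \<le> (a j / \<bar>a i\<bar> + 1) * real M / 2" "(a j / \<bar>a i\<bar> + 1) * real M / 2 \<le> real M" if "j < n" for j
        proof -
          have "\<bar>a j / \<bar>a i\<bar>\<bar> \<le> 1" using i that ai by (simp add: abs_divide)
          hence 1: "0 \<le> a j / \<bar>a i\<bar> + 1" "a j / \<bar>a i\<bar> + 1 \<le> 2" by linarith+
          show "0 \<le> (a j / \<bar>a i\<bar> + 1) * real M / 2" using 1 by simp
          have "(a j / \<bar>a i\<bar> + 1) * real M \<le> 2 * real M" using 1 by (intro mult_right_mono) auto
          thus "(a j / \<bar>a i\<bar> + 1) * real M / 2 \<le> real M" by simp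
        qed
        have "f \<in> ({..<n} - {i}) \<rightarrow>\<^sub>E {..M}"
        proof (rule PiE_I)
          fix j assume j: "j \<in> {..<n} - {i}"
          have "\<lfloor>(a j / \<bar>a i\<bar> + 1) * real M / 2\<rfloor> \<le> int M" using b[of j] j by (simp add: floor_le_iff)
          thus "f j \<in> {..M}" using j by (simp add: f_def nat_le_iff)
        qed (auto simp: f_def)
        moreover have "sgn (a i) \<in> {1, -1}" using ai by (auto simp: sgn_if)
        ultimately have "(i, sgn (a i), f) \<in> K" using i by (auto simp: K_def)
        moreover have "x \<in> U (i, sgn (a i), f)"
        proof -
          have fl: "real (nat \<lfloor>z\<rfloor>) \<le> z \<and> z \<le> real (nat \<lfloor>z\<rfloor>) + 1" if "0 \<le> z" for z :: real
            using that by linarith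
          have "real (f j) \<le> (a j / \<bar>a i\<bar> + 1) * real M / 2 \<and> (a j / \<bar>a i\<bar> + 1) * real M / 2 \<le> real (f j) + 1"
            if "j \<in> {..<n} - {i}" for j
          proof -
            have "f j = nat \<lfloor>(a j / \<bar>a i\<bar> + 1) * real M / 2\<rfloor>" using that by (simp add: f_def)
            moreover have "j < n" using that by simp
            ultimately show ?thesis using fl[OF b(1)] by (simp only:)
          qed
          thus ?thesis unfolding U_def using a i by (auto simp: sgn_mult_abs intro!: exI[of _ a])
        qed
        ultimately show "x \<in> (\<Union>\<kappa>\<in>K. U \<kappa>)" by blast
      qed
      show "0 \<le> D" "D \<le> \<delta>" using r_pos M\<delta> by (auto simp: D_def)
      fix \<kappa> x y assume "\<kappa> \<in> K" "x \<in> U \<kappa>" "y \<in> U \<kappa>"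
      obtain i s f where \<kappa>: "\<kappa> = (i, s, f)" by (cases \<kappa>)
      have i: "i < n" using \<open>\<kappa> \<in> K\<close> by (auto simp: \<kappa> K_def)
      obtain a where a: "x = c + vec a" "(\<Sum>l<n. (a l)\<^sup>2) = r\<^sup>2" "\<forall>j<n. \<bar>a j\<bar> \<le> \<bar>a i\<bar>" "s * \<bar>a i\<bar> = a i"
        "\<forall>j\<in>{..<n} - {i}. real (f j) \<le> (a j / \<bar>a i\<bar> + 1) * real M / 2 \<and> (a j / \<bar>a i\<bar> + 1) * real M / 2 \<le> real (f j) + 1"
        using \<open>x \<in> U \<kappa>\<close> unfolding \<kappa> U_def by blast
      obtain b where b: "y = c + vec b" "(\<Sum>l<n. (b l)\<^sup>2) = r\<^sup>2" "\<forall>j<n. \<bar>b j\<bar> \<le> \<bar>b i\<bar>" "s * \<bar>b i\<bar> = b i"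
        "\<forall>j\<in>{..<n} - {i}. real (f j) \<le> (b j / \<bar>b i\<bar> + 1) * real M / 2 \<and> (b j / \<bar>b i\<bar> + 1) * real M / 2 \<le> real (f j) + 1"
        using \<open>y \<in> U \<kappa>\<close> unfolding \<kappa> U_def by blast
      have max_entry: "0 < \<bar>v i\<bar>" "\<bar>v i\<bar> \<le> r" if "(\<Sum>l<n. (v l)\<^sup>2) = r\<^sup>2" "\<forall>j<n. \<bar>v j\<bar> \<le> \<bar>v i\<bar>" for v :: "nat \<Rightarrow> real"
      proof -
        show "0 < \<bar>v i\<bar>"
        proof (rule ccontr)
          assume "\<not> 0 < \<bar>v i\<bar>"
          hence "(\<Sum>l<n. (v l)\<^sup>2) = 0" using that by (intro sum.neutral) auto
          thus False using that r_pos by simp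
        qed
        have "(v i)\<^sup>2 \<le> r\<^sup>2" unfolding that(1)[symmetric] using i by (intro member_le_sum) auto
        thus "\<bar>v i\<bar> \<le> r" using r_pos by (simp add: abs_le_square_iff[symmetric])
      qed
      note ai = max_entry[OF a(2,3)] and bi = max_entry[OF b(2,3)]
      have nva: "norm (vec a) = r" "norm (vec b) = r"
        using norm_vec[of a] norm_vec[of b] a(2) b(2) r_pos by (auto simp: power2_eq_iff_nonneg)
      have "dist x y = norm (vec a - vec b)" by (simp add: a b dist_norm)
      also have "\<dots> \<le> r * norm (vec a /\<^sub>R \<bar>a i\<bar> - vec b /\<^sub>R \<bar>b i\<bar>)"
        by (rule norm_diff_le_radial[OF nva ai bi])
      also have "vec a /\<^sub>R \<bar>a i\<bar> - vec b /\<^sub>R \<bar>b i\<bar> = vec (\<lambda>l. a l / \<bar>a i\<bar> - b l / \<bar>b i\<bar>)"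
        unfolding vec_scale vec_diff by (simp add: divide_inverse mult.commute)
      also have "norm \<dots> \<le> sqrt (real n) * (2 / real M)"
      proof (rule power2_le_imp_le)
        have "(a l / \<bar>a i\<bar> - b l / \<bar>b i\<bar>)\<^sup>2 \<le> (2 / real M)\<^sup>2" if l: "l < n" for l
        proof (cases "l = i")
          case True
          have "a i / \<bar>a i\<bar> = s" "b i / \<bar>b i\<bar> = s" using a(4) b(4) ai bi by (auto simp: divide_eq_eq)
          thus ?thesis using True by simp
        next
          case False
          hence "real (f l) \<le> (a l / \<bar>a i\<bar> + 1) * real M / 2" "(a l / \<bar>a i\<bar> + 1) * real M / 2 \<le> real (f l) + 1"
            "real (f l) \<le> (b l / \<bar>b i\<bar> + 1) * real M / 2" "(b l / \<bar>b i\<bar> + 1) * real M / 2 \<le> real (f l) + 1"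
            using a(5) b(5) l by auto
          hence "\<bar>(a l / \<bar>a i\<bar> + 1) * real M / 2 - (b l / \<bar>b i\<bar> + 1) * real M / 2\<bar> \<le> 1" by linarith
          also have "(a l / \<bar>a i\<bar> + 1) * real M / 2 - (b l / \<bar>b i\<bar> + 1) * real M / 2 = (a l / \<bar>a i\<bar> - b l / \<bar>b i\<bar>) * (real M / 2)"
            by (simp only: left_diff_distrib distrib_right diff_divide_distrib add_divide_distrib times_divide_eq_right)
          also have "\<bar>\<dots>\<bar> = \<bar>a l / \<bar>a i\<bar> - b l / \<bar>b i\<bar>\<bar> * (real M / 2)" by (simp add: abs_mult)
          finally have "\<bar>a l / \<bar>a i\<bar> - b l / \<bar>b i\<bar>\<bar> \<le> 2 / real M" using M by (simp add: field_simps)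
          thus ?thesis by (simp add: abs_le_square_iff[symmetric])
        qed
        hence "(\<Sum>l<n. (a l / \<bar>a i\<bar> - b l / \<bar>b i\<bar>)\<^sup>2) \<le> (\<Sum>l<n. (2 / real M)\<^sup>2)" by (intro sum_mono) auto
        thus "(norm (vec (\<lambda>l. a l / \<bar>a i\<bar> - b l / \<bar>b i\<bar>)))\<^sup>2 \<le> (sqrt (real n) * (2 / real M))\<^sup>2"
          unfolding norm_vec power_mult_distrib by simp
      qed simp
      also have "r * (sqrt (real n) * (2 / real M)) = D" by (simp add: D_def)
      finally show "dist x y \<le> D" using r_pos by simp
    qed
    also have "real (card K) * D ^ (n - 1) \<le> C"
    proof -
      have "real (card K) * D ^ (n - 1) = 2 * real n * (real (M + 1) * D) ^ (n - 1)"
        unfolding cK by (simp add: power_mult_distrib)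
      also have "\<dots> \<le> C"
      proof -
        have "real (M + 1) * D \<le> (2 * real M) * D"
          using M r_pos by (intro mult_right_mono) (auto simp: D_def)
        also have "\<dots> = 4 * r * sqrt (real n)" using M by (simp add: D_def)
        finally show ?thesis unfolding C_def using r_pos
          by (intro mult_left_mono power_mono) (auto simp: D_def)
      qed
      finally show ?thesis .
    qed
    finally show ?thesis by (simp add: ennreal_leI)
  qed
  hence "hausdorff_outer (n - 1) S \<le> ennreal C" unfolding hausdorff_outer_def by (intro SUP_least) auto
  thus ?thesis by (simp add: order_le_less_trans)
qed

text \<open>Dropping the last coordinate does not increase distances and maps the sphere onto a set
  containing a cube.\<close>

lemma hausdorff_outer_S_pos: "0 < hausdorff_outer (n - 1) S"
proof -
  define d where "d = n - 1"
  have d: "0 < d" "d < n" "n = Suc d" using n_ge by (auto simp: d_def)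
  \<comment> \<open>Over the cube of half-side r / d the squared norm is at most d (r / d)^2 = r^2 /
    d \<le> r^2, so the last coordinate can be solved for.\<close>
  define \<rho> where "\<rho> = r / real d"
  have \<rho>: "0 < \<rho>" using r_pos d by (simp add: \<rho>_def)
  define proj where "proj x = (\<lambda>j\<in>{..<d}. inner (x - c) (e j))" for x
  have box: "emeasure (lebesgue_fun {..<d}) (\<Pi>\<^sub>E j\<in>{..<d}. {y j - s..y j + s}) = ennreal ((2 * s) ^ d)" if "0 \<le> s" for y :: "nat \<Rightarrow> real" and s
    using that by (subst lborel_prod.emeasure_PiM) (auto simp: ennreal_power)
  have lift: "(\<Pi>\<^sub>E j\<in>{..<d}. {- \<rho>..\<rho>}) \<subseteq> proj ` S"
  proof
    fix y assume y: "y \<in> (\<Pi>\<^sub>E j\<in>{..<d}. {- \<rho>..\<rho>})"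
    have "(\<Sum>j<d. (y j)\<^sup>2) \<le> (\<Sum>j<d. \<rho>\<^sup>2)"
    proof (rule sum_mono)
      fix j assume "j \<in> {..<d}"
      hence "\<bar>y j\<bar> \<le> \<bar>\<rho>\<bar>" using y \<rho> by (fastforce simp: PiE_iff abs_le_iff)
      thus "(y j)\<^sup>2 \<le> \<rho>\<^sup>2" by (simp only: abs_le_square_iff)
    qed
    also have "\<dots> = r\<^sup>2 / real d" using d by (simp add: \<rho>_def power2_eq_square)
    also have "\<dots> \<le> r\<^sup>2 / 1" using d by (intro divide_left_mono) auto
    finally have le: "(\<Sum>j<d. (y j)\<^sup>2) \<le> r\<^sup>2" by simp
    define a where "a l = (if l < d then y l else sqrt (r\<^sup>2 - (\<Sum>j<d. (y j)\<^sup>2)))" for l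
    have "(\<Sum>l<n. (a l)\<^sup>2) = r\<^sup>2" using le unfolding d(3) by (simp add: a_def)
    hence "c + vec a \<in> S" unfolding S_def by blast
    moreover have "proj (c + vec a) = y"
    proof
      fix j
      have "inner (vec a) (e j) = y j" if "j < d" using inner_vec[of j a] that d(2) by (simp add: a_def)
      thus "proj (c + vec a) j = y j" using y by (auto simp: proj_def PiE_iff extensional_def)
    qed
    ultimately show "y \<in> proj ` S" by (metis imageI)
  qed
  have "ennreal (\<rho> ^ d) \<le> hausdorff_pre d 1 S"
    unfolding hausdorff_pre_def
  proof (rule INF_greatest)
    fix U assume U: "U \<in> delta_covers 1 S"
    \<comment> \<open>A cube around the projection of a chosen point of U i, with half-side the
      diameter: it contains the projection of U i and has volume (2 diameter)^d. The factor 2^d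
      cancels against the one in (2 \<rho>)^d.\<close>
    define B where "B i = (if U i = {} then {} else
      \<Pi>\<^sub>E j\<in>{..<d}. {proj (SOME x. x \<in> U i) j - diameter (U i)..proj (SOME x. x \<in> U i) j + diameter (U i)})" for i
    have Bm: "B i \<in> sets (lebesgue_fun {..<d})" for i unfolding B_def by (auto intro!: sets_PiM_I_finite)
    have bU: "bounded (U i)" for i using U by (auto simp: delta_covers_def)
    have projU: "proj x \<in> B i" if x: "x \<in> U i" for x i
    proof -
      let ?x = "SOME x. x \<in> U i"
      have x0: "?x \<in> U i" using x by (rule someI)
      have "\<bar>proj x j - proj ?x j\<bar> \<le> diameter (U i)" if j: "j < d" for j
      proof -
        have "proj x j - proj ?x j = inner (x - ?x) (e j)" using j by (simp add: proj_def inner_diff_left)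
        also have "\<bar>\<dots>\<bar> \<le> norm (x - ?x) * norm (e j)" by (rule Cauchy_Schwarz_ineq2)
        also have "norm (e j) = 1" using j d orthonormal[of j j] by (simp add: norm_eq_sqrt_inner)
        also have "norm (x - ?x) * 1 \<le> diameter (U i)"
          using diameter_bounded_bound[OF bU x x0] by (simp add: dist_norm)
        finally show ?thesis .
      qed
      thus ?thesis using x unfolding B_def by (auto simp: proj_def abs_le_iff) (force simp: algebra_simps)+
    qed
    have "ennreal ((2 * \<rho>) ^ d) = emeasure (lebesgue_fun {..<d}) (\<Pi>\<^sub>E j\<in>{..<d}. {- \<rho>..\<rho>})"
      using box[of \<rho> "\<lambda>_. 0"] \<rho> by simp
    also have "\<dots> \<le> emeasure (lebesgue_fun {..<d}) (\<Union>i. B i)"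
    proof (rule emeasure_mono)
      show "(\<Pi>\<^sub>E j\<in>{..<d}. {- \<rho>..\<rho>}) \<subseteq> (\<Union>i. B i)"
      proof
        fix y assume "y \<in> (\<Pi>\<^sub>E j\<in>{..<d}. {- \<rho>..\<rho>})"
        then obtain x where x: "x \<in> S" "y = proj x" using lift by blast
        have "S \<subseteq> (\<Union>i. U i)" using U by (simp add: delta_covers_def)
        then obtain i where "x \<in> U i" using x(1) by blast
        thus "y \<in> (\<Union>i. B i)" using projU x(2) by blast
      qed
    qed (use Bm in auto)
    also have "\<dots> \<le> (\<Sum>i. emeasure (lebesgue_fun {..<d}) (B i))"
      by (rule emeasure_subadditive_countably) (use Bm in auto)
    also have "\<dots> \<le> (\<Sum>i. ennreal (2 ^ d) * diameter_weight d (U i))"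
    proof (intro suminf_le summableI)
      fix i
      show "emeasure (lebesgue_fun {..<d}) (B i) \<le> ennreal (2 ^ d) * diameter_weight d (U i)"
      proof (cases "U i = {}")
        case False
        thus ?thesis unfolding B_def diameter_weight_def using diameter_ge_0[OF bU, of i]
          by (simp add: box power_mult_distrib ennreal_mult)
      qed (simp add: B_def)
    qed
    also have "\<dots> = ennreal (2 ^ d) * (\<Sum>i. diameter_weight d (U i))" by (rule ennreal_suminf_cmult)
    finally have "ennreal (2 ^ d) * ennreal (\<rho> ^ d) \<le> ennreal (2 ^ d) * (\<Sum>i. diameter_weight d (U i))"
      using \<rho> by (simp add: power_mult_distrib ennreal_mult)
    thus "ennreal (\<rho> ^ d) \<le> (\<Sum>i. diameter_weight d (U i))"
      by (subst (asm) ennreal_mult_le_mult_iff) auto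
  qed
  also have "\<dots> \<le> hausdorff_outer d S" by (rule hausdorff_pre_le_outer) simp
  finally have "ennreal (\<rho> ^ d) \<le> hausdorff_outer d S" .
  moreover have "0 < ennreal (\<rho> ^ d)" using \<rho> by simp
  ultimately show ?thesis unfolding d_def by (rule less_le_trans[rotated])
qed

section \<open>Reflections of the sphere and its surface measure\<close>

definition refl_vec :: "'a \<Rightarrow> 'a \<Rightarrow> 'a" where
  "refl_vec v x = x - (2 * inner x v / inner v v) *\<^sub>R v"

lemma refl_vec_diff: "refl_vec v x - refl_vec v y = refl_vec v (x - y)"
  by (simp add: refl_vec_def inner_diff_left diff_divide_distrib right_diff_distrib scaleR_diff_left)

lemma norm_refl_vec: "norm (refl_vec v x) = norm x"
proof -
  have "inner (refl_vec v x) (refl_vec v x) = inner x x"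
    by (cases "v = 0") (simp_all add: refl_vec_def inner_diff_left inner_diff_right inner_commute[of v x] field_simps)
  thus ?thesis by (simp add: norm_eq_sqrt_inner)
qed

lemma dist_refl_vec: "dist (refl_vec v x) (refl_vec v y) = dist x y"
  by (simp add: dist_norm refl_vec_diff norm_refl_vec)

lemma refl_vec_refl_vec: "refl_vec v (refl_vec v x) = x"
  by (cases "v = 0") (simp_all add: refl_vec_def inner_diff_left scaleR_diff_left[symmetric] diff_divide_distrib)

lemma inner_refl_vec: "inner (refl_vec v x) y = inner x (refl_vec v y)"
  by (simp add: refl_vec_def inner_diff_left inner_diff_right inner_commute)

lemma refl_vec_swap: "norm x = norm y \<Longrightarrow> refl_vec (x - y) x = y"
proof -
  assume "norm x = norm y"
  hence xy: "inner x x = inner y y" by (simp add: norm_eq)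
  show ?thesis
  proof (cases "x = y")
    case False
    hence "inner (x - y) (x - y) \<noteq> 0" by simp
    moreover have "inner (x - y) (x - y) = 2 * inner x (x - y)"
      using xy by (simp add: inner_diff_left inner_diff_right inner_commute)
    ultimately have *: "2 * inner x (x - y) / inner (x - y) (x - y) = 1" by (metis divide_self)
    show ?thesis unfolding refl_vec_def * by simp
  qed (simp add: refl_vec_def)
qed

lemma continuous_refl_vec: "continuous_on UNIV (refl_vec v)"
  unfolding refl_vec_def divide_inverse by (intro continuous_intros)

text \<open>The centre is orthogonal to \<open>vec b\<close> and so is fixed; the rest of x stays in
  the span of the e l and keeps its norm.\<close>

lemma refl_vec_S: "x \<in> S \<Longrightarrow> refl_vec (vec b) x \<in> S"
proof -
  assume "x \<in> S"
  then obtain a where a: "x = c + vec a" "(\<Sum>l<n. (a l)\<^sup>2) = r\<^sup>2" unfolding S_def by blast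
  have cb: "inner c (vec b) = 0" by (simp add: vec_def inner_sum_right center)
  define q where "q = 2 * inner (vec a) (vec b) / inner (vec b) (vec b)"
  have eq: "refl_vec (vec b) (vec a) = vec (\<lambda>l. a l - q * b l)"
    unfolding refl_vec_def q_def[symmetric] vec_scale vec_diff ..
  have "refl_vec (vec b) x = c + refl_vec (vec b) (vec a)"
    by (simp add: refl_vec_def a inner_add_left cb)
  moreover have "(\<Sum>l<n. (a l - q * b l)\<^sup>2) = r\<^sup>2"
    unfolding norm_vec[symmetric] eq[symmetric] norm_refl_vec unfolding norm_vec by (rule a(2))
  ultimately show ?thesis unfolding S_def eq by blast
qed

abbreviation \<sigma> :: "'a measure" where
  "\<sigma> \<equiv> normalized_surface_measure (n - 1) S"

abbreviation coords :: "'a \<Rightarrow> nat \<Rightarrow> real" where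
  "coords x \<equiv> (\<lambda>l\<in>{..<n}. inner x (e l))"

lemma sets_\<sigma> [measurable_cong]: "sets \<sigma> = sets borel"
  by (simp add: normalized_surface_measure_def)

lemma measurable_coords [measurable]: "coords \<in> measurable borel (borel_fun {..<n})"
  by (rule measurable_restrict, rule borel_measurable_continuous_onI) (intro continuous_intros)

context
  assumes S_borel: "S \<in> sets borel"
begin

lemma emeasure_S: "emeasure (hausdorff_measure (n - 1)) S \<noteq> 0" "emeasure (hausdorff_measure (n - 1)) S \<noteq> \<infinity>"
  using hausdorff_outer_S_pos hausdorff_outer_S_finite by (simp_all add: emeasure_hausdorff_measure[OF S_borel])

lemma prob_space_\<sigma>: "prob_space \<sigma>"
  unfolding normalized_surface_measure_def by (rule prob_space_uniform_measure[OF emeasure_S])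

lemma AE_\<sigma>: "AE x in \<sigma>. x \<in> S"
  unfolding normalized_surface_measure_def
  by (rule AE_uniform_measureI) (use S_borel in auto)

text \<open>The reflection is an involution mapping S onto itself, so the part of S sent into A is
  the image of S \<inter> A, and isometric involutions preserve the Hausdorff outer measure.\<close>

lemma distr_\<sigma>_refl_vec: "distr \<sigma> borel (refl_vec (vec b)) = \<sigma>"
proof (rule measure_eqI)
  let ?f = "refl_vec (vec b)"
  fix A assume "A \<in> sets (distr \<sigma> borel ?f)"
  hence A: "A \<in> sets borel" by simp
  have fm: "?f \<in> measurable borel borel" by (intro borel_measurable_continuous_onI continuous_refl_vec)
  have fA: "?f -` A \<in> sets borel" using measurable_sets[OF fm A] by simp
  have "emeasure (distr \<sigma> borel ?f) A = emeasure \<sigma> (?f -` A)"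
    using A fm by (subst emeasure_distr) (auto simp: normalized_surface_measure_def)
  also have "\<dots> = hausdorff_outer (n - 1) (S \<inter> ?f -` A) / hausdorff_outer (n - 1) S"
    unfolding normalized_surface_measure_def using S_borel fA
    by (simp add: emeasure_hausdorff_measure)
  also have "S \<inter> ?f -` A = ?f ` (S \<inter> A)"
  proof (intro set_eqI iffI)
    fix x assume "x \<in> S \<inter> ?f -` A"
    hence "?f x \<in> S \<inter> A" using refl_vec_S by auto
    thus "x \<in> ?f ` (S \<inter> A)" using refl_vec_refl_vec[of "vec b" x] by (metis imageI)
  qed (auto simp: refl_vec_refl_vec refl_vec_S)
  also have "hausdorff_outer (n - 1) (?f ` (S \<inter> A)) = hausdorff_outer (n - 1) (S \<inter> A)"
    by (intro hausdorff_outer_involution dist_refl_vec refl_vec_refl_vec)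
  also have "\<dots> / hausdorff_outer (n - 1) S = emeasure \<sigma> A"
    unfolding normalized_surface_measure_def using S_borel A
    by (simp add: emeasure_hausdorff_measure)
  finally show "emeasure (distr \<sigma> borel ?f) A = emeasure \<sigma> A" .
qed (simp only: sets_distr sets_\<sigma>)

text \<open>For frequencies of equal norm the vectors \<open>vec s\<close> and \<open>vec t\<close>
  are exchanged by the reflection along their difference, and self-adjointness moves that reflection
  from the point to the frequency.\<close>

lemma radial_char_coords: "radial_char {..<n} (distr \<sigma> (borel_fun {..<n}) coords)"
  unfolding radial_char_def
proof (intro allI impI)
  fix s t :: "nat \<Rightarrow> real" assume "(\<Sum>i<n. (s i)\<^sup>2) = (\<Sum>i<n. (t i)\<^sup>2)"
  hence st: "norm (vec t) = norm (vec s)" unfolding norm_vec[symmetric] by simp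
  have m: "(\<lambda>x. iexp (inner x (vec u))) \<in> borel_measurable borel" for u
    by (intro borel_measurable_continuous_onI continuous_intros)
  have ch: "char_fun {..<n} (distr \<sigma> (borel_fun {..<n}) coords) u = (CLINT x|\<sigma>. iexp (inner x (vec u)))" for u
  proof -
    have "char_fun {..<n} (distr \<sigma> (borel_fun {..<n}) coords) u = (CLINT x|\<sigma>. iexp (\<Sum>i<n. u i * coords x i))"
      unfolding char_fun_def by (rule integral_distr) measurable
    also have "(\<lambda>x. (\<Sum>i<n. u i * coords x i)) = (\<lambda>x. inner x (vec u))"
      by (simp add: vec_def inner_sum_right)
    finally show ?thesis .
  qed
  let ?b = "\<lambda>l. t l - s l"
  have "(CLINT x|\<sigma>. iexp (inner x (vec t))) = (CLINT x|distr \<sigma> borel (refl_vec (vec ?b)). iexp (inner x (vec t)))"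
    unfolding distr_\<sigma>_refl_vec ..
  also have "\<dots> = (CLINT x|\<sigma>. iexp (inner (refl_vec (vec ?b) x) (vec t)))"
    by (rule integral_distr[OF _ m], subst measurable_cong_sets[OF sets_\<sigma> refl])
       (intro borel_measurable_continuous_onI continuous_refl_vec)
  also have "\<dots> = (CLINT x|\<sigma>. iexp (inner x (vec s)))"
    unfolding inner_refl_vec vec_diff[symmetric] refl_vec_swap[OF st] ..
  finally show "char_fun {..<n} (distr \<sigma> (borel_fun {..<n}) coords) s = char_fun {..<n} (distr \<sigma> (borel_fun {..<n}) coords) t"
    unfolding ch by simp
qed

lemma AE_coords: "AE a in distr \<sigma> (borel_fun {..<n}) coords. (\<Sum>l<n. (a l)\<^sup>2) = r\<^sup>2"
proof (subst AE_distr_iff)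
  show "AE x in \<sigma>. (\<Sum>l<n. (coords x l)\<^sup>2) = r\<^sup>2"
    using AE_\<sigma>
  proof eventually_elim
    case (elim x)
    then obtain a where "x = c + vec a" "(\<Sum>l<n. (a l)\<^sup>2) = r\<^sup>2" unfolding S_def by blast
    thus ?case by (simp add: inner_add_left center inner_vec)
  qed
qed measurable

end

end


section \<open>Convergence of the marginal densities\<close>

lemma ln_one_minus_bounds:
  fixes x :: real
  assumes "x < 1"
  shows "- x / (1 - x) \<le> ln (1 - x)" "ln (1 - x) \<le> - x"
proof -
  show "ln (1 - x) \<le> - x" using ln_le_minus_one[of "1 - x"] assms by simp
  have "ln (1 / (1 - x)) \<le> 1 / (1 - x) - 1" using assms by (intro ln_le_minus_one) simp
  also have "\<dots> = x / (1 - x)" using assms by (simp add: field_simps)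
  finally show "- x / (1 - x) \<le> ln (1 - x)" using assms by (simp add: ln_div)
qed

lemma max_one_minus_powr: "x < 1 \<Longrightarrow> max 0 (1 - x) powr p = exp (p * ln (1 - x))" for x :: real
  by (simp add: powr_def)

text \<open>This is ln (1 - x) \<le> - x, multiplied by p; where s / R \<ge> 1 the left side is
  0.\<close>

lemma one_minus_powr_le_exp:
  fixes s R p :: real
  assumes "0 \<le> p"
  shows "max 0 (1 - s / R) powr p \<le> exp (- (p / R * s))"
proof (cases "s / R < 1")
  case True
  have "max 0 (1 - s / R) powr p = exp (p * ln (1 - s / R))" by (rule max_one_minus_powr[OF True])
  also have "\<dots> \<le> exp (p * (- (s / R)))"
    using mult_left_mono[OF ln_one_minus_bounds(2)[OF True] assms] by (simp only: exp_le_cancel_iff)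
  finally show ?thesis by simp
qed simp

text \<open>Both bounds for the logarithm, multiplied by p N, tend to - s0 / 2. The argument s N
  varies because the densities are evaluated at preimages under the N-th affine map.\<close>

lemma one_minus_powr_tendsto:
  fixes s R p :: "nat \<Rightarrow> real"
  assumes R: "filterlim R at_top sequentially" and pR: "(\<lambda>N. p N / R N) \<longlonglongrightarrow> 1 / 2"
    and p: "\<And>N. 0 \<le> p N" and s: "s \<longlonglongrightarrow> s0"
  shows "(\<lambda>N. max 0 (1 - s N / R N) powr p N) \<longlonglongrightarrow> exp (- s0 / 2)"
proof -
  have x0: "(\<lambda>N. s N / R N) \<longlonglongrightarrow> 0"
    by (rule real_tendsto_divide_at_top[OF s R])
  have px: "(\<lambda>N. p N * (s N / R N)) \<longlonglongrightarrow> s0 / 2"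
    using tendsto_mult[OF pR s] by (simp add: mult.commute)
  have ev: "\<forall>\<^sub>F N in sequentially. s N / R N < 1" using order_tendstoD(2)[OF x0, of 1] by simp
  have "(\<lambda>N. p N * ln (1 - s N / R N)) \<longlonglongrightarrow> - (s0 / 2)"
  proof (rule tendsto_sandwich)
    show "\<forall>\<^sub>F N in sequentially. - (p N * (s N / R N)) / (1 - s N / R N) \<le> p N * ln (1 - s N / R N)"
      using ev
    proof eventually_elim
      case (elim N)
      have "p N * (- (s N / R N) / (1 - s N / R N)) \<le> p N * ln (1 - s N / R N)"
        using ln_one_minus_bounds(1)[OF elim] p by (rule mult_left_mono)
      thus ?case by simp
    qed
    show "\<forall>\<^sub>F N in sequentially. p N * ln (1 - s N / R N) \<le> - (p N * (s N / R N))"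
      using ev
    proof eventually_elim
      case (elim N)
      have "p N * ln (1 - s N / R N) \<le> p N * (- (s N / R N))"
        using ln_one_minus_bounds(2)[OF elim] p by (rule mult_left_mono)
      thus ?case by simp
    qed
    have "(\<lambda>N. - (p N * (s N / R N)) / (1 - s N / R N)) \<longlonglongrightarrow> - (s0 / 2) / (1 - 0)"
      by (intro tendsto_intros px x0) simp
    thus "(\<lambda>N. - (p N * (s N / R N)) / (1 - s N / R N)) \<longlonglongrightarrow> - (s0 / 2)" by simp
    show "(\<lambda>N. - (p N * (s N / R N))) \<longlonglongrightarrow> - (s0 / 2)" by (intro tendsto_intros px)
  qed
  hence "(\<lambda>N. exp (p N * ln (1 - s N / R N))) \<longlonglongrightarrow> exp (- (s0 / 2))" by (rule tendsto_exp)
  moreover have "\<forall>\<^sub>F N in sequentially. exp (p N * ln (1 - s N / R N)) = max 0 (1 - s N / R N) powr p N"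
    using ev by eventually_elim (rule max_one_minus_powr[symmetric])
  ultimately show ?thesis by (auto intro: Lim_transform_eventually)
qed

section \<open>Triangular linear systems\<close>

fun forward_subst :: "(nat \<Rightarrow> real) \<Rightarrow> (nat \<Rightarrow> real) \<Rightarrow> (nat \<Rightarrow> nat \<Rightarrow> real) \<Rightarrow> (nat \<Rightarrow> real) \<Rightarrow> nat \<Rightarrow> real" where
  "forward_subst d b A y j = (y j - b j - (\<Sum>l<j. A j l * forward_subst d b A y l)) / d j"

declare forward_subst.simps [simp del]

definition lower_map :: "nat \<Rightarrow> (nat \<Rightarrow> real) \<Rightarrow> (nat \<Rightarrow> real) \<Rightarrow> (nat \<Rightarrow> nat \<Rightarrow> real) \<Rightarrow> (nat \<Rightarrow> real) \<Rightarrow> (nat \<Rightarrow> real)" where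
  "lower_map k d b A = triangular_map k d (\<lambda>j a. b j + (\<Sum>l<j. A j l * a l))"

lemma lower_map_apply: "j < k \<Longrightarrow> lower_map k d b A a j = d j * a j + b j + (\<Sum>l<j. A j l * a l)"
  by (simp add: lower_map_def triangular_map_def)

lemma lower_map_off_measurable: "(\<lambda>a. b j + (\<Sum>l<j. A j l * a l)) \<in> borel_measurable (borel_fun {..<j})"
  by measurable

lemma measurable_lower_map [measurable]: "lower_map k d b A \<in> measurable (borel_fun {..<k}) (borel_fun {..<k})"
  unfolding lower_map_def by (intro measurable_triangular_map lower_map_off_measurable)

lemma measurable_forward_subst:
  assumes "j < k"
  shows "(\<lambda>y. forward_subst d b A y j) \<in> borel_measurable (borel_fun {..<k})"
  using assms
proof (induction j rule: less_induct)
  case (less j)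
  have "(\<lambda>y. forward_subst d b A y l) \<in> borel_measurable (borel_fun {..<k})" if "l \<in> {..<j}" for l
    using less that by auto
  hence "(\<lambda>y. \<Sum>l<j. A j l * forward_subst d b A y l) \<in> borel_measurable (borel_fun {..<k})"
    by (intro borel_measurable_sum borel_measurable_times) auto
  moreover have "(\<lambda>y. y j) \<in> borel_measurable (borel_fun {..<k})"
    using less.prems by (intro measurable_component_singleton) auto
  ultimately show ?case unfolding forward_subst.simps[of d b A _ j] by measurable
qed

lemma forward_subst_lower_map:
  assumes d: "\<And>j. j < k \<Longrightarrow> d j \<noteq> 0" and "j < k"
  shows "forward_subst d b A (lower_map k d b A a) j = a j"
  using assms(2)
proof (induction j rule: less_induct)
  case (less j)
  have "(\<Sum>l<j. A j l * forward_subst d b A (lower_map k d b A a) l) = (\<Sum>l<j. A j l * a l)"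
    using less by (intro sum.cong) auto
  thus ?case using less.prems d
    by (subst forward_subst.simps) (simp add: lower_map_apply)
qed

text \<open>Each entry is a rational expression in the coefficients whose only denominators are
  diagonal entries d, and these have nonzero limits.\<close>

lemma tendsto_forward_subst:
  assumes "\<And>j. j < k \<Longrightarrow> (\<lambda>N. d N j) \<longlonglongrightarrow> d' j" "\<And>j. j < k \<Longrightarrow> d' j \<noteq> 0"
    and "\<And>j. j < k \<Longrightarrow> (\<lambda>N. b N j) \<longlonglongrightarrow> b' j"
    and "\<And>j l. l < j \<Longrightarrow> j < k \<Longrightarrow> (\<lambda>N. A N j l) \<longlonglongrightarrow> A' j l" and "j < k"
  shows "(\<lambda>N. forward_subst (d N) (b N) (A N) y j) \<longlonglongrightarrow> forward_subst d' b' A' y j"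
  using assms(5)
proof (induction j rule: less_induct)
  case (less j)
  have "(\<lambda>N. (y j - b N j - (\<Sum>l<j. A N j l * forward_subst (d N) (b N) (A N) y l)) / d N j)
      \<longlonglongrightarrow> (y j - b' j - (\<Sum>l<j. A' j l * forward_subst d' b' A' y l)) / d' j"
    using less assms by (intro tendsto_intros tendsto_sum) auto
  thus ?case by (simp only: forward_subst.simps[of _ _ _ _ j])
qed

section \<open>Convergence in total variation\<close>

lemma integrable_exp_quarter:
  assumes I: "finite I"
  shows "integrable (lebesgue_fun I) (\<lambda>y. exp (- (1 / 4 * (\<Sum>i\<in>I. (y i)\<^sup>2))))"
proof -
  have "integrable lborel (\<lambda>x::real. exp (- (1 / 4 * x\<^sup>2)))"
  proof -
    have "integrable lborel (\<lambda>x. sqrt (2 * pi * (sqrt 2)\<^sup>2) * normal_density 0 (sqrt 2) x)" by simp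
    also have "(\<lambda>x. sqrt (2 * pi * (sqrt 2)\<^sup>2) * normal_density 0 (sqrt 2) x) = (\<lambda>x. exp (- (1 / 4 * x\<^sup>2)))"
      by (auto simp: normal_density_def)
    finally show ?thesis .
  qed
  hence "integrable (lebesgue_fun I) (\<lambda>y. \<Prod>i\<in>I. exp (- (1 / 4 * (y i)\<^sup>2)))"
    by (intro lborel_prod.product_integrable_prod[OF I])
  also have "(\<lambda>y. \<Prod>i\<in>I. exp (- (1 / 4 * (y i)\<^sup>2))) = (\<lambda>y. exp (- (1 / 4 * (\<Sum>i\<in>I. (y i)\<^sup>2))))"
    by (simp add: exp_sum[OF I, symmetric] sum_negf sum_distrib_left)
  finally show ?thesis .
qed

text \<open>As \<open>\<phi>\<close> need not be continuous, its composition with the varying maps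
  is not treated pointwise. The maps are absorbed into the densities \<open>\<psi> N\<close> of the
  image measures, which converge pointwise and all have mass 1, so that Scheffe's lemma applies. The
  bound 1 / 4, half the limit of p N / R N, provides the majorant exp (- |y|^2 / 4) for the
  normalizing integrals.\<close>

theorem density_lower_map_tendsto:
  fixes R p :: "nat \<Rightarrow> real" and P :: "nat \<Rightarrow> (nat \<Rightarrow> real) measure"
    and \<phi> :: "(nat \<Rightarrow> real) \<Rightarrow> real"
  assumes R: "filterlim R at_top sequentially" "\<And>N. 0 < R N" and p: "\<And>N. 0 \<le> p N"
    and pR: "(\<lambda>N. p N / R N) \<longlonglongrightarrow> 1 / 2" "\<And>N. 1 / 4 \<le> p N / R N"
    and d: "\<And>N j. j < k \<Longrightarrow> 0 < d N j" "\<And>j. j < k \<Longrightarrow> 0 < d' j" "\<And>j. j < k \<Longrightarrow> (\<lambda>N. d N j) \<longlonglongrightarrow> d' j"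
    and b: "\<And>j. j < k \<Longrightarrow> (\<lambda>N. b N j) \<longlonglongrightarrow> b' j"
    and A: "\<And>j l. l < j \<Longrightarrow> j < k \<Longrightarrow> (\<lambda>N. A N j l) \<longlonglongrightarrow> A' j l"
    and prob: "\<And>N. prob_space (P N)"
    and P: "\<And>N. P N = density (lebesgue_fun {..<k}) (\<lambda>y. ennreal (max 0 (R N - (\<Sum>i<k. (y i)\<^sup>2)) powr p N /
        (\<integral>y. max 0 (R N - (\<Sum>i<k. (y i)\<^sup>2)) powr p N \<partial>lebesgue_fun {..<k})))"
    and \<phi>: "\<phi> \<in> borel_measurable (borel_fun {..<k})" "\<And>y. y \<in> space (borel_fun {..<k}) \<Longrightarrow> \<bar>\<phi> y\<bar> \<le> B"
  shows "(\<lambda>N. \<integral>a. \<phi> (lower_map k (d N) (b N) (A N) a) \<partial>P N) \<longlonglongrightarrow>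
    (\<integral>a. \<phi> (lower_map k d' b' A' a) \<partial>gauss_fun {..<k})"
proof -
  let ?L = "lebesgue_fun {..<k}"
  note [measurable] = \<phi>(1)
  define h where "h N y = max 0 (1 - (\<Sum>i<k. (y i)\<^sup>2) / R N) powr p N" for N and y :: "nat \<Rightarrow> real"
  define h' where "h' y = exp (- (\<Sum>i<k. (y i)\<^sup>2) / 2)" for y :: "nat \<Rightarrow> real"
  define Z where "Z N = (\<integral>y. h N y \<partial>?L)" for N
  define Z' where "Z' = (\<integral>y. h' y \<partial>?L)"
  have hm[measurable]: "h N \<in> borel_measurable (borel_fun {..<k})" for N unfolding h_def by measurable
  have hm'[measurable]: "h' \<in> borel_measurable (borel_fun {..<k})" unfolding h'_def by measurable
  have h0: "0 \<le> h N y" for N y by (simp add: h_def)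
  have h'0: "0 \<le> h' y" for y by (simp add: h'_def)
  have bound: "h N y \<le> exp (- (1 / 4 * (\<Sum>i<k. (y i)\<^sup>2)))" for N y
  proof -
    have "h N y \<le> exp (- (p N / R N * (\<Sum>i<k. (y i)\<^sup>2)))"
      unfolding h_def by (rule one_minus_powr_le_exp[OF p])
    also have "\<dots> \<le> exp (- (1 / 4 * (\<Sum>i<k. (y i)\<^sup>2)))"
    proof -
      have "1 / 4 * (\<Sum>i<k. (y i)\<^sup>2) \<le> p N / R N * (\<Sum>i<k. (y i)\<^sup>2)"
        by (intro mult_right_mono pR(2) sum_nonneg) simp
      thus ?thesis by (simp only: exp_le_cancel_iff neg_le_iff_le)
    qed
    finally show ?thesis .
  qed
  have Z_lim: "Z \<longlonglongrightarrow> Z'"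
    unfolding Z_def Z'_def
  proof (rule integral_dominated_convergence[OF _ _ integrable_exp_quarter])
    show "AE y in ?L. (\<lambda>N. h N y) \<longlonglongrightarrow> h' y"
      unfolding h_def h'_def by (intro AE_I2 one_minus_powr_tendsto[OF R(1) pR(1) p]) simp
    show "AE y in ?L. norm (h N y) \<le> exp (- (1 / 4 * (\<Sum>i<k. (y i)\<^sup>2)))" for N
      using bound h0 by simp
  qed (auto simp: measurable_cong_sets[OF sets_lebesgue_fun refl])
  \<comment> \<open>The factor R N powr p N occurs in the numerator and in the normalizing integral,
    hence cancels in the density.\<close>
  have scale: "max 0 (R N - s) powr p N = R N powr p N * max 0 (1 - s / R N) powr p N" for N s
  proof -
    have "max 0 (R N - s) = R N * max 0 (1 - s / R N)"
      using R(2)[of N] by (simp add: max_mult_distrib_left right_diff_distrib)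
    thus ?thesis using R(2)[of N] by (simp add: powr_mult)
  qed
  have P': "P N = density ?L (\<lambda>y. ennreal (h N y / Z N))" for N
    unfolding P scale h_def[symmetric] Z_def integral_mult_right_zero using R(2)[of N] by simp
  define \<kappa> where "\<kappa> = (1 / sqrt (2 * pi)) ^ k"
  have \<kappa>: "0 < \<kappa>" by (simp add: \<kappa>_def)
  have G: "gauss_fun {..<k} = density ?L (\<lambda>y. ennreal (\<kappa> * h' y))"
  proof -
    have "(\<Prod>i<k. std_normal_density (y i)) = \<kappa> * h' y" for y
      unfolding std_normal_density_def prod.distrib h'_def \<kappa>_def
      by (simp add: exp_sum[symmetric] sum_negf sum_divide_distrib)
    thus ?thesis unfolding gauss_fun_eq_density[OF finite_lessThan] by simp
  qed
  have h'int: "integrable ?L h'"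
  proof (rule Bochner_Integration.integrable_bound[OF integrable_exp_quarter])
    show "AE y in ?L. norm (h' y) \<le> norm (exp (- (1 / 4 * (\<Sum>i<k. (y i)\<^sup>2))))"
      by (auto simp: h'_def sum_nonneg)
  qed (auto simp: measurable_cong_sets[OF sets_lebesgue_fun refl])
  \<comment> \<open>The total mass 1 of the Gaussian identifies the limit of the normalizing
    integrals without evaluating it.\<close>
  have \<kappa>Z: "\<kappa> * Z' = 1"
  proof -
    have "1 = emeasure (gauss_fun {..<k}) (space (gauss_fun {..<k}))"
      by (rule prob_space.emeasure_space_1[OF prob_space_gauss_fun, symmetric])
    also have "\<dots> = (\<integral>\<^sup>+y. ennreal (\<kappa> * h' y) \<partial>?L)"
      unfolding G by (subst emeasure_density) (auto intro!: nn_integral_cong simp: space_PiM)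
    also have "\<dots> = ennreal (\<integral>y. \<kappa> * h' y \<partial>?L)"
      using \<kappa> h'0 h'int by (intro nn_integral_eq_integral integrable_mult_right) auto
    finally have "ennreal 1 = ennreal (\<kappa> * Z')" by (simp add: Z'_def)
    moreover have "0 \<le> \<kappa> * Z'" unfolding Z'_def using \<kappa> h'0 by (intro mult_nonneg_nonneg integral_nonneg_AE) auto
    ultimately show ?thesis by (subst (asm) ennreal_inj) auto
  qed
  hence Z'0: "Z' \<noteq> 0" by auto
  have \<kappa>_eq: "\<kappa> = 1 / Z'" using \<kappa>Z Z'0 by (simp add: field_simps)
  \<comment> \<open>The inverse of the N-th affine map, through which the density of the image
    measure is written.\<close>
  define U where "U N y = (\<lambda>j\<in>{..<k}. forward_subst (d N) (b N) (A N) y j)" for N y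
  define U' where "U' y = (\<lambda>j\<in>{..<k}. forward_subst d' b' A' y j)" for y
  have Um[measurable]: "U N \<in> measurable (borel_fun {..<k}) (borel_fun {..<k})" for N
    unfolding U_def by (intro measurable_restrict measurable_forward_subst) auto
  have U'm[measurable]: "U' \<in> measurable (borel_fun {..<k}) (borel_fun {..<k})"
    unfolding U'_def by (intro measurable_restrict measurable_forward_subst) auto
  define c where "c N = (\<Prod>j<k. 1 / d N j)" for N
  define c' where "c' = (\<Prod>j<k. 1 / d' j)"
  have c0: "0 \<le> c N" for N unfolding c_def using d(1) by (intro prod_nonneg) (auto simp: less_imp_le)
  have c'0: "0 \<le> c'" unfolding c'_def using d(2) by (intro prod_nonneg) (auto simp: less_imp_le)
  have c_lim: "c \<longlonglongrightarrow> c'" unfolding c_def c'_def using d by (intro tendsto_intros tendsto_prod) force+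
  define \<psi> where "\<psi> N y = c N * (h N (U N y) / Z N)" for N y
  define \<psi>' where "\<psi>' y = c' * (h' (U' y) / Z')" for y
  have Z0: "0 \<le> Z N" for N unfolding Z_def using h0 by (intro integral_nonneg_AE) auto
  have Z'ge: "0 \<le> Z'" unfolding Z'_def using h'0 by (intro integral_nonneg_AE) auto
  have \<psi>0: "0 \<le> \<psi> N y" for N y using c0 h0 Z0 by (simp add: \<psi>_def)
  have \<psi>'0: "0 \<le> \<psi>' y" for y using c'0 h'0 Z'ge by (simp add: \<psi>'_def)
  have \<psi>m[measurable]: "\<psi> N \<in> borel_measurable (borel_fun {..<k})" for N unfolding \<psi>_def by measurable
  have \<psi>'m[measurable]: "\<psi>' \<in> borel_measurable (borel_fun {..<k})" unfolding \<psi>'_def by measurable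
  have Q: "distr (P N) (borel_fun {..<k}) (lower_map k (d N) (b N) (A N)) = density ?L (\<lambda>y. ennreal (\<psi> N y))" for N
  proof -
    have "distr (P N) (borel_fun {..<k}) (lower_map k (d N) (b N) (A N)) =
        density ?L (\<lambda>y. ennreal (c N) * ennreal (h N (U N y) / Z N))"
      unfolding P' lower_map_def c_def
    proof (rule distr_density_triangular_map[where U = "U N"])
      fix a assume a: "a \<in> space (borel_fun {..<k})"
      show "U N (triangular_map k (d N) (\<lambda>j a. b N j + (\<Sum>l<j. A N j l * a l)) a) = a"
        using a d(1)[of _ N] forward_subst_lower_map[of k "d N" _ "b N" "A N" a]
        by (fastforce simp: U_def lower_map_def[symmetric] fun_eq_iff space_PiM PiE_iff extensional_def)
    qed (use d(1) in \<open>auto intro: lower_map_off_measurable\<close>)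
    also have "(\<lambda>y. ennreal (c N) * ennreal (h N (U N y) / Z N)) = (\<lambda>y. ennreal (\<psi> N y))"
      unfolding \<psi>_def by (intro ext ennreal_mult[symmetric] c0 divide_nonneg_nonneg h0 Z0)
    finally show ?thesis .
  qed
  have Q': "distr (gauss_fun {..<k}) (borel_fun {..<k}) (lower_map k d' b' A') = density ?L (\<lambda>y. ennreal (\<psi>' y))"
  proof -
    have "distr (gauss_fun {..<k}) (borel_fun {..<k}) (lower_map k d' b' A') =
        density ?L (\<lambda>y. ennreal c' * ennreal (\<kappa> * h' (U' y)))"
      unfolding G lower_map_def c'_def
    proof (rule distr_density_triangular_map[where U = U'])
      fix a assume a: "a \<in> space (borel_fun {..<k})"
      show "U' (triangular_map k d' (\<lambda>j a. b' j + (\<Sum>l<j. A' j l * a l)) a) = a"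
        using a d(2) forward_subst_lower_map[of k d' _ b' A' a]
        by (fastforce simp: U'_def lower_map_def[symmetric] fun_eq_iff space_PiM PiE_iff extensional_def)
    qed (use d(2) in \<open>auto intro: lower_map_off_measurable\<close>)
    also have "(\<lambda>y. ennreal c' * ennreal (\<kappa> * h' (U' y))) = (\<lambda>y. ennreal (\<psi>' y))"
      unfolding \<psi>'_def \<kappa>_eq using c'0 h'0 Z'ge by (intro ext) (simp add: ennreal_mult[symmetric])
    finally show ?thesis .
  qed
  \<comment> \<open>Scheffe's lemma asks for densities of equal mass; these belong to images of
    probability measures.\<close>
  have nn1: "(\<integral>\<^sup>+y. ennreal (f y) \<partial>?L) = 1"
    if "prob_space M" "distr M (borel_fun {..<k}) T = density ?L (\<lambda>y. ennreal (f y))" "T \<in> measurable M (borel_fun {..<k})"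
      "f \<in> borel_measurable (borel_fun {..<k})" for M T f
  proof -
    note [measurable] = that(4)
    interpret D: prob_space "density ?L (\<lambda>y. ennreal (f y))"
      unfolding that(2)[symmetric] by (rule prob_space.prob_space_distr[OF that(1,3)])
    have "1 = emeasure (density ?L (\<lambda>y. ennreal (f y))) (space (density ?L (\<lambda>y. ennreal (f y))))"
      by (rule D.emeasure_space_1[symmetric])
    also have "\<dots> = (\<integral>\<^sup>+y. ennreal (f y) \<partial>?L)"
      by (subst emeasure_density) (auto intro!: nn_integral_cong)
    finally show ?thesis by simp
  qed
  have lmP: "lower_map k (d N) (b N) (A N) \<in> measurable (P N) (borel_fun {..<k})" for N
    unfolding P' by measurable
  have lmG: "lower_map k d' b' A' \<in> measurable (gauss_fun {..<k}) (borel_fun {..<k})" by measurable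
  have \<psi>1: "(\<integral>\<^sup>+y. ennreal (\<psi> N y) \<partial>?L) = 1" for N by (rule nn1[OF prob Q lmP \<psi>m])
  have \<psi>'1: "(\<integral>\<^sup>+y. ennreal (\<psi>' y) \<partial>?L) = 1" by (rule nn1[OF prob_space_gauss_fun Q' lmG \<psi>'m])
  have int: "integrable ?L f" if "f \<in> borel_measurable (borel_fun {..<k})" "\<And>y. 0 \<le> f y" "(\<integral>\<^sup>+y. ennreal (f y) \<partial>?L) = 1" for f
    using that by (intro integrableI_nonneg) (auto simp: measurable_cong_sets[OF sets_lebesgue_fun refl])
  have \<psi>int: "integrable ?L (\<psi> N)" for N using int \<psi>m \<psi>0 \<psi>1 by blast
  have \<psi>'int: "integrable ?L \<psi>'" using int \<psi>'m \<psi>'0 \<psi>'1 by blast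
  \<comment> \<open>The coefficients converge, hence so do the preimages of a fixed y, and
    \<open>h N\<close> is evaluated along a convergent sequence.\<close>
  have pointwise: "(\<lambda>N. \<psi> N y) \<longlonglongrightarrow> \<psi>' y" for y
  proof -
    have "(\<lambda>N. \<Sum>i<k. (U N y i)\<^sup>2) \<longlonglongrightarrow> (\<Sum>i<k. (U' y i)\<^sup>2)"
    proof (intro tendsto_sum tendsto_power)
      fix i assume "i \<in> {..<k}"
      moreover have "d' j \<noteq> 0" if "j < k" for j using d(2)[OF that] by simp
      ultimately show "(\<lambda>N. U N y i) \<longlonglongrightarrow> U' y i"
        using tendsto_forward_subst[where k = k, OF d(3) _ b A] by (simp add: U_def U'_def)
    qed
    hence "(\<lambda>N. h N (U N y)) \<longlonglongrightarrow> h' (U' y)"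
      unfolding h_def h'_def by (rule one_minus_powr_tendsto[OF R(1) pR(1) p])
    thus ?thesis unfolding \<psi>_def \<psi>'_def by (intro tendsto_intros c_lim Z_lim Z'0)
  qed
  have "(\<lambda>N. \<integral>\<^sup>+y. norm (\<psi> N y - \<psi>' y) \<partial>?L) \<longlonglongrightarrow> 0"
    by (rule Scheffe_lemma2) (use pointwise \<psi>'int \<psi>0 \<psi>'0 \<psi>1 \<psi>'1 in \<open>auto simp: measurable_cong_sets[OF sets_lebesgue_fun refl]\<close>)
  hence "(\<lambda>N. enn2real (\<integral>\<^sup>+y. norm (\<psi> N y - \<psi>' y) \<partial>?L)) \<longlonglongrightarrow> enn2real 0"
    by (intro tendsto_enn2real) auto
  hence L1: "(\<lambda>N. \<integral>y. \<bar>\<psi> N y - \<psi>' y\<bar> \<partial>?L) \<longlonglongrightarrow> 0"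
    using \<psi>int \<psi>'int by (subst (asm) nn_integral_eq_integral) (auto simp: enn2real_ennreal)
  have val: "(\<integral>a. \<phi> (lower_map k (d N) (b N) (A N) a) \<partial>P N) = (\<integral>y. \<psi> N y * \<phi> y \<partial>?L)" for N
  proof -
    have "(\<integral>a. \<phi> (lower_map k (d N) (b N) (A N) a) \<partial>P N) = (\<integral>y. \<phi> y \<partial>distr (P N) (borel_fun {..<k}) (lower_map k (d N) (b N) (A N)))"
      by (rule integral_distr[OF lmP, symmetric]) measurable
    also have "\<dots> = (\<integral>y. \<psi> N y * \<phi> y \<partial>?L)"
      unfolding Q by (subst integral_density) (auto simp: \<psi>0 measurable_cong_sets[OF sets_lebesgue_fun refl])
    finally show ?thesis .
  qed
  have val': "(\<integral>a. \<phi> (lower_map k d' b' A' a) \<partial>gauss_fun {..<k}) = (\<integral>y. \<psi>' y * \<phi> y \<partial>?L)"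
  proof -
    have "(\<integral>a. \<phi> (lower_map k d' b' A' a) \<partial>gauss_fun {..<k}) = (\<integral>y. \<phi> y \<partial>distr (gauss_fun {..<k}) (borel_fun {..<k}) (lower_map k d' b' A'))"
      by (rule integral_distr[OF lmG, symmetric]) measurable
    also have "\<dots> = (\<integral>y. \<psi>' y * \<phi> y \<partial>?L)"
      unfolding Q' by (subst integral_density) (auto simp: \<psi>'0 measurable_cong_sets[OF sets_lebesgue_fun refl])
    finally show ?thesis .
  qed
  have \<phi>int: "integrable ?L (\<lambda>y. f y * \<phi> y)" if f: "integrable ?L f" for f
  proof (rule Bochner_Integration.integrable_bound)
    show "integrable ?L (\<lambda>y. B * f y)" using f by simp
    show "(\<lambda>y. f y * \<phi> y) \<in> borel_measurable ?L"
      using borel_measurable_integrable[OF f] by measurable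
    show "AE y in ?L. norm (f y * \<phi> y) \<le> norm (B * f y)"
    proof (intro AE_I2)
      fix y assume "y \<in> space ?L"
      hence "\<bar>\<phi> y\<bar> \<le> B" using \<phi>(2) by (simp add: space_PiM)
      hence "\<bar>f y\<bar> * \<bar>\<phi> y\<bar> \<le> \<bar>f y\<bar> * \<bar>B\<bar>" by (intro mult_left_mono) auto
      thus "norm (f y * \<phi> y) \<le> norm (B * f y)" by (simp add: abs_mult mult.commute)
    qed
  qed
  show ?thesis
    unfolding val val'
  proof (rule LIM_zero_cancel, rule Lim_null_comparison)
    show "\<forall>\<^sub>F N in sequentially. norm ((\<integral>y. \<psi> N y * \<phi> y \<partial>?L) - (\<integral>y. \<psi>' y * \<phi> y \<partial>?L)) \<le> B * (\<integral>y. \<bar>\<psi> N y - \<psi>' y\<bar> \<partial>?L)"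
    proof (intro always_eventually allI)
      fix N
      have "(\<integral>y. \<psi> N y * \<phi> y \<partial>?L) - (\<integral>y. \<psi>' y * \<phi> y \<partial>?L) = (\<integral>y. (\<psi> N y - \<psi>' y) * \<phi> y \<partial>?L)"
        using \<phi>int[OF \<psi>int] \<phi>int[OF \<psi>'int] by (simp add: left_diff_distrib)
      also have "norm \<dots> \<le> (\<integral>y. norm ((\<psi> N y - \<psi>' y) * \<phi> y) \<partial>?L)" by (rule integral_norm_bound)
      also have "\<dots> \<le> (\<integral>y. B * \<bar>\<psi> N y - \<psi>' y\<bar> \<partial>?L)"
      proof (rule integral_mono)
        have "integrable ?L (\<lambda>y. \<psi> N y - \<psi>' y)" using \<psi>int \<psi>'int by simp
        from \<phi>int[OF this] show "integrable ?L (\<lambda>y. norm ((\<psi> N y - \<psi>' y) * \<phi> y))" by (rule integrable_norm)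
        show "integrable ?L (\<lambda>y. B * \<bar>\<psi> N y - \<psi>' y\<bar>)" using \<psi>int \<psi>'int by simp
        fix y assume "y \<in> space ?L"
        hence "\<bar>\<phi> y\<bar> \<le> B" using \<phi>(2) by (simp add: space_PiM)
        hence "\<bar>\<psi> N y - \<psi>' y\<bar> * \<bar>\<phi> y\<bar> \<le> \<bar>\<psi> N y - \<psi>' y\<bar> * B" by (intro mult_left_mono) auto
        thus "norm ((\<psi> N y - \<psi>' y) * \<phi> y) \<le> B * \<bar>\<psi> N y - \<psi>' y\<bar>" by (simp add: abs_mult mult.commute)
      qed
      also have "\<dots> = B * (\<integral>y. \<bar>\<psi> N y - \<psi>' y\<bar> \<partial>?L)" by simp
      finally show "norm ((\<integral>y. \<psi> N y * \<phi> y \<partial>?L) - (\<integral>y. \<psi>' y * \<phi> y \<partial>?L)) \<le> \<dots>" .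
    qed
    show "(\<lambda>N. B * (\<integral>y. \<bar>\<psi> N y - \<psi>' y\<bar> \<partial>?L)) \<longlonglongrightarrow> 0"
      using tendsto_mult[OF tendsto_const L1, of B] by simp
  qed
qed


section \<open>Gram-Schmidt orthogonalization in the sequence space\<close>

definition unit_ell2 :: "nat \<Rightarrow> ell2" where
  "unit_ell2 j = Abs_ell2 (\<lambda>n. if n = j then 1 else 0)"

definition trunc_ell2 :: "nat \<Rightarrow> ell2 \<Rightarrow> ell2" where
  "trunc_ell2 N x = Abs_ell2 (\<lambda>n. if n < N then coord x n else 0)"

lemma coord_Abs_finite:
  assumes "\<And>n. n \<ge> N \<Longrightarrow> f n = 0"
  shows "coord (Abs_ell2 f) = f"
proof -
  have "summable (\<lambda>n. (f n)\<^sup>2)"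
    by (rule summable_finite[of "{..<N}"]) (use assms in \<open>auto simp: not_less\<close>)
  thus ?thesis by (simp add: Abs_ell2_inverse)
qed

lemma coord_unit: "coord (unit_ell2 j) n = (if n = j then 1 else 0)"
  unfolding unit_ell2_def by (subst coord_Abs_finite[of "Suc j"]) auto

lemma coord_trunc: "coord (trunc_ell2 N x) n = (if n < N then coord x n else 0)"
  unfolding trunc_ell2_def by (subst coord_Abs_finite[of N]) auto

lemma coord_sum: "coord (\<Sum>i\<in>I. f i) n = (\<Sum>i\<in>I. coord (f i) n)"
  by (induction I rule: infinite_finite_induct) auto

lemma inner_ell2_finite:
  assumes "\<And>n. n \<ge> N \<Longrightarrow> coord x n = 0 \<or> coord y n = 0"
  shows "inner x y = (\<Sum>n<N. coord x n * coord y n)"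
  unfolding inner_ell2_def by (rule suminf_finite) (use assms in \<open>auto simp: not_less\<close>)

lemma inner_unit: "inner x (unit_ell2 j) = coord x j"
  by (subst inner_ell2_finite[of "Suc j"]) (auto simp: coord_unit)

lemma unit_in_RN: "j < N \<Longrightarrow> unit_ell2 j \<in> RN N"
  by (simp add: RN_def coord_unit)

lemma trunc_in_RN: "trunc_ell2 N x \<in> RN N"
  by (simp add: RN_def coord_trunc)

lemma trunc_eq: "x \<in> RN N \<Longrightarrow> trunc_ell2 N x = x"
  by (auto simp: RN_def coord_trunc intro!: ell2_eqI)

lemma subspace_RN: "subspace (RN N)"
  by (auto simp: subspace_def RN_def)

lemma inner_trunc_right: "x \<in> RN N \<Longrightarrow> inner x (trunc_ell2 N y) = inner x y"
  by (subst (1 2) inner_ell2_finite[of N]) (auto simp: RN_def coord_trunc)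

lemma tendsto_inner_trunc: "(\<lambda>N. inner (trunc_ell2 N x) (trunc_ell2 N y)) \<longlonglongrightarrow> inner x y"
proof -
  have "inner (trunc_ell2 N x) (trunc_ell2 N y) = (\<Sum>n<N. coord x n * coord y n)" for N
    by (subst inner_ell2_finite[of N]) (auto simp: coord_trunc)
  thus ?thesis unfolding inner_ell2_def using summable_LIMSEQ[OF summable_coord_mult] by simp
qed

section \<open>The Gram-Schmidt recursion and its continuity\<close>

fun gs :: "(nat \<Rightarrow> 'a::real_inner) \<Rightarrow> nat \<Rightarrow> 'a" where
  "gs v i = sgn (v i - (\<Sum>l<i. inner (v i) (gs v l) *\<^sub>R gs v l))"

declare gs.simps [simp del]

definition gs_resid :: "(nat \<Rightarrow> 'a::real_inner) \<Rightarrow> nat \<Rightarrow> 'a" where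
  "gs_resid v i = v i - (\<Sum>l<i. inner (v i) (gs v l) *\<^sub>R gs v l)"

lemma gs_eq: "gs v i = gs_resid v i /\<^sub>R norm (gs_resid v i)"
  by (simp add: gs.simps[of v i] gs_resid_def sgn_div_norm)

text \<open>This holds for dependent vectors too: when the residual is 0, \<open>sgn\<close> makes
  \<open>gs v i\<close> zero as well. The expansion is triangular, with the norm of the residual as
  diagonal coefficient.\<close>

lemma gs_decomp: "v i = norm (gs_resid v i) *\<^sub>R gs v i + (\<Sum>l<i. inner (v i) (gs v l) *\<^sub>R gs v l)"
proof -
  have "norm (gs_resid v i) *\<^sub>R gs v i = gs_resid v i" by (cases "gs_resid v i = 0") (auto simp: gs_eq)
  thus ?thesis by (simp add: gs_resid_def)
qed

lemma gs_orthonormal: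
  assumes "\<And>i. i < q \<Longrightarrow> gs_resid v i \<noteq> 0" "i < q" "j < q"
  shows "inner (gs v i) (gs v j) = (if i = j then 1 else 0)"
proof -
  have norm1: "inner (gs v i) (gs v i) = 1" if "i < q" for i
    using assms(1)[OF that] by (simp add: gs_eq power2_norm_eq_inner[symmetric] power2_eq_square)
  have "\<forall>j<i. inner (gs v i) (gs v j) = 0" if "i < q" for i
    using that
  proof (induction i rule: less_induct)
    case (less i)
    show ?case
    proof (intro allI impI)
      fix j assume j: "j < i"
      have "(\<Sum>l<i. inner (v i) (gs v l) * inner (gs v l) (gs v j)) = (\<Sum>l<i. if l = j then inner (v i) (gs v j) else 0)"
      proof (rule sum.cong)
        fix l assume l: "l \<in> {..<i}"
        show "inner (v i) (gs v l) * inner (gs v l) (gs v j) = (if l = j then inner (v i) (gs v j) else 0)"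
        proof (cases l j rule: linorder_cases)
          case less
          have "inner (gs v j) (gs v l) = 0" using less.IH[OF j] less j less.prems by auto
          thus ?thesis using less by (simp add: inner_commute)
        next
          case equal
          thus ?thesis using norm1 j less.prems by simp
        next
          case greater
          have "inner (gs v l) (gs v j) = 0" using less.IH[of l] greater l less.prems by auto
          thus ?thesis using greater by simp
        qed
      qed simp
      also have "\<dots> = inner (v i) (gs v j)" using j by simp
      finally show "inner (gs v i) (gs v j) = 0"
        by (simp add: gs_eq[of v i] gs_resid_def inner_diff_left inner_sum_left)
    qed
  qed
  hence lower: "inner (gs v i) (gs v j) = 0" if "j < i" "i < q" for i j using that by blast
  show ?thesis
  proof (cases i j rule: linorder_cases)
    case less
    thus ?thesis using lower[OF less] assms(3) by (simp add: inner_commute)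
  qed (use norm1 lower assms(2) in auto)
qed

text \<open>Together with \<open>norm_gs_resid\<close>, this is a recursion expressing all
  coefficients through inner products of the original vectors.\<close>

lemma inner_gs:
  "inner (u j) (gs u i) = (inner (u j) (u i) - (\<Sum>l<i. inner (u i) (gs u l) * inner (u j) (gs u l))) / norm (gs_resid u i)"
  by (simp add: gs_eq[of u i] gs_resid_def[of u i] inner_diff_right inner_sum_right divide_inverse mult.commute)

lemma norm_gs_resid:
  assumes "\<And>l. l < i \<Longrightarrow> gs_resid v l \<noteq> 0"
  shows "norm (gs_resid v i) = sqrt (inner (v i) (v i) - (\<Sum>l<i. (inner (v i) (gs v l))\<^sup>2))"
proof -
  let ?s = "\<Sum>l<i. inner (v i) (gs v l) *\<^sub>R gs v l"
  have "inner ?s (gs v l) = inner (v i) (gs v l)" if "l < i" for l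
  proof -
    have "inner ?s (gs v l) = (\<Sum>l'<i. if l' = l then inner (v i) (gs v l') else 0)"
      unfolding inner_sum_left using that gs_orthonormal[OF assms] by (intro sum.cong) auto
    thus ?thesis using that by simp
  qed
  hence "(\<Sum>l<i. inner ?s (inner (v i) (gs v l) *\<^sub>R gs v l)) = (\<Sum>l<i. (inner (v i) (gs v l))\<^sup>2)"
    by (intro sum.cong) (auto simp: power2_eq_square)
  hence ss: "inner ?s ?s = (\<Sum>l<i. (inner (v i) (gs v l))\<^sup>2)"
    by (simp only: inner_sum_right[of ?s "\<lambda>l. inner (v i) (gs v l) *\<^sub>R gs v l"])
  have vs: "inner (v i) ?s = (\<Sum>l<i. (inner (v i) (gs v l))\<^sup>2)"
    by (simp add: inner_sum_right power2_eq_square)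
  have "inner (gs_resid v i) (gs_resid v i) = inner (v i) (v i) - (\<Sum>l<i. (inner (v i) (gs v l))\<^sup>2)"
    unfolding gs_resid_def inner_diff_left inner_diff_right ss vs inner_commute[of ?s "v i"] by simp
  thus ?thesis by (simp add: norm_eq_sqrt_inner)
qed

text \<open>By \<open>inner_gs\<close> and \<open>norm_gs_resid\<close> the coefficients are
  continuous functions of the Gram matrix where the residuals are nonzero. The vectors themselves
  are never compared, so those of the sequence and those of the limit may lie in different
  spaces.\<close>

lemma gs_tendsto:
  fixes v :: "nat \<Rightarrow> nat \<Rightarrow> 'a::real_inner" and v' :: "nat \<Rightarrow> 'b::real_inner"
  assumes lim: "\<And>i j. (\<lambda>N. inner (v N i) (v N j)) \<longlonglongrightarrow> inner (v' i) (v' j)"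
    and resid: "\<And>i. i < q \<Longrightarrow> gs_resid v' i \<noteq> 0"
  shows "i < q \<Longrightarrow> (\<forall>\<^sub>F N in sequentially. gs_resid (v N) i \<noteq> 0) \<and>
      (\<lambda>N. norm (gs_resid (v N) i)) \<longlonglongrightarrow> norm (gs_resid v' i) \<and>
      (\<forall>j. (\<lambda>N. inner (v N j) (gs (v N) i)) \<longlonglongrightarrow> inner (v' j) (gs v' i))"
proof (induction i rule: less_induct)
  case (less i)
  have ev: "\<forall>\<^sub>F N in sequentially. \<forall>l\<in>{..<i}. gs_resid (v N) l \<noteq> 0"
    using less by (intro eventually_ball_finite) auto
  have IH: "(\<lambda>N. inner (v N j) (gs (v N) l)) \<longlonglongrightarrow> inner (v' j) (gs v' l)" if "l < i" for j l
    using less that by auto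
  have "(\<lambda>N. sqrt (inner (v N i) (v N i) - (\<Sum>l<i. (inner (v N i) (gs (v N) l))\<^sup>2)))
      \<longlonglongrightarrow> sqrt (inner (v' i) (v' i) - (\<Sum>l<i. (inner (v' i) (gs v' l))\<^sup>2))"
    by (intro tendsto_intros lim IH) auto
  moreover have "sqrt (inner (v' i) (v' i) - (\<Sum>l<i. (inner (v' i) (gs v' l))\<^sup>2)) = norm (gs_resid v' i)"
    by (rule norm_gs_resid[symmetric]) (use resid less.prems in auto)
  moreover have "\<forall>\<^sub>F N in sequentially. sqrt (inner (v N i) (v N i) - (\<Sum>l<i. (inner (v N i) (gs (v N) l))\<^sup>2)) = norm (gs_resid (v N) i)"
    using ev by eventually_elim (rule norm_gs_resid[symmetric], auto)
  ultimately have nlim: "(\<lambda>N. norm (gs_resid (v N) i)) \<longlonglongrightarrow> norm (gs_resid v' i)"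
    by (auto intro: Lim_transform_eventually)
  have pos: "0 < norm (gs_resid v' i)" using resid less.prems by simp
  have "\<forall>\<^sub>F N in sequentially. 0 < norm (gs_resid (v N) i)" using order_tendstoD(1)[OF nlim pos] .
  hence "\<forall>\<^sub>F N in sequentially. gs_resid (v N) i \<noteq> 0" by eventually_elim auto
  moreover have "(\<lambda>N. inner (v N j) (gs (v N) i)) \<longlonglongrightarrow> inner (v' j) (gs v' i)" for j
  proof -
    have "(\<lambda>N. (inner (v N j) (v N i) - (\<Sum>l<i. inner (v N i) (gs (v N) l) * inner (v N j) (gs (v N) l))) / norm (gs_resid (v N) i))
      \<longlonglongrightarrow> (inner (v' j) (v' i) - (\<Sum>l<i. inner (v' i) (gs v' l) * inner (v' j) (gs v' l))) / norm (gs_resid v' i)"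
      using pos by (intro tendsto_intros lim IH nlim) auto
    thus ?thesis by (simp only: inner_gs[of _ _ i])
  qed
  ultimately show ?case using nlim by blast
qed

lemma gs_mem_subspace:
  assumes V: "subspace V" and v: "\<And>l. l \<le> i \<Longrightarrow> v l \<in> V"
  shows "gs v i \<in> V"
  using v
proof (induction i rule: less_induct)
  case (less i)
  have "gs v l \<in> V" if "l \<in> {..<i}" for l using less that by auto
  hence "gs_resid v i \<in> V"
    unfolding gs_resid_def using less.prems V
    by (intro subspace_diff subspace_sum subspace_scale) auto
  thus ?case unfolding gs_eq using V by (intro subspace_scale)
qed

lemma gs_ortho:
  assumes "\<And>l. l \<le> i \<Longrightarrow> inner x (v l) = 0"
  shows "inner x (gs v i) = 0"
proof -
  have "subspace {y. inner x y = 0}" by (auto simp: subspace_def inner_add_right)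
  from gs_mem_subspace[OF this, of i v] assms show ?thesis by simp
qed

section \<open>Orthonormal completion in finite dimension\<close>

lemma ortho_resid:
  fixes g :: "nat \<Rightarrow> 'a::real_inner"
  assumes "\<And>i j. i < q \<Longrightarrow> j < q \<Longrightarrow> inner (g i) (g j) = (if i = j then 1 else 0)"
  shows "l < q \<Longrightarrow> inner (x - (\<Sum>i<q. inner x (g i) *\<^sub>R g i)) (g l) = 0"
    and "(norm (x - (\<Sum>i<q. inner x (g i) *\<^sub>R g i)))\<^sup>2 = inner x x - (\<Sum>i<q. (inner x (g i))\<^sup>2)"
proof -
  let ?s = "\<Sum>i<q. inner x (g i) *\<^sub>R g i"
  have *: "inner ?s (g l) = inner x (g l)" if "l < q" for l
  proof -
    have "inner ?s (g l) = (\<Sum>i<q. if i = l then inner x (g i) else 0)"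
      unfolding inner_sum_left using that assms by (intro sum.cong) auto
    thus ?thesis using that by simp
  qed
  thus "l < q \<Longrightarrow> inner (x - ?s) (g l) = 0" by (simp add: inner_diff_left)
  have "(\<Sum>l<q. inner ?s (inner x (g l) *\<^sub>R g l)) = (\<Sum>l<q. (inner x (g l))\<^sup>2)"
    using * by (intro sum.cong) (auto simp: power2_eq_square)
  hence ss: "inner ?s ?s = (\<Sum>l<q. (inner x (g l))\<^sup>2)"
    by (simp only: inner_sum_right[of ?s "\<lambda>l. inner x (g l) *\<^sub>R g l"])
  have xs: "inner x ?s = (\<Sum>l<q. (inner x (g l))\<^sup>2)"
    by (simp add: inner_sum_right power2_eq_square)
  show "(norm (x - ?s))\<^sup>2 = inner x x - (\<Sum>i<q. (inner x (g i))\<^sup>2)"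
    unfolding power2_norm_eq_inner inner_diff_left inner_diff_right ss xs inner_commute[of ?s x] by simp
qed

text \<open>The squared distances of the standard basis vectors to the span of \<open>q\<close> orthonormal vectors
  add up to \<open>N - q\<close>; this replaces dimension counting.\<close>

lemma sum_norm_resid_unit:
  assumes on: "\<And>i j. i < q \<Longrightarrow> j < q \<Longrightarrow> inner (g i) (g j) = (if i = j then 1 else 0)"
    and RN: "\<And>i. i < q \<Longrightarrow> g i \<in> RN N"
  shows "(\<Sum>j<N. (norm (unit_ell2 j - (\<Sum>i<q. inner (unit_ell2 j) (g i) *\<^sub>R g i)))\<^sup>2) = real N - real q"
proof -
  have "(\<Sum>j<N. (norm (unit_ell2 j - (\<Sum>i<q. inner (unit_ell2 j) (g i) *\<^sub>R g i)))\<^sup>2) =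
      (\<Sum>j<N. 1 - (\<Sum>i<q. (coord (g i) j)\<^sup>2))"
    by (intro sum.cong refl, subst ortho_resid(2)[OF on]) (auto simp: inner_unit coord_unit inner_commute[of "unit_ell2 _"])
  also have "\<dots> = real N - (\<Sum>i<q. \<Sum>j<N. (coord (g i) j)\<^sup>2)"
    unfolding sum_subtractf by (subst sum.swap) simp
  also have "(\<Sum>i<q. \<Sum>j<N. (coord (g i) j)\<^sup>2) = (\<Sum>i<q. inner (g i) (g i))"
    using RN by (intro sum.cong refl, subst inner_ell2_finite[of N]) (auto simp: RN_def power2_eq_square)
  also have "\<dots> = real q" using on by simp
  finally show ?thesis .
qed

text \<open>While q' < N, the squared residuals of the N unit vectors add up to N - q' > 0, so some
  unit vector has a nonzero residual; normalized, it becomes the next member.\<close>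

lemma orthonormal_extend:
  assumes on: "\<And>i j. i < q \<Longrightarrow> j < q \<Longrightarrow> inner (g i) (g j) = (if i = j then 1 else 0)"
    and RN: "\<And>i. i < q \<Longrightarrow> g i \<in> RN N" and q: "q \<le> N"
  obtains e where "\<And>i. i < q \<Longrightarrow> e i = g i" "\<And>i. i < N \<Longrightarrow> e i \<in> RN N"
    "\<And>i j. i < N \<Longrightarrow> j < N \<Longrightarrow> inner (e i) (e j) = (if i = j then 1 else 0)"
proof -
  have "\<exists>e. (\<forall>i<q. e i = g i) \<and> (\<forall>i<q'. e i \<in> RN N) \<and> (\<forall>i<q'. \<forall>j<q'. inner (e i) (e j) = (if i = j then 1 else 0))"
    if "q \<le> q'" "q' \<le> N" for q'
    using that
  proof (induction q' rule: dec_induct)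
    case base
    show ?case by (rule exI[of _ g]) (use on RN in auto)
  next
    case (step q')
    then obtain e where e: "\<forall>i<q. e i = g i" "\<forall>i<q'. e i \<in> RN N"
      "\<forall>i<q'. \<forall>j<q'. inner (e i) (e j) = (if i = j then 1 else 0)" by auto
    define u where "u j = unit_ell2 j - (\<Sum>i<q'. inner (unit_ell2 j) (e i) *\<^sub>R e i)" for j
    have "(\<Sum>j<N. (norm (u j))\<^sup>2) = real N - real q'"
      unfolding u_def by (rule sum_norm_resid_unit) (use e in auto)
    also have "\<dots> \<noteq> 0" using step by simp
    finally obtain j where j: "j < N" "u j \<noteq> 0" by (metis (no_types, lifting) lessThan_iff norm_zero power_zero_numeral sum.neutral)
    have uo: "inner (u j) (e l) = 0" if "l < q'" for l
      unfolding u_def by (rule ortho_resid(1)) (use e that in auto)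
    have uR: "u j \<in> RN N" unfolding u_def using e(2) j subspace_RN unit_in_RN
      by (intro subspace_diff subspace_sum subspace_scale) auto
    define e' where "e' = e(q' := sgn (u j))"
    have "inner (e' i) (e' l) = (if i = l then 1 else 0)" if "i < Suc q'" "l < Suc q'" for i l
    proof -
      have "inner (sgn (u j)) (sgn (u j)) = 1" using j
        by (simp add: power2_norm_eq_inner[symmetric] norm_sgn)
      thus ?thesis using that e(3) uo
        by (auto simp: e'_def less_Suc_eq sgn_div_norm inner_commute[of "e _" "u j"])
    qed
    moreover have "e' i \<in> RN N" if "i < Suc q'" for i
      using that e(2) uR subspace_RN by (auto simp: e'_def less_Suc_eq sgn_div_norm intro: subspace_scale)
    moreover have "\<forall>i<q. e' i = g i" using e(1) step by (auto simp: e'_def)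
    ultimately show ?case by blast
  qed
  from this[OF q order_refl] show thesis using that by metis
qed

text \<open>For a family of N vectors the squared residuals add up to 0, so each of the first N unit
  vectors lies in their span.\<close>

lemma orthonormal_expansion_RN:
  assumes on: "\<And>i j. i < N \<Longrightarrow> j < N \<Longrightarrow> inner (e i) (e j) = (if i = j then 1 else 0)"
    and RN: "\<And>i. i < N \<Longrightarrow> e i \<in> RN N" and x: "x \<in> RN N"
  shows "x = (\<Sum>i<N. inner x (e i) *\<^sub>R e i)"
proof (rule ell2_eqI)
  fix n
  let ?s = "\<Sum>i<N. inner x (e i) *\<^sub>R e i"
  show "coord x n = coord ?s n"
  proof (cases "n < N")
    case True
    have "(\<Sum>j<N. (norm (unit_ell2 j - (\<Sum>i<N. inner (unit_ell2 j) (e i) *\<^sub>R e i)))\<^sup>2) = 0"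
      using sum_norm_resid_unit[OF on RN] by simp
    hence "unit_ell2 n = (\<Sum>i<N. inner (unit_ell2 n) (e i) *\<^sub>R e i)"
      using True by (subst (asm) sum_nonneg_eq_0_iff) auto
    hence "coord x n = inner x (\<Sum>i<N. inner (unit_ell2 n) (e i) *\<^sub>R e i)"
      by (metis inner_unit)
    also have "\<dots> = (\<Sum>i<N. inner x (e i) * coord (e i) n)"
      by (simp add: inner_sum_right inner_commute[of "unit_ell2 n"] inner_unit mult.commute)
    also have "\<dots> = coord ?s n" by (simp add: coord_sum)
    finally show ?thesis .
  next
    case False
    thus ?thesis using x RN by (simp add: coord_sum RN_def)
  qed
qed

lemma closed_RN: "closed (RN N)"
proof -
  have "RN N = (\<Inter>n\<in>{N..}. {x. inner x (unit_ell2 n) = 0})" by (auto simp: RN_def inner_unit)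
  moreover have "closed {x. inner x (unit_ell2 n) = 0}" for n
    by (intro closed_Collect_eq continuous_intros)
  ultimately show ?thesis by auto
qed

lemma closed_affine: "closed {v :: 'a::real_inner. \<forall>i<m. inner v (w i) = p i}"
proof -
  have "{v. \<forall>i<m. inner v (w i) = p i} = (\<Inter>i\<in>{..<m}. {v. inner v (w i) = p i})" by auto
  moreover have "closed {v. inner v (w i) = p i}" for i
    by (intro closed_Collect_eq continuous_intros)
  ultimately show ?thesis by auto
qed


section \<open>Spheres in affine sections\<close>

lemma measurable_first_coords_coord:
  "(\<lambda>x. first_coords k (coord x)) \<in> measurable borel (borel_fun {..<k})"
  unfolding first_coords_def
proof (rule measurable_restrict)
  fix j
  have "(\<lambda>x. inner x (unit_ell2 j)) \<in> borel_measurable borel"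
    by (intro borel_measurable_continuous_onI continuous_intros)
  thus "(\<lambda>x. coord x j) \<in> borel_measurable borel" by (simp add: inner_unit)
qed

lemma sum_lessThan_add:
  fixes f :: "nat \<Rightarrow> 'a::comm_monoid_add"
  shows "(\<Sum>i<m + n. f i) = (\<Sum>i<m. f i) + (\<Sum>l<n. f (m + l))"
  by (induction n) (auto simp: add.assoc)

lemma inner_gs_decomp:
  "inner x (v i) = norm (gs_resid v i) * inner x (gs v i) + (\<Sum>l<i. inner (v i) (gs v l) * inner x (gs v l))"
  by (subst gs_decomp) (simp add: inner_add_right inner_sum_right)

lemma forward_subst_eq_iff:
  assumes "\<And>i. i < m \<Longrightarrow> d i \<noteq> 0"
  shows "(\<forall>i<m. d i * X i + (\<Sum>l<i. A i l * X l) = p i) \<longleftrightarrow> (\<forall>i<m. X i = forward_subst d (\<lambda>_. 0) A p i)"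
    (is "?lhs \<longleftrightarrow> ?rhs")
proof
  assume eq: ?lhs
  have "X i = forward_subst d (\<lambda>_. 0) A p i" if "i < m" for i
    using that
  proof (induction i rule: less_induct)
    case (less i)
    have "(\<Sum>l<i. A i l * forward_subst d (\<lambda>_. 0) A p l) = (\<Sum>l<i. A i l * X l)"
      using less by (intro sum.cong) auto
    hence "forward_subst d (\<lambda>_. 0) A p i = (p i - (\<Sum>l<i. A i l * X l)) / d i"
      by (subst forward_subst.simps) simp
    also have "p i = d i * X i + (\<Sum>l<i. A i l * X l)" using eq less.prems by simp
    finally show ?case using assms less.prems by simp
  qed
  thus ?rhs by blast
next
  assume eq: ?rhs
  show ?lhs
  proof (intro allI impI)
    fix i assume i: "i < m"
    have "(\<Sum>l<i. A i l * forward_subst d (\<lambda>_. 0) A p l) = (\<Sum>l<i. A i l * X l)"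
      using eq i by (intro sum.cong) auto
    moreover have "X i = forward_subst d (\<lambda>_. 0) A p i" using eq i by simp
    ultimately have "X i = (p i - (\<Sum>l<i. A i l * X l)) / d i"
      by (subst (asm) forward_subst.simps) simp
    thus "d i * X i + (\<Sum>l<i. A i l * X l) = p i" using assms[OF i] by simp
  qed
qed

text \<open>The constraint vectors come first: the first m Gram-Schmidt vectors then carry the
  coordinates fixed by L, and the next k the free coordinates on which the first k entries
  depend.\<close>

definition frame :: "nat \<Rightarrow> (nat \<Rightarrow> ell2) \<Rightarrow> nat \<Rightarrow> ell2" where
  "frame m w i = (if i < m then w i else unit_ell2 (i - m))"

text \<open>The j-th entry of x is its inner product with v (m + j), which Gram-Schmidt expands
  triangularly; the fixed coordinates c enter the offset, the free coordinates a the linear part. It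
  serves both the points of a sphere and the limiting Gaussian vector.\<close>

lemma lower_map_frame:
  fixes v :: "nat \<Rightarrow> ell2"
  assumes v: "\<And>j. j < k \<Longrightarrow> v (m + j) = unit_ell2 j"
    and c: "\<And>i. i < m \<Longrightarrow> inner x (gs v i) = c i"
    and a: "\<And>l. l < k \<Longrightarrow> inner x (gs v (m + l)) = a l"
  shows "lower_map k (\<lambda>j. norm (gs_resid v (m + j))) (\<lambda>j. \<Sum>i<m. inner (v (m + j)) (gs v i) * c i)
      (\<lambda>j l. inner (v (m + j)) (gs v (m + l))) a = first_coords k (coord x)"
proof
  fix j
  show "lower_map k (\<lambda>j. norm (gs_resid v (m + j))) (\<lambda>j. \<Sum>i<m. inner (v (m + j)) (gs v i) * c i)
      (\<lambda>j l. inner (v (m + j)) (gs v (m + l))) a j = first_coords k (coord x) j"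
  proof (cases "j < k")
    case True
    have "coord x j = inner x (v (m + j))" by (simp add: v True inner_unit)
    also have "\<dots> = norm (gs_resid v (m + j)) * inner x (gs v (m + j)) +
        (\<Sum>l<m + j. inner (v (m + j)) (gs v l) * inner x (gs v l))"
      by (rule inner_gs_decomp)
    also have "\<dots> = norm (gs_resid v (m + j)) * a j +
        ((\<Sum>i<m. inner (v (m + j)) (gs v i) * c i) + (\<Sum>l<j. inner (v (m + j)) (gs v (m + l)) * a l))"
      unfolding sum_lessThan_add using True c a by (intro arg_cong2[where f = "(+)"] sum.cong) auto
    finally show ?thesis using True by (simp add: lower_map_apply first_coords_def)
  next
    case False
    thus ?thesis by (simp add: lower_map_def triangular_map_def first_coords_def)
  qed
qed

text \<open>On \<open>RN N\<close> the constraints become a triangular system for the Gram-Schmidt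
  coordinates. Its solution c gives the point of the section closest to the origin, and the squared
  radius R is N minus the squared norm of that point. The marginal law on a sphere in dimension N -
  m then yields P.\<close>

lemma surface_integral_eq:
  fixes N m k :: nat and w :: "nat \<Rightarrow> ell2" and p :: "nat \<Rightarrow> real" and \<phi> :: "(nat \<Rightarrow> real) \<Rightarrow> real"
  defines "v \<equiv> frame m (\<lambda>i. trunc_ell2 N (w i))"
  defines "c \<equiv> forward_subst (\<lambda>i. norm (gs_resid v i)) (\<lambda>_. 0) (\<lambda>i l. inner (v i) (gs v l)) p"
  defines "R \<equiv> real N - (\<Sum>i<m. (c i)\<^sup>2)"
  defines "h \<equiv> \<lambda>y. max 0 (R - (\<Sum>i<k. (y i)\<^sup>2)) powr (real (N - m - k) / 2 - 1)"
  defines "P \<equiv> density (lebesgue_fun {..<k}) (\<lambda>y. ennreal (h y / (\<integral>y. h y \<partial>lebesgue_fun {..<k})))"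
  assumes resid: "\<And>i. i < m + k \<Longrightarrow> gs_resid v i \<noteq> 0" and N: "m + k + 3 \<le> N" and k: "0 < k" and R: "0 < R"
    and \<phi>: "\<phi> \<in> borel_measurable (borel_fun {..<k})"
    and L: "L = {v. \<forall>i<m. inner v (w i) = p i}"
  shows "prob_space P \<and>
    (\<integral>x. \<phi> (first_coords k (coord x)) \<partial>normalized_surface_measure (N - m - 1) (L \<inter> RN N \<inter> sphere 0 (sqrt (real N)))) =
    (\<integral>a. \<phi> (lower_map k (\<lambda>j. norm (gs_resid v (m + j))) (\<lambda>j. \<Sum>i<m. inner (v (m + j)) (gs v i) * c i)
      (\<lambda>j l. inner (v (m + j)) (gs v (m + l))) a) \<partial>P)"
proof -
  define n where "n = N - m"
  have Nmn: "N = m + n" and n2: "2 \<le> n" and kn: "k + 3 \<le> n" using N by (auto simp: n_def)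
  define T where "T = lower_map k (\<lambda>j. norm (gs_resid v (m + j))) (\<lambda>j. \<Sum>i<m. inner (v (m + j)) (gs v i) * c i)
      (\<lambda>j l. inner (v (m + j)) (gs v (m + l)))"
  have gon: "inner (gs v i) (gs v j) = (if i = j then 1 else 0)" if "i < m + k" "j < m + k" for i j
    using gs_orthonormal[OF resid that] by simp
  have vRN: "v i \<in> RN N" if "i < m + k" for i
    using that N by (auto simp: v_def frame_def trunc_in_RN unit_in_RN)
  have gRN: "gs v i \<in> RN N" if "i < m + k" for i
    by (rule gs_mem_subspace[OF subspace_RN]) (use that vRN in auto)
  obtain e where eg: "\<And>i. i < m + k \<Longrightarrow> e i = gs v i" and eRN: "\<And>i. i < N \<Longrightarrow> e i \<in> RN N"
    and eon: "\<And>i j. i < N \<Longrightarrow> j < N \<Longrightarrow> inner (e i) (e j) = (if i = j then 1 else 0)"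
  proof -
    have "m + k \<le> N" using N by simp
    from orthonormal_extend[of "m + k" "gs v" N, OF gon gRN this] that show thesis by blast
  qed
  \<comment> \<open>The e i with i < m are normal to the section of L, the E l span its directions,
    and C is its point closest to the origin.\<close>
  define E where "E l = e (m + l)" for l
  define C where "C = (\<Sum>i<m. c i *\<^sub>R e i)"
  define r where "r = sqrt R"
  have r2: "r\<^sup>2 = R" using R by (simp add: r_def)
  have Ce: "inner C (e i) = (if i < m then c i else 0)" if "i < N" for i
  proof -
    have "inner C (e i) = (\<Sum>l<m. if l = i then c i else 0)"
      unfolding C_def inner_sum_left using that eon Nmn by (intro sum.cong) auto
    thus ?thesis by simp
  qed
  interpret affine_sphere E C n r
  proof
    show "inner (E i) (E j) = (if i = j then 1 else 0)" if "i < n" "j < n" for i j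
      using that eon Nmn by (simp add: E_def)
    show "inner C (E i) = 0" if "i < n" for i using that Ce[of "m + i"] Nmn by (simp add: E_def)
    show "0 < r" using R by (simp add: r_def)
    show "2 \<le> n" by fact
  qed
  have vec_e: "inner (vec a) (e i) = 0" if "i < m" for a i
    unfolding vec_def inner_sum_left E_def using that eon Nmn by (intro sum.neutral) auto
  \<comment> \<open>Against a point of \<open>RN N\<close>, truncating w i does not change the inner
    product, so the constraints are triangular in the coordinates along e.\<close>
  have L_iff: "x \<in> L \<longleftrightarrow> (\<forall>i<m. inner x (e i) = c i)" if x: "x \<in> RN N" for x
  proof -
    have "inner x (w i) = norm (gs_resid v i) * inner x (e i) + (\<Sum>l<i. inner (v i) (gs v l) * inner x (e l))" if "i < m" for i
    proof -
      have "inner x (w i) = inner x (v i)" using that x by (simp add: v_def frame_def inner_trunc_right)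
      thus ?thesis unfolding inner_gs_decomp[of x v i] using that by (auto simp: eg intro!: sum.cong)
    qed
    hence "x \<in> L \<longleftrightarrow> (\<forall>i<m. norm (gs_resid v i) * inner x (e i) + (\<Sum>l<i. inner (v i) (gs v l) * inner x (e l)) = p i)"
      unfolding L by auto
    also have "\<dots> \<longleftrightarrow> (\<forall>i<m. inner x (e i) = c i)"
      unfolding c_def by (rule forward_subst_eq_iff) (use resid in auto)
    finally show ?thesis .
  qed
  have CC: "inner C C = (\<Sum>i<m. (c i)\<^sup>2)"
  proof -
    have "inner C C = inner C (\<Sum>i<m. c i *\<^sub>R e i)" by (simp only: C_def)
    also have "\<dots> = (\<Sum>i<m. c i * inner C (e i))" by (simp add: inner_sum_right)
    finally show ?thesis using Ce Nmn by (simp add: power2_eq_square)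
  qed
  have norm_Cv: "(norm (C + vec a))\<^sup>2 = (\<Sum>i<m. (c i)\<^sup>2) + (\<Sum>l<n. (a l)\<^sup>2)" for a
  proof -
    have "inner (vec a) C = 0" unfolding C_def inner_sum_right using vec_e by simp
    moreover from this have "inner C (vec a) = 0" by (simp only: inner_commute[of C])
    ultimately show ?thesis unfolding power2_norm_eq_inner inner_add_left inner_add_right CC inner_vec_vec
      by (simp add: power2_eq_square)
  qed
  have S_eq: "L \<inter> RN N \<inter> sphere 0 (sqrt (real N)) = S"
  proof (intro set_eqI iffI)
    fix x assume "x \<in> L \<inter> RN N \<inter> sphere 0 (sqrt (real N))"
    hence xL: "x \<in> L" and xR: "x \<in> RN N" and nx: "norm x = sqrt (real N)" by auto
    define a where "a l = inner x (E l)" for l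
    have "x = (\<Sum>i<N. inner x (e i) *\<^sub>R e i)" by (rule orthonormal_expansion_RN[OF eon eRN xR])
    also have "\<dots> = C + vec a"
      unfolding Nmn sum_lessThan_add vec_def C_def a_def E_def
      using L_iff[OF xR] xL by (intro arg_cong2[where f = "(+)"] sum.cong) auto
    finally have xa: "x = C + vec a" .
    have "real N = (norm x)\<^sup>2" using nx by simp
    hence "(\<Sum>l<n. (a l)\<^sup>2) = r\<^sup>2" using norm_Cv[of a] by (simp add: xa r2 R_def)
    thus "x \<in> S" unfolding S_def xa by blast
  next
    fix x assume "x \<in> S"
    then obtain a where xa: "x = C + vec a" and a: "(\<Sum>l<n. (a l)\<^sup>2) = r\<^sup>2" unfolding S_def by blast
    have xR: "x \<in> RN N" unfolding xa C_def vec_def E_def using eRN Nmn subspace_RN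
      by (intro subspace_add subspace_sum subspace_scale) auto
    have "\<forall>i<m. inner x (e i) = c i" unfolding xa using vec_e Ce Nmn by (simp add: inner_add_left)
    hence "x \<in> L" by (simp only: L_iff[OF xR])
    moreover have "norm x = sqrt (real N)"
      using norm_Cv[of a] by (simp add: xa[symmetric] a r2 R_def real_sqrt_unique)
    ultimately show "x \<in> L \<inter> RN N \<inter> sphere 0 (sqrt (real N))" using xR by simp
  qed
  have Sb: "S \<in> sets borel"
  proof -
    have "closed {x :: ell2. dist 0 x = sqrt (real N)}" by (intro closed_Collect_eq continuous_intros)
    thus ?thesis
      unfolding S_eq[symmetric] L sphere_def by (intro borel_closed closed_Int closed_affine closed_RN)
  qed
  define \<nu> where "\<nu> = distr \<sigma> (borel_fun {..<n}) coords"
  interpret \<sigma>: prob_space \<sigma> by (rule prob_space_\<sigma>[OF Sb])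
  have cm: "coords \<in> measurable \<sigma> (borel_fun {..<n})" by measurable
  have \<nu>: "prob_space \<nu>" "sets \<nu> = sets (borel_fun {..<n})"
    unfolding \<nu>_def by (rule \<sigma>.prob_space_distr[OF cm], simp)
  have rm: "(\<lambda>x. restrict x {..<k}) \<in> measurable (borel_fun {..<n}) (borel_fun {..<k})"
    using kn by (intro measurable_restrict_subset) auto
  have rm\<nu>: "(\<lambda>x. restrict x {..<k}) \<in> measurable \<nu> (borel_fun {..<k})"
    using rm by (simp add: measurable_cong_sets[OF \<nu>(2) refl])
  have marg: "distr \<nu> (borel_fun {..<k}) (\<lambda>x. restrict x {..<k}) = P"
  proof -
    have rad: "radial_char {..<n} \<nu>" unfolding \<nu>_def by (rule radial_char_coords[OF Sb])
    have "AE a in \<nu>. (\<Sum>l<n. (a l)\<^sup>2) = r\<^sup>2" unfolding \<nu>_def by (rule AE_coords[OF Sb])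
    from distr_restrict_radial_sphere[OF \<nu> rad r_pos this k kn]
    show ?thesis unfolding P_def h_def n_def[symmetric] r2[symmetric] .
  qed
  have "prob_space P" unfolding marg[symmetric] by (rule prob_space.prob_space_distr[OF \<nu>(1) rm\<nu>])
  moreover have "(\<integral>x. \<phi> (first_coords k (coord x)) \<partial>\<sigma>) = (\<integral>a. \<phi> (T a) \<partial>P)"
  proof -
    have Tm: "T \<in> measurable (borel_fun {..<k}) (borel_fun {..<k})" unfolding T_def by (rule measurable_lower_map)
    have \<phi>T: "(\<lambda>a. \<phi> (T a)) \<in> borel_measurable (borel_fun {..<k})" by (rule measurable_compose[OF Tm \<phi>])
    have \<phi>Tr: "(\<lambda>a. \<phi> (T (restrict a {..<k}))) \<in> borel_measurable (borel_fun {..<n})"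
      by (rule measurable_compose[OF rm \<phi>T])
    \<comment> \<open>Almost every x lies on the sphere, where its first k entries are the
      triangular image of its first k sphere coordinates.\<close>
    have "(\<integral>x. \<phi> (first_coords k (coord x)) \<partial>\<sigma>) = (\<integral>x. \<phi> (T (restrict (coords x) {..<k})) \<partial>\<sigma>)"
    proof (rule integral_cong_AE)
      show "(\<lambda>x. \<phi> (first_coords k (coord x))) \<in> borel_measurable \<sigma>"
        using measurable_compose[OF measurable_first_coords_coord \<phi>]
        by (simp only: measurable_cong_sets[OF sets_\<sigma> refl])
      show "(\<lambda>x. \<phi> (T (restrict (coords x) {..<k}))) \<in> borel_measurable \<sigma>"
        by (rule measurable_compose[OF cm \<phi>Tr])
      show "AE x in \<sigma>. \<phi> (first_coords k (coord x)) = \<phi> (T (restrict (coords x) {..<k}))"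
        using AE_\<sigma>[OF Sb]
      proof eventually_elim
        case (elim x)
        hence x: "x \<in> L" "x \<in> RN N" by (auto simp: S_eq[symmetric])
        have "T (restrict (coords x) {..<k}) = first_coords k (coord x)"
          unfolding T_def
        proof (rule lower_map_frame)
          show "v (m + j) = unit_ell2 j" for j by (simp add: v_def frame_def)
          show "inner x (gs v i) = c i" if "i < m" for i
          proof -
            have "inner x (e i) = c i" using L_iff[OF x(2)] x(1) that by blast
            thus ?thesis using eg[of i] that by simp
          qed
          show "inner x (gs v (m + l)) = restrict (coords x) {..<k} l" if "l < k" for l
            using that kn eg[of "m + l"] by (simp add: E_def)
        qed
        thus ?case by simp
      qed
    qed
    also have "\<dots> = (\<integral>a. \<phi> (T (restrict a {..<k})) \<partial>\<nu>)"
      unfolding \<nu>_def by (rule integral_distr[OF cm \<phi>Tr, symmetric])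
    also have "\<dots> = (\<integral>a. \<phi> (T a) \<partial>distr \<nu> (borel_fun {..<k}) (\<lambda>x. restrict x {..<k}))"
      by (rule integral_distr[OF rm\<nu> \<phi>T, symmetric])
    finally show ?thesis unfolding marg .
  qed
  ultimately show ?thesis unfolding S_eq T_def n_def by simp
qed

section \<open>The limiting frame and the Gaussian marginal\<close>

lemma gs_orthonormal_prefix:
  assumes on: "\<And>i j. i < m \<Longrightarrow> j < m \<Longrightarrow> inner (v i) (v j) = (if i = j then 1 else 0)"
  shows "i < m \<Longrightarrow> gs v i = v i \<and> gs_resid v i = v i"
proof (induction i rule: less_induct)
  case (less i)
  have "(\<Sum>l<i. inner (v i) (gs v l) *\<^sub>R gs v l) = 0"
    using less on by (intro sum.neutral) auto
  hence "gs_resid v i = v i" by (simp add: gs_resid_def)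
  moreover have "norm (v i) = 1" using on[OF less.prems less.prems] by (simp add: norm_eq_sqrt_inner)
  ultimately show ?case by (simp add: gs_eq)
qed

text \<open>For i = m + j, surjectivity of the projection yields a direction u of L whose first k
  entries form the j-th unit vector. It is orthogonal to every earlier frame vector but has inner
  product 1 with the i-th, which is therefore not in their span.\<close>

lemma gs_resid_frame_nonzero:
  assumes on: "\<And>i j. i < m \<Longrightarrow> j < m \<Longrightarrow> inner (w i) (w j) = (if i = j then 1 else 0)"
    and L: "L = {v. \<forall>i<m. inner v (w i) = p i}"
    and onto: "(\<lambda>z. first_coords k (coord z)) ` L = space (borel_fun {..<k})"
    and i: "i < m + k"
  shows "gs_resid (frame m w) i \<noteq> 0"
proof (cases "i < m")
  case True
  have "gs_resid (frame m w) i = w i" using gs_orthonormal_prefix[of m "frame m w" i] True on by (simp add: frame_def)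
  moreover have "w i \<noteq> 0" using on[OF True True] by auto
  ultimately show ?thesis by simp
next
  case False
  define j where "j = i - m"
  have j: "j < k" "i = m + j" using False i by (auto simp: j_def)
  have "\<exists>z\<in>L. first_coords k (coord z) = restrict f {..<k}" for f
  proof -
    have "restrict f {..<k} \<in> (\<lambda>z. first_coords k (coord z)) ` L" unfolding onto by (simp add: space_PiM)
    then obtain z where z: "restrict f {..<k} = first_coords k (coord z)" "z \<in> L" by (rule imageE)
    show ?thesis by (intro bexI[of _ z] z(1)[symmetric] z(2))
  qed
  then obtain z where z: "\<And>f. z f \<in> L" "\<And>f. first_coords k (coord (z f)) = restrict f {..<k}" by metis
  define u where "u = z (\<lambda>l. if l = j then 1 else 0) - z (\<lambda>_. 0)"
  have uw: "inner u (w l) = 0" if "l < m" for l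
    using that z(1)[of "\<lambda>l. if l = j then 1 else 0"] z(1)[of "\<lambda>_. 0"] by (simp add: u_def L inner_diff_left)
  have uc: "coord u l = (if l = j then 1 else 0)" if "l < k" for l
    using that fun_cong[OF z(2)[of "\<lambda>l. if l = j then 1 else 0"], of l] fun_cong[OF z(2)[of "\<lambda>_. 0"], of l]
    by (simp add: u_def first_coords_def)
  have "inner u (frame m w l) = 0" if "l < i" for l
    using that uw uc j by (auto simp: frame_def inner_unit)
  hence "inner u (gs (frame m w) l) = 0" if "l < i" for l
    using that by (intro gs_ortho) auto
  hence "inner u (gs_resid (frame m w) i) = inner u (frame m w i)"
    by (simp add: gs_resid_def inner_diff_right inner_sum_right)
  also have "\<dots> = 1" using j uc by (simp add: frame_def inner_unit)
  finally show ?thesis by auto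
qed

text \<open>The combination of the w i is orthogonal to its differences from points of L, so by
  Pythagoras a minimizer cannot differ from it.\<close>

lemma closest_point_affine:
  fixes m :: nat
  assumes on: "\<And>i j. i < m \<Longrightarrow> j < m \<Longrightarrow> inner (w i) (w j) = (if i = j then 1 else 0)"
    and L: "L = {v::'a::real_inner. \<forall>i<m. inner v (w i) = p i}"
    and z0: "is_arg_min norm (\<lambda>v. v \<in> L) z0"
  shows "z0 = (\<Sum>i<m. p i *\<^sub>R w i)"
proof -
  let ?z = "\<Sum>i<m. p i *\<^sub>R w i"
  have zw: "inner ?z (w i) = p i" if "i < m" for i
  proof -
    have "inner ?z (w i) = (\<Sum>l<m. if l = i then p i else 0)"
      unfolding inner_sum_left using that on by (intro sum.cong) auto
    thus ?thesis using that by simp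
  qed
  have z0L: "z0 \<in> L" and min: "\<And>y. y \<in> L \<Longrightarrow> norm z0 \<le> norm y"
    using z0 by (auto simp: is_arg_min_def not_less)
  have "inner (z0 - ?z) ?z = 0"
    unfolding inner_sum_right[of _ "\<lambda>i. p i *\<^sub>R w i"] using z0L zw by (intro sum.neutral) (auto simp: L inner_diff_left)
  hence "(norm (?z + (z0 - ?z)))\<^sup>2 = (norm ?z)\<^sup>2 + (norm (z0 - ?z))\<^sup>2"
    unfolding power2_norm_eq_inner by (simp only: inner_add_left inner_add_right inner_commute[of ?z "z0 - ?z"])
  moreover have "norm z0 \<le> norm ?z" by (rule min) (use zw in \<open>simp add: L\<close>)
  hence "(norm z0)\<^sup>2 \<le> (norm ?z)\<^sup>2" by (rule power_mono) simp
  ultimately have "(norm (z0 - ?z))\<^sup>2 \<le> 0" by simp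
  thus ?thesis by simp
qed

lemma orthogonal_projection_eqI:
  assumes "subspace V" "y \<in> V" "\<And>v. v \<in> V \<Longrightarrow> inner (x - y) v = 0"
  shows "orthogonal_projection V x = y"
  unfolding orthogonal_projection_def
proof (rule the_equality)
  fix y' assume y': "y' \<in> V \<and> (\<forall>v\<in>V. inner (x - y') v = 0)"
  hence "y' - y \<in> V" using assms by (simp add: subspace_diff)
  hence "inner (x - y) (y' - y) - inner (x - y') (y' - y) = 0" using assms(3) y' by simp
  hence "inner (y' - y) (y' - y) = 0" by (simp add: inner_diff_left[symmetric])
  thus "y' = y" by simp
qed (use assms in auto)

text \<open>The left side is the law of the first k entries of z0 plus a standard Gaussian
  combination of the vectors \<open>gs v (m + l)\<close>. Its inner product with a frequency in the
  span of the first k unit vectors is normal, with mean that of z0 and variance the squared norm of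
  the projected frequency; these are the two terms in the exponent for \<open>\<mu>\<close>.\<close>

lemma distr_gauss_lower_map_eq:
  fixes m k :: nat and w :: "nat \<Rightarrow> ell2" and \<mu> :: "(nat \<Rightarrow> real) measure"
  defines "v \<equiv> frame m w"
  assumes on: "\<And>i j. i < m \<Longrightarrow> j < m \<Longrightarrow> inner (w i) (w j) = (if i = j then 1 else 0)"
    and L: "L = {v. \<forall>i<m. inner v (w i) = p i}"
    and resid: "\<And>i. i < m + k \<Longrightarrow> gs_resid v i \<noteq> 0"
    and z0: "is_arg_min norm (\<lambda>v. v \<in> L) z0"
    and \<mu>: "prob_space \<mu>" "sets \<mu> = sets (borel_fun UNIV)"
    and char: "\<And>t. t \<in> finitely_supported \<Longrightarrow>
      (\<integral>x. exp (\<i> * complex_of_real (pairing t x)) \<partial>\<mu>) =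
        exp (\<i> * complex_of_real (pairing t (coord z0))
          - complex_of_real ((norm (orthogonal_projection ((\<lambda>v. v - z0) ` L) t))\<^sup>2 / 2))"
  shows "distr (gauss_fun {..<k}) (borel_fun {..<k}) (lower_map k (\<lambda>j. norm (gs_resid v (m + j)))
      (\<lambda>j. \<Sum>i<m. inner (v (m + j)) (gs v i) * p i) (\<lambda>j l. inner (v (m + j)) (gs v (m + l)))) =
    distr \<mu> (borel_fun {..<k}) (first_coords k)"
    (is "distr _ _ ?T = _")
proof (rule char_fun_unique)
  let ?g = "\<lambda>l. gs v (m + l)"
  have v_unit: "v (m + j) = unit_ell2 j" for j by (simp add: v_def frame_def)
  have vw: "v i = w i" if "i < m" for i using that by (simp add: v_def frame_def)
  have gw: "gs v i = w i" if "i < m" for i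
    using gs_orthonormal_prefix[of m v i] that on vw by simp
  have gon: "inner (gs v i) (gs v j) = (if i = j then 1 else 0)" if "i < m + k" "j < m + k" for i j
    using gs_orthonormal[OF resid that] by simp
  have z0_eq: "z0 = (\<Sum>i<m. p i *\<^sub>R w i)" by (rule closest_point_affine[OF on L z0])
  have fm: "first_coords k \<in> measurable \<mu> (borel_fun {..<k})"
  proof -
    have "first_coords k \<in> measurable (borel_fun UNIV) (borel_fun {..<k})"
      unfolding first_coords_def by (intro measurable_restrict_subset) auto
    thus ?thesis by (simp only: measurable_cong_sets[OF \<mu>(2) refl])
  qed
  have Tm: "?T \<in> measurable (gauss_fun {..<k}) (borel_fun {..<k})" by measurable
  show "prob_space (distr (gauss_fun {..<k}) (borel_fun {..<k}) ?T)"
    by (rule prob_space.prob_space_distr[OF prob_space_gauss_fun Tm])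
  show "prob_space (distr \<mu> (borel_fun {..<k}) (first_coords k))"
    by (rule prob_space.prob_space_distr[OF \<mu>(1) fm])
  fix t :: "nat \<Rightarrow> real"
  \<comment> \<open>The finitely supported sequence with entries t, at which the hypothesis on the
    characteristic function of \<open>\<mu>\<close> is used.\<close>
  define \<tau> where "\<tau> = (\<Sum>j<k. t j *\<^sub>R unit_ell2 j)"
  have c\<tau>: "coord \<tau> j = (if j < k then t j else 0)" for j
  proof -
    have "coord \<tau> j = (\<Sum>i<k. if j = i then t i else 0)"
      unfolding \<tau>_def coord_sum by (intro sum.cong) (auto simp: coord_unit)
    thus ?thesis by simp
  qed
  have inner\<tau>: "inner x \<tau> = (\<Sum>j<k. t j * coord x j)" for x
    unfolding \<tau>_def inner_sum_right by (simp add: inner_unit)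
  have pair\<tau>: "pairing \<tau> x = (\<Sum>j<k. t j * x j)" for x
  proof -
    have "pairing \<tau> x = (\<Sum>j\<in>{j. coord \<tau> j \<noteq> 0}. t j * x j)"
      unfolding pairing_def by (intro sum.cong) (auto simp: c\<tau> split: if_splits)
    also have "\<dots> = (\<Sum>j<k. t j * x j)"
      by (rule sum.mono_neutral_left) (auto simp: c\<tau> split: if_splits)
    finally show ?thesis .
  qed
  define V where "V = (\<lambda>v. v - z0) ` L"
  have V: "V = {u. \<forall>i<m. inner u (w i) = 0}"
  proof -
    have zL: "\<forall>i<m. inner z0 (w i) = p i" using z0 by (simp add: is_arg_min_def L)
    show ?thesis unfolding V_def
    proof (intro set_eqI iffI)
      fix u assume "u \<in> {u. \<forall>i<m. inner u (w i) = 0}"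
      hence "u + z0 \<in> L" using zL by (simp add: L inner_add_left)
      thus "u \<in> (\<lambda>v. v - z0) ` L" by (auto intro!: image_eqI[of _ _ "u + z0"])
    qed (use zL in \<open>auto simp: L inner_diff_left\<close>)
  qed
  have sV: "subspace V" unfolding V by (auto simp: subspace_def inner_add_left)
  \<comment> \<open>The first k unit vectors lie in the span of the Gram-Schmidt vectors; W is that
    span, described by the expansion itself.\<close>
  have exp\<tau>: "\<tau> = (\<Sum>i<m + k. inner \<tau> (gs v i) *\<^sub>R gs v i)"
  proof -
    define W where "W = {x. x = (\<Sum>i<m + k. inner x (gs v i) *\<^sub>R gs v i)}"
    have sW: "subspace W"
    proof (rule subspaceI)
      fix c x assume "x \<in> W"
      hence "c *\<^sub>R x = c *\<^sub>R (\<Sum>i<m + k. inner x (gs v i) *\<^sub>R gs v i)" unfolding W_def by simp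
      thus "c *\<^sub>R x \<in> W"
        unfolding W_def mem_Collect_eq inner_scaleR_left by (simp only: scaleR_sum_right scaleR_scaleR)
    qed (auto simp: W_def inner_add_left scaleR_add_left sum.distrib)
    have gW: "gs v l \<in> W" if "l < m + k" for l
    proof -
      have "(\<Sum>i<m + k. inner (gs v l) (gs v i) *\<^sub>R gs v i) = (\<Sum>i<m + k. if i = l then gs v l else 0)"
        using that gon by (intro sum.cong) auto
      thus ?thesis using that by (simp add: W_def)
    qed
    have "unit_ell2 j \<in> W" if "j < k" for j
      unfolding v_unit[symmetric]
      by (subst gs_decomp, intro subspace_add[OF sW] subspace_sum[OF sW] subspace_scale[OF sW] gW) (use that in auto)
    hence "\<tau> \<in> W" unfolding \<tau>_def by (intro subspace_sum[OF sW] subspace_scale[OF sW]) auto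
    thus ?thesis by (simp add: W_def)
  qed
  \<comment> \<open>The component of \<tau> along the Gram-Schmidt vectors beyond the first m: it
    lies in V, and \<tau> - y is a combination of the w i, hence orthogonal to V.\<close>
  define y where "y = (\<Sum>l<k. inner \<tau> (?g l) *\<^sub>R ?g l)"
  have \<tau>y: "\<tau> - y = (\<Sum>i<m. inner \<tau> (w i) *\<^sub>R w i)"
  proof -
    have "\<tau> = (\<Sum>i<m. inner \<tau> (gs v i) *\<^sub>R gs v i) + y" unfolding y_def using exp\<tau> by (simp only: sum_lessThan_add)
    moreover have "(\<Sum>i<m. inner \<tau> (gs v i) *\<^sub>R gs v i) = (\<Sum>i<m. inner \<tau> (w i) *\<^sub>R w i)"
      by (intro sum.cong) (auto simp: gw)
    ultimately show ?thesis by (metis add_diff_cancel_right')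
  qed
  have proj: "orthogonal_projection V \<tau> = y"
  proof (rule orthogonal_projection_eqI[OF sV])
    have "inner (?g l) (w i) = 0" if "l < k" "i < m" for l i using gon[of "m + l" i] gw that by simp
    thus "y \<in> V" unfolding V y_def by (auto simp: inner_sum_left)
    show "inner (\<tau> - y) u = 0" if "u \<in> V" for u
      unfolding \<tau>y inner_sum_left using that by (intro sum.neutral) (auto simp: V inner_commute[of u])
  qed
  have ny: "(norm y)\<^sup>2 = (\<Sum>l<k. (inner \<tau> (?g l))\<^sup>2)"
  proof -
    have "inner y (?g l) = inner \<tau> (?g l)" if "l < k" for l
    proof -
      have "inner y (?g l) = (\<Sum>i<k. if i = l then inner \<tau> (?g l) else 0)"
        unfolding y_def inner_sum_left using that gon by (intro sum.cong) auto
      thus ?thesis using that by simp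
    qed
    hence "(\<Sum>l<k. inner y (inner \<tau> (?g l) *\<^sub>R ?g l)) = (\<Sum>l<k. (inner \<tau> (?g l))\<^sup>2)"
      by (intro sum.cong) (auto simp: power2_eq_square)
    thus ?thesis unfolding power2_norm_eq_inner by (subst (2) y_def) (simp only: inner_sum_right)
  qed
  have "char_fun {..<k} (distr \<mu> (borel_fun {..<k}) (first_coords k)) t = (CLINT x|\<mu>. iexp (\<Sum>j<k. t j * first_coords k x j))"
    unfolding char_fun_def by (rule integral_distr[OF fm]) measurable
  also have "\<dots> = (CLINT x|\<mu>. iexp (pairing \<tau> x))" unfolding pair\<tau> by (simp add: first_coords_def)
  also have "\<dots> = exp (\<i> * complex_of_real (pairing \<tau> (coord z0)) - complex_of_real ((norm y)\<^sup>2 / 2))"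
    using char[of \<tau>] unfolding V_def[symmetric] proj by (auto simp: finitely_supported_def c\<tau>)
  also have "\<dots> = iexp (inner z0 \<tau>) * complex_of_real (exp (- (\<Sum>l<k. (inner \<tau> (?g l))\<^sup>2) / 2))"
  proof -
    have "exp (\<i> * complex_of_real a - complex_of_real b) = iexp a * complex_of_real (exp (- b))" for a b
      by (simp add: exp_diff exp_minus exp_of_real divide_inverse)
    thus ?thesis unfolding pair\<tau> inner\<tau> ny by (simp only: minus_divide_left)
  qed
  also have "\<dots> = iexp (inner z0 \<tau>) * char_fun {..<k} (gauss_fun {..<k}) (\<lambda>l. inner \<tau> (?g l))"
    by (simp add: char_fun_gauss)
  also have "\<dots> = (CLINT a|gauss_fun {..<k}. iexp (inner z0 \<tau>) * iexp (\<Sum>l<k. inner \<tau> (?g l) * a l))"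
    unfolding char_fun_def by (rule integral_mult_right_zero[symmetric])
  also have "\<dots> = (CLINT a|gauss_fun {..<k}. iexp (\<Sum>j<k. t j * ?T a j))"
  proof (rule Bochner_Integration.integral_cong[OF refl])
    fix a :: "nat \<Rightarrow> real"
    \<comment> \<open>The point of L with free coordinates a; its first k entries are
      \<open>?T a\<close>, so pairing these with t is taking the inner product of x with
      \<tau>.\<close>
    define x where "x = z0 + (\<Sum>l<k. a l *\<^sub>R ?g l)"
    have T: "?T a = first_coords k (coord x)"
    proof (rule lower_map_frame[OF v_unit])
      show "inner x (gs v i) = p i" if "i < m" for i
      proof -
        have "inner z0 (w i) = p i" using z0 that by (simp add: is_arg_min_def L)
        moreover have "(\<Sum>l<k. a l * inner (?g l) (gs v i)) = 0"
          using that gon by (intro sum.neutral) auto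
        ultimately show ?thesis using gw[OF that] by (simp add: x_def inner_add_left inner_sum_left)
      qed
      show "inner x (?g l) = a l" if "l < k" for l
      proof -
        have "inner (w i) (?g l) = 0" if "i < m" for i
          using gon[of i "m + l"] gw[OF that] that \<open>l < k\<close> by simp
        hence "inner z0 (?g l) = 0"
          unfolding z0_eq inner_sum_left by (intro sum.neutral) auto
        moreover have "(\<Sum>i<k. a i * inner (?g i) (?g l)) = (\<Sum>i<k. if i = l then a l else 0)"
          using that gon by (intro sum.cong) auto
        ultimately show ?thesis using that by (simp add: x_def inner_add_left inner_sum_left)
      qed
    qed
    have "(\<Sum>j<k. t j * ?T a j) = inner x \<tau>" unfolding T inner\<tau> by (simp add: first_coords_def)
    also have "\<dots> = inner z0 \<tau> + (\<Sum>l<k. inner \<tau> (?g l) * a l)"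
      unfolding x_def inner_add_left inner_sum_left inner_scaleR_left
      by (simp add: inner_commute[of \<tau>] mult.commute)
    finally show "iexp (inner z0 \<tau>) * iexp (\<Sum>l<k. inner \<tau> (?g l) * a l) = iexp (\<Sum>j<k. t j * ?T a j)"
      by (simp only: of_real_add distrib_left exp_add)
  qed
  also have "\<dots> = char_fun {..<k} (distr (gauss_fun {..<k}) (borel_fun {..<k}) ?T) t"
    unfolding char_fun_def by (rule integral_distr[OF Tm, symmetric]) measurable
  finally show "char_fun {..<k} (distr (gauss_fun {..<k}) (borel_fun {..<k}) ?T) t =
      char_fun {..<k} (distr \<mu> (borel_fun {..<k}) (first_coords k)) t" by simp
qed simp_all

section \<open>Passage to the limit in N\<close>

theorem theorem2p1:
  fixes m k :: nat
    and w :: "nat \<Rightarrow> ell2"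
    and p :: "nat \<Rightarrow> real"
    and L :: "ell2 set"
    and \<phi> :: "(nat \<Rightarrow> real) \<Rightarrow> real"
    and \<mu> :: "(nat \<Rightarrow> real) measure"
    and z0 :: ell2
  assumes orthonormal: "\<And>i j. i < m \<Longrightarrow> j < m \<Longrightarrow> inner (w i) (w j) = (if i = j then 1 else 0)"
    and L_eq: "L = {v. \<forall>i<m. inner v (w i) = p i}"
    and k_pos: "0 < k"
    and projection_onto: "(\<lambda>z. first_coords k (coord z)) ` L = space (PiM {..<k} (\<lambda>_. borel :: real measure))"
    and \<phi>_borel: "\<phi> \<in> borel_measurable (PiM {..<k} (\<lambda>_. borel))"
    and \<phi>_bounded: "bounded (\<phi> ` space (PiM {..<k} (\<lambda>_. borel :: real measure)))"
    and z0_closest: "is_arg_min norm (\<lambda>v. v \<in> L) z0"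
    and \<mu>_prob: "prob_space \<mu>"
    and \<mu>_sets: "sets \<mu> = sets (PiM UNIV (\<lambda>_. borel))"
    and \<mu>_char: "\<And>t. t \<in> finitely_supported \<Longrightarrow>
      (\<integral>x. exp (\<i> * complex_of_real (pairing t x)) \<partial>\<mu>) =
        exp (\<i> * complex_of_real (pairing t (coord z0))
          - complex_of_real ((norm (orthogonal_projection ((\<lambda>v. v - z0) ` L) t))\<^sup>2 / 2))"
  shows "(\<lambda>N. \<integral>x. \<phi> (first_coords k (coord x))
             \<partial>normalized_surface_measure (N - m - 1) (L \<inter> RN N \<inter> sphere 0 (sqrt (real N))))
         \<longlonglongrightarrow> (\<integral>z. \<phi> (first_coords k z) \<partial>\<mu>)"
proof -
  let ?L = "\<lambda>N. L \<inter> RN N \<inter> sphere 0 (sqrt (real N))"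
  define v where "v N = frame m (\<lambda>i. trunc_ell2 N (w i))" for N
  define v' where "v' = frame m w"
  \<comment> \<open>Truncation fixes a unit vector once N exceeds its index, so for fixed i and j
    the inner product is eventually that of truncations of the limiting vectors, a partial
    sum.\<close>
  have lim: "(\<lambda>N. inner (v N i) (v N j)) \<longlonglongrightarrow> inner (v' i) (v' j)" for i j
  proof (rule Lim_transform_eventually[OF tendsto_inner_trunc])
    have "v N i = trunc_ell2 N (v' i)" if "i < N" for N i
      using that by (simp add: v_def v'_def frame_def trunc_eq unit_in_RN)
    thus "\<forall>\<^sub>F N in sequentially. inner (trunc_ell2 N (v' i)) (trunc_ell2 N (v' j)) = inner (v N i) (v N j)"
      by (intro eventually_sequentiallyI[of "Suc (max i j)"]) auto
  qed
  have resid': "gs_resid v' i \<noteq> 0" if "i < m + k" for i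
    unfolding v'_def by (rule gs_resid_frame_nonzero[OF orthonormal L_eq projection_onto that])
  have gs_lim: "(\<forall>\<^sub>F N in sequentially. gs_resid (v N) i \<noteq> 0) \<and>
      (\<lambda>N. norm (gs_resid (v N) i)) \<longlonglongrightarrow> norm (gs_resid v' i) \<and>
      (\<forall>j. (\<lambda>N. inner (v N j) (gs (v N) i)) \<longlonglongrightarrow> inner (v' j) (gs v' i))" if "i < m + k" for i
    by (rule gs_tendsto[OF lim _ that]) (rule resid')
  define \<rho> where "\<rho> N i = norm (gs_resid (v N) i)" for N i
  define G where "G N i l = inner (v N i) (gs (v N) l)" for N i l
  define \<rho>' where "\<rho>' i = norm (gs_resid v' i)" for i
  define G' where "G' i l = inner (v' i) (gs v' l)" for i l
  have \<rho>_lim: "(\<lambda>N. \<rho> N i) \<longlonglongrightarrow> \<rho>' i" if "i < m + k" for i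
    using gs_lim[OF that] by (simp add: \<rho>_def \<rho>'_def)
  have G_lim: "(\<lambda>N. G N i l) \<longlonglongrightarrow> G' i l" if "l < m + k" for i l
    using gs_lim[OF that] by (simp add: G_def G'_def)
  have \<rho>'_pos: "0 < \<rho>' i" if "i < m + k" for i using resid'[OF that] by (simp add: \<rho>'_def)
  define c where "c N = forward_subst (\<rho> N) (\<lambda>_. 0) (G N) p" for N
  \<comment> \<open>The first m limiting frame vectors are orthonormal, so the limiting triangular
    system has the identity matrix and solution p.\<close>
  have c_lim: "(\<lambda>N. c N i) \<longlonglongrightarrow> p i" if i: "i < m" for i
  proof -
    have "\<rho>' j \<noteq> 0" if "j < m" for j using \<rho>'_pos[of j] that by simp
    hence "(\<lambda>N. c N i) \<longlonglongrightarrow> forward_subst \<rho>' (\<lambda>_. 0) G' p i"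
      unfolding c_def using i by (intro tendsto_forward_subst[where k = m] \<rho>_lim G_lim tendsto_const) auto
    moreover have on': "inner (v' j) (v' l) = (if j = l then 1 else 0)" if "j < m" "l < m" for j l
      using that orthonormal by (simp add: v'_def frame_def)
    have "G' i l = 0" if "l < i" for l
      using that i on'[of i l] gs_orthonormal_prefix[of m v' l, OF on'] by (simp add: G'_def)
    moreover have "\<rho>' i = 1"
      using on'[OF i i] gs_orthonormal_prefix[of m v' i, OF on' i] by (simp add: \<rho>'_def norm_eq_sqrt_inner)
    ultimately show ?thesis by (simp add: forward_subst.simps[of _ _ _ _ i])
  qed
  define R where "R N = real N - (\<Sum>i<m. (c N i)\<^sup>2)" for N
  define q where "q N = real (N - m - k) / 2 - 1" for N
  have s_lim: "(\<lambda>N. \<Sum>i<m. (c N i)\<^sup>2) \<longlonglongrightarrow> (\<Sum>i<m. (p i)\<^sup>2)"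
    by (intro tendsto_sum tendsto_power c_lim) simp
  have R_top: "filterlim R at_top sequentially"
  proof -
    have "filterlim (\<lambda>N. - (\<Sum>i<m. (c N i)\<^sup>2) + real N) at_top sequentially"
      by (rule filterlim_tendsto_add_at_top[OF tendsto_minus[OF s_lim] filterlim_real_sequentially])
    thus ?thesis by (simp add: R_def[abs_def])
  qed
  have R_pos: "\<forall>\<^sub>F N in sequentially. 0 < R N"
    using R_top by (simp add: filterlim_at_top_dense)
  \<comment> \<open>Here 2 q N equals R N plus the sum of the (c N i)^2 minus m + k + 2 for large N,
    and this correction stays bounded while R N tends to infinity.\<close>
  have qR: "(\<lambda>N. q N / R N) \<longlonglongrightarrow> 1 / 2"
  proof (rule Lim_transform_eventually)
    have "(\<lambda>N. ((\<Sum>i<m. (c N i)\<^sup>2) - real (m + k + 2)) / R N) \<longlonglongrightarrow> 0"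
      by (rule real_tendsto_divide_at_top[OF tendsto_diff[OF s_lim tendsto_const] R_top])
    hence "(\<lambda>N. (1 + ((\<Sum>i<m. (c N i)\<^sup>2) - real (m + k + 2)) / R N) / 2) \<longlonglongrightarrow> (1 + 0) / 2"
      by (intro tendsto_intros) auto
    thus "(\<lambda>N. (1 + ((\<Sum>i<m. (c N i)\<^sup>2) - real (m + k + 2)) / R N) / 2) \<longlonglongrightarrow> 1 / 2" by simp
    show "\<forall>\<^sub>F N in sequentially. (1 + ((\<Sum>i<m. (c N i)\<^sup>2) - real (m + k + 2)) / R N) / 2 = q N / R N"
      using R_pos eventually_ge_at_top[of "m + k + 2"]
    proof eventually_elim
      case (elim N)
      have "q N = (R N + ((\<Sum>i<m. (c N i)\<^sup>2) - real (m + k + 2))) / 2"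
        using elim by (simp add: q_def R_def of_nat_diff field_simps)
      thus ?case using elim by (simp add: add_divide_distrib)
    qed
  qed
  \<comment> \<open>Vanishing residuals, too small N and nonpositive R N are confined to finitely
    many N, and 1 / 4 lies below the limit 1 / 2 of the ratio. Shifting by N0 makes the hypotheses
    hold at every index; \<open>LIMSEQ_offset\<close> undoes the shift at the end.\<close>
  have "\<forall>\<^sub>F N in sequentially. (\<forall>i\<in>{..<m + k}. gs_resid (v N) i \<noteq> 0) \<and> m + k + 3 \<le> N \<and> 0 < R N \<and> 1 / 4 < q N / R N"
    using R_pos eventually_ge_at_top[of "m + k + 3"] order_tendstoD(1)[OF qR, of "1 / 4"] gs_lim
    by (intro eventually_conj eventually_ball_finite) auto
  then obtain N0 where N0: "\<And>N. N \<ge> N0 \<Longrightarrow>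
      (\<forall>i\<in>{..<m + k}. gs_resid (v N) i \<noteq> 0) \<and> m + k + 3 \<le> N \<and> 0 < R N \<and> 1 / 4 < q N / R N"
    unfolding eventually_sequentially by blast
  have good: "gs_resid (v (N + N0)) i \<noteq> 0" if "i < m + k" for N i using N0[of "N + N0"] that by simp
  have good2: "m + k + 3 \<le> N + N0" "0 < R (N + N0)" "1 / 4 \<le> q (N + N0) / R (N + N0)" for N
    using N0[OF le_add2, of N] by (blast intro: less_imp_le)+
  obtain B where B: "\<bar>\<phi> y\<bar> \<le> B" if "y \<in> space (borel_fun {..<k})" for y
    using \<phi>_bounded unfolding bounded_iff by (auto simp: real_norm_def)
  define P where "P N = density (lebesgue_fun {..<k}) (\<lambda>y. ennreal (max 0 (R N - (\<Sum>i<k. (y i)\<^sup>2)) powr q N /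
        (\<integral>y. max 0 (R N - (\<Sum>i<k. (y i)\<^sup>2)) powr q N \<partial>lebesgue_fun {..<k})))" for N
  define T where "T N = lower_map k (\<lambda>j. \<rho> N (m + j)) (\<lambda>j. \<Sum>i<m. G N (m + j) i * c N i) (\<lambda>j l. G N (m + j) (m + l))" for N
  define T' where "T' = lower_map k (\<lambda>j. \<rho>' (m + j)) (\<lambda>j. \<Sum>i<m. G' (m + j) i * p i) (\<lambda>j l. G' (m + j) (m + l))"
  have surface: "prob_space (P (N + N0)) \<and>
      (\<integral>x. \<phi> (first_coords k (coord x)) \<partial>normalized_surface_measure ((N + N0) - m - 1) (?L (N + N0))) =
      (\<integral>a. \<phi> (T (N + N0) a) \<partial>P (N + N0))" for N
    unfolding P_def T_def R_def q_def c_def \<rho>_def[abs_def] G_def[abs_def] v_def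
    by (rule surface_integral_eq[OF _ _ k_pos _ \<phi>_borel L_eq])
       (use good good2 in \<open>simp_all add: R_def c_def \<rho>_def[abs_def] G_def[abs_def] v_def\<close>)
  have "(\<lambda>N. \<integral>a. \<phi> (T (N + N0) a) \<partial>P (N + N0)) \<longlonglongrightarrow> (\<integral>a. \<phi> (T' a) \<partial>gauss_fun {..<k})"
    unfolding T_def T'_def
  proof (rule density_lower_map_tendsto[where R = "\<lambda>N. R (N + N0)" and p = "\<lambda>N. q (N + N0)" and B = B])
    show "filterlim (\<lambda>N. R (N + N0)) at_top sequentially"
      by (rule filterlim_compose[OF R_top filterlim_add_const_nat_at_top])
    show "(\<lambda>N. q (N + N0) / R (N + N0)) \<longlonglongrightarrow> 1 / 2"
      by (rule LIMSEQ_ignore_initial_segment[OF qR])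
    show "0 \<le> q (N + N0)" for N
    proof -
      have "2 \<le> N + N0 - m - k" using good2(1)[of N] by simp
      hence "2 \<le> real (N + N0 - m - k)" by linarith
      thus ?thesis by (simp add: q_def)
    qed
    show "0 < \<rho> (N + N0) (m + j)" if "j < k" for N j using good[of "m + j"] that by (simp add: \<rho>_def)
    show "(\<lambda>N. \<rho> (N + N0) (m + j)) \<longlonglongrightarrow> \<rho>' (m + j)" if "j < k" for j
      using that by (intro LIMSEQ_ignore_initial_segment[OF \<rho>_lim]) simp
    show "(\<lambda>N. \<Sum>i<m. G (N + N0) (m + j) i * c (N + N0) i) \<longlonglongrightarrow> (\<Sum>i<m. G' (m + j) i * p i)" for j
      by (intro tendsto_sum tendsto_mult LIMSEQ_ignore_initial_segment[OF G_lim] LIMSEQ_ignore_initial_segment[OF c_lim]) auto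
    show "(\<lambda>N. G (N + N0) (m + j) (m + l)) \<longlonglongrightarrow> G' (m + j) (m + l)" if "l < j" "j < k" for j l
      using that by (intro LIMSEQ_ignore_initial_segment[OF G_lim]) simp
  qed (use good2 \<rho>'_pos surface B \<phi>_borel in \<open>auto simp: P_def\<close>)
  hence "(\<lambda>N. \<integral>x. \<phi> (first_coords k (coord x)) \<partial>normalized_surface_measure ((N + N0) - m - 1) (?L (N + N0)))
      \<longlonglongrightarrow> (\<integral>a. \<phi> (T' a) \<partial>gauss_fun {..<k})"
    using surface by simp
  also have "(\<integral>a. \<phi> (T' a) \<partial>gauss_fun {..<k}) = (\<integral>y. \<phi> y \<partial>distr (gauss_fun {..<k}) (borel_fun {..<k}) T')"
    by (rule integral_distr[OF _ \<phi>_borel, symmetric]) (simp add: T'_def)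
  also have "distr (gauss_fun {..<k}) (borel_fun {..<k}) T' = distr \<mu> (borel_fun {..<k}) (first_coords k)"
    unfolding T'_def \<rho>'_def G'_def v'_def
    by (rule distr_gauss_lower_map_eq[OF orthonormal L_eq _ z0_closest \<mu>_prob \<mu>_sets \<mu>_char])
       (use resid' in \<open>simp_all add: v'_def\<close>)
  also have "(\<integral>y. \<phi> y \<partial>distr \<mu> (borel_fun {..<k}) (first_coords k)) = (\<integral>z. \<phi> (first_coords k z) \<partial>\<mu>)"
  proof (rule integral_distr[OF _ \<phi>_borel])
    have "first_coords k \<in> measurable (borel_fun UNIV) (borel_fun {..<k})"
      unfolding first_coords_def by (intro measurable_restrict_subset) auto
    thus "first_coords k \<in> measurable \<mu> (borel_fun {..<k})" by (simp only: measurable_cong_sets[OF \<mu>_sets refl])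
  qed
  finally show ?thesis by (rule LIMSEQ_offset)
qed

end
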